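(* Let $\widetilde T\le\mathrm{Homeo}_+(\mathbb R)$ denote the lift to the real line of Thompson's group $T$ acting on $\mathbb R/\mathbb Z$ (a central extension of $T$ by $\mathbb Z$). Every action of $\widetilde T$ by homeomorphisms of the real line, without global fixed points, is semi-conjugate to the standard action of $\widetilde T$ on $\mathbb R$, i.e. the action lifting the action of $T$ on the circle.
   Context: Thompson's group $T$ is the group of orientation-preserving homeomorphisms of $\mathbb S^1=\mathbb R/\mathbb Z$ that are piecewise linear with finitely many breakpoints, all breakpoints being dyadic rationals (numbers $p/2^q$, $p,q\in\mathbb Z$), and whose affine pieces are of the form $x\mapsto2^mx+b$ with $m\in\mathbb Z$ and $b$ a dyadic rational. $\widetilde T$ consists of all homeomorphisms of $\mathbb R$ that commute with integer translations and are lifts of elements of $T$; explicitly, those commuting with integer translations and which are piecewise linear dyadic (affine pieces of the form $x\mapsto 2^mx+b$ with $m\in\mathbb Z$ and $b$ a dyadic rational, and all breakpoints dyadic rationals) with a possibly infinite, discrete closed set of breakpoints. Semi-conjugacy: an action $\rho_1\colon G\to\mathrm{Homeo}_+(\mathbb R)$ is semi-conjugate to $\rho_2\colon G\to\mathrm{Homeo}_+(\mathbb R)$ if there is a weakly monotone (non-decreasing or non-increasing) proper map $h\colon\mathbb R\to\mathbb R$ with $h\,\rho_1(g)=\rho_2(g)\,h$ for all $g\in G$; when $\rho_2$ is minimal, such an $h$ is automatically continuous and surjective. Since $\widetilde T$ is perfect, all its actions on $\mathbb R$ preserve orientation. *)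

theory Defs
  imports "HOL-Analysis.Analysis" "HOL-Algebra.Group"
begin

definition homeo_line :: "(real \<Rightarrow> real) monoid" where
  "homeo_line = \<lparr>carrier = {f. \<exists>g. homeomorphism UNIV UNIV f g}, mult = (\<circ>), one = id\<rparr>"

definition homeo_line_plus :: "(real \<Rightarrow> real) monoid" where
  "homeo_line_plus = homeo_line\<lparr>carrier := {f \<in> carrier homeo_line. strict_mono f}\<rparr>"

definition dyadic :: "real set" where
  "dyadic = {of_int p / 2 powi q | p q :: int. True}"

(* B contains all breakpoints of f; it may contain further points, at which f is affine.
   For a homeomorphism this does not enlarge the class: the set of actual breakpoints is then
   a closed discrete subset of B, and pieces that meet at a point which is not a breakpoint
   are given by the same formula. *)
definition pl_dyadic :: "(real \<Rightarrow> real) \<Rightarrow> bool" where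
  "pl_dyadic f \<longleftrightarrow> (\<exists>B. closed B \<and> discrete B \<and> B \<subseteq> dyadic \<and>
     (\<forall>C \<in> components (- B). \<exists>m::int. \<exists>b \<in> dyadic. \<forall>x \<in> C. f x = 2 powi m * x + b))"

definition T_tilde :: "(real \<Rightarrow> real) monoid" where
  "T_tilde = homeo_line\<lparr>carrier := {f \<in> carrier homeo_line.
     (\<forall>x. \<forall>n::int. f (x + of_int n) = f x + of_int n) \<and> pl_dyadic f}\<rparr>"

definition no_global_fixed_point ::
  "('g, 'm) monoid_scheme \<Rightarrow> ('g \<Rightarrow> real \<Rightarrow> real) \<Rightarrow> bool" where
  "no_global_fixed_point G \<rho> \<longleftrightarrow> \<not> (\<exists>x. \<forall>g \<in> carrier G. \<rho> g x = x)"

(* The map h of a semi-conjugacy need not be continuous, so preimages of compact sets need not be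
   closed; properness means that they are relatively compact. *)
definition semi_conjugate ::
  "('g, 'm) monoid_scheme \<Rightarrow> ('g \<Rightarrow> real \<Rightarrow> real) \<Rightarrow> ('g \<Rightarrow> real \<Rightarrow> real) \<Rightarrow> bool" where
  "semi_conjugate G \<rho>\<^sub>1 \<rho>\<^sub>2 \<longleftrightarrow>
     \<rho>\<^sub>1 \<in> hom G homeo_line_plus \<and> \<rho>\<^sub>2 \<in> hom G homeo_line_plus \<and>
     (\<exists>h :: real \<Rightarrow> real. (mono h \<or> antimono h) \<and>
        (\<forall>K. compact K \<longrightarrow> compact (closure (h -` K))) \<and>
        (\<forall>g \<in> carrier G. h \<circ> \<rho>\<^sub>1 g = \<rho>\<^sub>2 g \<circ> h))"

lemma group_homeo_line: "group homeo_line"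
proof (rule groupI)
  fix f g assume "f \<in> carrier homeo_line" "g \<in> carrier homeo_line"
  then show "f \<otimes>\<^bsub>homeo_line\<^esub> g \<in> carrier homeo_line"
    by (auto simp: homeo_line_def intro: homeomorphism_compose)
next
  fix f assume "f \<in> carrier homeo_line"
  then obtain g where g: "homeomorphism UNIV UNIV f g" by (auto simp: homeo_line_def)
  then have "g \<circ> f = id" by (auto simp: homeomorphism_def)
  moreover have "homeomorphism UNIV UNIV g f" using g by (simp add: homeomorphism_symD)
  ultimately show "\<exists>g \<in> carrier homeo_line. g \<otimes>\<^bsub>homeo_line\<^esub> f = \<one>\<^bsub>homeo_line\<^esub>"
    by (auto simp: homeo_line_def)
next
  show "\<one>\<^bsub>homeo_line\<^esub> \<in> carrier homeo_line"
    by (auto simp: homeo_line_def homeomorphism_def intro!: exI[of _ id])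
qed (auto simp: homeo_line_def)

lemma homeo_lineI: "homeomorphism UNIV UNIV f g \<Longrightarrow> f \<in> carrier homeo_line"
  "homeomorphism UNIV UNIV f g \<Longrightarrow> g \<in> carrier homeo_line"
  using homeomorphism_symD by (fastforce simp: homeo_line_def)+

lemma inv_homeo_line:
  assumes "homeomorphism UNIV UNIV f g"
  shows "inv\<^bsub>homeo_line\<^esub> f = g"
proof -
  have "g \<otimes>\<^bsub>homeo_line\<^esub> f = \<one>\<^bsub>homeo_line\<^esub>"
    using assms by (auto simp: homeo_line_def homeomorphism_def)
  moreover have "f \<in> carrier homeo_line" "g \<in> carrier homeo_line"
    using assms homeo_lineI by blast+
  ultimately show ?thesis using group.inv_equality[OF group_homeo_line] by blast
qed

lemma subgroup_homeo_line_plus: "subgroup (carrier homeo_line_plus) homeo_line"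
proof (rule group.subgroupI[OF group_homeo_line])
  show "carrier homeo_line_plus \<subseteq> carrier homeo_line" by (auto simp: homeo_line_plus_def)
  have "id \<in> carrier homeo_line"
    using group.is_monoid[OF group_homeo_line, THEN monoid.one_closed] by (simp add: homeo_line_def)
  then show "carrier homeo_line_plus \<noteq> {}"
    by (auto simp: homeo_line_plus_def strict_mono_def intro!: exI[of _ id])
next
  fix f assume f: "f \<in> carrier homeo_line_plus"
  then obtain g where g: "homeomorphism UNIV UNIV f g" "strict_mono f"
    by (auto simp: homeo_line_plus_def homeo_line_def)
  have "strict_mono g"
  proof (rule strict_monoI)
    fix x y :: real assume "x < y"
    moreover have "f (g x) = x" "f (g y) = y" using g(1) by (auto simp: homeomorphism_def)
    ultimately show "g x < g y" using strict_mono_less[OF g(2), of "g x" "g y"] by simp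
  qed
  then show "inv\<^bsub>homeo_line\<^esub> f \<in> carrier homeo_line_plus"
    using inv_homeo_line[OF g(1)] homeo_lineI[OF g(1)] by (simp add: homeo_line_plus_def)
next
  fix f g assume "f \<in> carrier homeo_line_plus" "g \<in> carrier homeo_line_plus"
  then show "f \<otimes>\<^bsub>homeo_line\<^esub> g \<in> carrier homeo_line_plus"
    by (auto simp: homeo_line_plus_def homeo_line_def strict_mono_def intro: homeomorphism_compose)
qed

lemma T_tilde_subset_plus: "carrier T_tilde \<subseteq> carrier homeo_line_plus"
proof
  fix f assume f: "f \<in> carrier T_tilde"
  then obtain g where g: "homeomorphism UNIV UNIV f g" and tr: "\<And>x (n::int). f (x + of_int n) = f x + of_int n"
    by (auto simp: T_tilde_def homeo_line_def)
  have "inj f" using g by (metis UNIV_I homeomorphism_apply1 injI)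
  moreover have "continuous_on UNIV f" using g by (simp add: homeomorphism_def)
  ultimately have "strict_mono f \<or> strict_antimono_on UNIV f"
    using injective_eq_monotone_map[of UNIV f] is_interval_univ by blast
  moreover have "f 0 < f 1" using tr[of 0 1] by simp
  ultimately have "strict_mono f"
    using monotone_onD[of UNIV "(<)" "(>)" f 0 1] by force
  with f show "f \<in> carrier homeo_line_plus"
    by (auto simp: T_tilde_def homeo_line_plus_def)
qed

lemma dyadic_iff: "x \<in> dyadic \<longleftrightarrow> (\<exists>(p::int) (n::nat). x = of_int p / 2 ^ n)"
proof
  assume "x \<in> dyadic"
  then obtain p q :: int where x: "x = of_int p / 2 powi q" by (auto simp: dyadic_def)
  show "\<exists>(p::int) (n::nat). x = of_int p / 2 ^ n"
  proof (cases "q \<ge> 0")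
    case True
    then show ?thesis using x by (auto simp: power_int_def)
  next
    case False
    then have "x = of_int (p * 2 ^ nat (- q)) / 2 ^ 0"
      using x by (simp add: power_int_def field_simps)
    then show ?thesis by blast
  qed
next
  assume "\<exists>(p::int) (n::nat). x = of_int p / 2 ^ n"
  then obtain p :: int and n :: nat where "x = of_int p / 2 powi (int n)" by auto
  then show "x \<in> dyadic" unfolding dyadic_def by blast
qed

lemma dyadic_add: "x \<in> dyadic \<Longrightarrow> y \<in> dyadic \<Longrightarrow> x + y \<in> dyadic"
proof -
  assume "x \<in> dyadic" "y \<in> dyadic"
  then obtain p q :: int and m n :: nat where "x = of_int p / 2 ^ m" "y = of_int q / 2 ^ n"
    by (auto simp: dyadic_iff)
  then have "x + y = of_int (p * 2 ^ n + q * 2 ^ m) / 2 ^ (m + n)"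
    by (simp add: add_divide_distrib power_add)
  then show ?thesis unfolding dyadic_iff by blast
qed

lemma dyadic_minus: "x \<in> dyadic \<Longrightarrow> - x \<in> dyadic"
  unfolding dyadic_iff by (metis minus_divide_left of_int_minus)

lemma dyadic_scale: "x \<in> dyadic \<Longrightarrow> 2 powi m * x \<in> dyadic"
proof -
  assume "x \<in> dyadic"
  then obtain p q :: int where "x = of_int p / 2 powi q" by (auto simp: dyadic_def)
  then have "2 powi m * x = of_int p / 2 powi (q - m)"
    by (simp add: power_int_diff)
  then show ?thesis unfolding dyadic_def by blast
qed

lemma dyadic_affine_iff: "b \<in> dyadic \<Longrightarrow> 2 powi m * x + b \<in> dyadic \<longleftrightarrow> x \<in> dyadic"
proof
  assume b: "b \<in> dyadic" and "2 powi m * x + b \<in> dyadic"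
  then have "2 powi (- m) * ((2 powi m * x + b) + - b) \<in> dyadic"
    using dyadic_scale[OF dyadic_add[OF _ dyadic_minus[OF b]]] by blast
  moreover have "2 powi (- m) * ((2 powi m * x + b) + - b) = x"
    by (simp add: power_int_minus)
  ultimately show "x \<in> dyadic" by (simp only:)
qed (simp add: dyadic_add dyadic_scale)

lemma closed_discrete_iff:
  fixes B :: "real set"
  shows "closed B \<and> discrete B \<longleftrightarrow> (\<forall>x. \<forall>\<^sub>F y in at x. y \<notin> B)"
  unfolding closed_limpt islimpt_iff_eventually discrete_altdef by metis

lemma pl_dyadic_iff: "pl_dyadic f \<longleftrightarrow> (\<exists>B. closed B \<and> discrete B \<and> B \<subseteq> dyadic \<and>
   (\<forall>C. connected C \<and> C \<inter> B = {} \<longrightarrow> (\<exists>m::int. \<exists>b \<in> dyadic. \<forall>x \<in> C. f x = 2 powi m * x + b)))"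
  (is "_ \<longleftrightarrow> (\<exists>B. ?P B)")
proof
  assume "pl_dyadic f"
  then obtain B where B: "closed B" "discrete B" "B \<subseteq> dyadic"
    and aff: "\<And>C. C \<in> components (- B) \<Longrightarrow> \<exists>m::int. \<exists>b \<in> dyadic. \<forall>x \<in> C. f x = 2 powi m * x + b"
    unfolding pl_dyadic_def by blast
  have zero: "0 \<in> dyadic" unfolding dyadic_iff by (intro exI[of _ 0]) simp
  have "\<exists>m::int. \<exists>b \<in> dyadic. \<forall>x \<in> C. f x = 2 powi m * x + b" if "connected C" "C \<inter> B = {}" for C
  proof (cases "C = {}")
    case False
    then obtain D where "D \<in> components (- B)" "C \<subseteq> D"
      using exists_component_superset[of C "- B"] \<open>connected C\<close> \<open>C \<inter> B = {}\<close> by blast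
    then show ?thesis using aff by blast
  qed (use zero in auto)
  with B show "\<exists>B. ?P B" by blast
next
  assume "\<exists>B. ?P B"
  then obtain B where B: "?P B" by blast
  have "connected C \<and> C \<inter> B = {}" if "C \<in> components (- B)" for C
    using that in_components_connected in_components_subset by blast
  then show "pl_dyadic f" unfolding pl_dyadic_def using B by (intro exI[of _ B]) simp
qed

lemma homeo_filterlim_at:
  fixes f :: "real \<Rightarrow> real"
  assumes "homeomorphism UNIV UNIV f g"
  shows "filterlim f (at (f x)) (at x)"
proof -
  have "isCont f x" using assms by (simp add: homeomorphism_def continuous_on_eq_continuous_at)
  moreover have "inj f" using assms by (metis UNIV_I homeomorphism_apply1 injI)
  then have "\<forall>\<^sub>F y in at x. f y \<noteq> f x" by (auto simp: eventually_at_filter inj_eq)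
  ultimately show ?thesis by (simp add: filterlim_at isCont_def)
qed

lemma pl_dyadic_comp:
  assumes f: "homeomorphism UNIV UNIV f f'" and "pl_dyadic f" "pl_dyadic g"
  shows "pl_dyadic (g \<circ> f)"
proof -
  obtain A where A: "closed A" "discrete A" "A \<subseteq> dyadic"
    and affA: "\<And>C. connected C \<Longrightarrow> C \<inter> A = {} \<Longrightarrow> \<exists>m::int. \<exists>b \<in> dyadic. \<forall>x \<in> C. f x = 2 powi m * x + b"
    using \<open>pl_dyadic f\<close> unfolding pl_dyadic_iff by metis
  obtain B where B: "closed B" "discrete B" "B \<subseteq> dyadic"
    and affB: "\<And>C. connected C \<Longrightarrow> C \<inter> B = {} \<Longrightarrow> \<exists>m::int. \<exists>b \<in> dyadic. \<forall>x \<in> C. g x = 2 powi m * x + b"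
    using \<open>pl_dyadic g\<close> unfolding pl_dyadic_iff by metis
  let ?D = "A \<union> f -` B"
  have "\<forall>\<^sub>F y in at x. y \<notin> ?D" for x
  proof -
    have "\<forall>\<^sub>F y in at x. f y \<notin> B"
      using eventually_compose_filterlim[OF _ homeo_filterlim_at[OF f], of "\<lambda>y. y \<notin> B" x]
        B closed_discrete_iff[of B] by auto
    moreover have "\<forall>\<^sub>F y in at x. y \<notin> A" using A closed_discrete_iff[of A] by blast
    ultimately show ?thesis by eventually_elim auto
  qed
  then have "closed ?D \<and> discrete ?D" by (intro closed_discrete_iff[THEN iffD2] allI)
  moreover have "?D \<subseteq> dyadic"
  proof
    fix x assume x: "x \<in> ?D"
    show "x \<in> dyadic"
    proof (cases "x \<in> A")
      case False
      then obtain m :: int and b where "b \<in> dyadic" "f x = 2 powi m * x + b"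
        using affA[of "{x}"] by auto
      moreover have "f x \<in> dyadic" using x False B by auto
      ultimately show ?thesis using dyadic_affine_iff by simp
    qed (use A in auto)
  qed
  moreover have "\<exists>m::int. \<exists>b \<in> dyadic. \<forall>x \<in> C. (g \<circ> f) x = 2 powi m * x + b"
    if C: "connected C" "C \<inter> ?D = {}" for C
  proof -
    obtain m :: int and b where b: "b \<in> dyadic" and fb: "\<And>x. x \<in> C \<Longrightarrow> f x = 2 powi m * x + b"
      using affA[of C] C by blast
    have "continuous_on C f" using f homeomorphism_cont1 continuous_on_subset by blast
    then have "connected (f ` C)" using C connected_continuous_image by blast
    moreover have "f ` C \<inter> B = {}" using C by blast
    ultimately obtain n :: int and c where c: "c \<in> dyadic"
      and gc: "\<And>x. x \<in> C \<Longrightarrow> g (f x) = 2 powi n * f x + c"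
      using affB[of "f ` C"] by blast
    have "\<forall>x \<in> C. (g \<circ> f) x = 2 powi (n + m) * x + (2 powi n * b + c)"
      using fb gc by (simp add: power_int_add algebra_simps)
    moreover have "2 powi n * b + c \<in> dyadic" using b c by (intro dyadic_add dyadic_scale)
    ultimately show ?thesis by blast
  qed
  ultimately show ?thesis
    unfolding pl_dyadic_iff by (intro exI[of _ ?D] conjI allI impI) (simp_all only:)
qed

lemma pl_dyadic_image:
  assumes f: "homeomorphism UNIV UNIV f g" and "pl_dyadic f" and x: "x \<in> dyadic"
  shows "f x \<in> dyadic"
proof -
  obtain A where A: "closed A" "discrete A" "A \<subseteq> dyadic"
    and affA: "\<And>C. connected C \<Longrightarrow> C \<inter> A = {} \<Longrightarrow> \<exists>m::int. \<exists>b \<in> dyadic. \<forall>x \<in> C. f x = 2 powi m * x + b"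
    using \<open>pl_dyadic f\<close> unfolding pl_dyadic_iff by metis
  have "\<forall>\<^sub>F y in at x. y \<notin> A" using A closed_discrete_iff[of A] by blast
  then have "\<forall>\<^sub>F y in at_right x. y \<notin> A" by (simp add: eventually_at_split)
  then obtain e where e: "e > x" "\<And>y. y > x \<Longrightarrow> y < e \<Longrightarrow> y \<notin> A"
    by (auto simp: eventually_at_right_field)
  obtain m :: int and b where b: "b \<in> dyadic" and fb: "\<And>y. y \<in> {x<..<e} \<Longrightarrow> f y = 2 powi m * y + b"
    using affA[of "{x<..<e}"] e by fastforce
  have "isCont f x" using f by (simp add: homeomorphism_def continuous_on_eq_continuous_at)
  then have "(f \<longlongrightarrow> f x) (at_right x)" by (simp add: isCont_def filterlim_at_split)
  moreover have "((\<lambda>y. 2 powi m * y + b) \<longlongrightarrow> 2 powi m * x + b) (at_right x)"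
    by (intro tendsto_intros)
  moreover have "\<forall>\<^sub>F y in at_right x. f y = 2 powi m * y + b"
    using fb e(1) by (auto simp: eventually_at_right_field)
  ultimately have "f x = 2 powi m * x + b"
    using tendsto_unique[OF trivial_limit_at_right_real] tendsto_cong by metis
  then show ?thesis using b x by (simp add: dyadic_affine_iff)
qed

lemma pl_dyadic_inverse:
  assumes f: "homeomorphism UNIV UNIV f g" and pl: "pl_dyadic f"
  shows "pl_dyadic g"
proof -
  obtain A where A: "closed A" "discrete A" "A \<subseteq> dyadic"
    and affA: "\<And>C. connected C \<Longrightarrow> C \<inter> A = {} \<Longrightarrow> \<exists>m::int. \<exists>b \<in> dyadic. \<forall>x \<in> C. f x = 2 powi m * x + b"
    using pl unfolding pl_dyadic_iff by metis
  have g: "homeomorphism UNIV UNIV g f" using f by (rule homeomorphism_symD)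
  have fg: "f (g y) = y" for y using f by (simp add: homeomorphism_def)
  let ?D = "g -` A"
  have "\<forall>\<^sub>F y in at x. y \<notin> ?D" for x
    using eventually_compose_filterlim[OF _ homeo_filterlim_at[OF g], of "\<lambda>y. y \<notin> A" x]
      A closed_discrete_iff[of A] by auto
  then have "closed ?D \<and> discrete ?D" by (intro closed_discrete_iff[THEN iffD2] allI)
  moreover have "?D \<subseteq> dyadic"
  proof
    fix y assume "y \<in> ?D"
    then have "f (g y) \<in> dyadic" using A pl_dyadic_image[OF f pl] by blast
    then show "y \<in> dyadic" by (simp add: fg)
  qed
  moreover have "\<exists>m::int. \<exists>b \<in> dyadic. \<forall>x \<in> C. g x = 2 powi m * x + b"
    if C: "connected C" "C \<inter> ?D = {}" for C
  proof -
    have "continuous_on C g" using g homeomorphism_cont1 continuous_on_subset by blast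
    then have "connected (g ` C)" using C connected_continuous_image by blast
    moreover have "g ` C \<inter> A = {}" using C by blast
    ultimately obtain m :: int and b where b: "b \<in> dyadic"
      and fb: "\<And>y. y \<in> C \<Longrightarrow> f (g y) = 2 powi m * g y + b"
      using affA[of "g ` C"] by blast
    have "g y = 2 powi (- m) * y + (- (2 powi (- m) * b))" if "y \<in> C" for y
      using fb[OF that] by (simp add: fg power_int_minus field_simps)
    moreover have "- (2 powi (- m) * b) \<in> dyadic" using b by (intro dyadic_minus dyadic_scale)
    ultimately show ?thesis by blast
  qed
  ultimately show ?thesis
    unfolding pl_dyadic_iff by (intro exI[of _ ?D] conjI allI impI) (simp_all only:)
qed

lemma subgroup_T_tilde: "subgroup (carrier T_tilde) homeo_line"
proof (rule group.subgroupI[OF group_homeo_line])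
  show "carrier T_tilde \<subseteq> carrier homeo_line" by (auto simp: T_tilde_def)
  have "pl_dyadic id"
    unfolding pl_dyadic_iff
    by (intro exI[of _ "{}"]) (auto intro!: exI[of _ 0] bexI[of _ 0] simp: dyadic_iff)
  moreover have "id \<in> carrier homeo_line"
    using group.is_monoid[OF group_homeo_line, THEN monoid.one_closed] by (simp add: homeo_line_def)
  ultimately have "id \<in> carrier T_tilde" by (simp add: T_tilde_def)
  then show "carrier T_tilde \<noteq> {}" by blast
next
  fix f assume f: "f \<in> carrier T_tilde"
  then obtain g where g: "homeomorphism UNIV UNIV f g" and pl: "pl_dyadic f"
    and tr: "\<And>x (n::int). f (x + of_int n) = f x + of_int n"
    by (auto simp: T_tilde_def homeo_line_def)
  have "g (x + of_int n) = g x + of_int n" for x and n :: int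
  proof -
    have "f (g x + of_int n) = x + of_int n" using tr g by (simp add: homeomorphism_def)
    then show ?thesis using g by (metis UNIV_I homeomorphism_apply1)
  qed
  then show "inv\<^bsub>homeo_line\<^esub> f \<in> carrier T_tilde"
    using inv_homeo_line[OF g] homeo_lineI[OF g] pl_dyadic_inverse[OF g pl] by (simp add: T_tilde_def)
next
  fix f g assume f: "f \<in> carrier T_tilde" and g: "g \<in> carrier T_tilde"
  then obtain g' where "homeomorphism UNIV UNIV g g'" by (auto simp: T_tilde_def homeo_line_def)
  then have "pl_dyadic (f \<circ> g)" using f g pl_dyadic_comp by (auto simp: T_tilde_def)
  moreover have "f \<otimes>\<^bsub>homeo_line\<^esub> g \<in> carrier homeo_line"
    using f g group.is_monoid[OF group_homeo_line, THEN monoid.m_closed] by (simp add: T_tilde_def)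
  ultimately show "f \<otimes>\<^bsub>homeo_line\<^esub> g \<in> carrier T_tilde"
    using f g by (simp add: T_tilde_def homeo_line_def)
qed

end

theory Submission
  imports Defs
begin

text \<open>
  Write \<open>\<tau>\<close> for the central translation by 1 and let \<open>\<rho>\<close> be an action without global fixed points.

  The group is generated, as a normal subgroup, by translations by dyadic numbers together with
  commutators of elements supported in a fixed arc. Hence \<open>\<rho>\<close> preserves orientation. If \<open>\<rho>(\<tau>)\<close> had a
  fixed point, its roots, the dyadic translations, would fix it too, and the pointwise stabilizer of the
  fixed point set of \<open>\<rho>(\<tau>)\<close> would be everything, which contradicts the absence of global fixed points. So we may assume
  \<open>\<rho>(\<tau>) x > x\<close> for all \<open>x\<close>, after conjugating by \<open>x \<mapsto> - x\<close> if necessary.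

  Counting how many fundamental domains of \<open>\<rho>(\<tau>)\<close> the point 0 is moved through gives a quasimorphism. Its
  homogenization is a homomorphism on the elements supported in an arc, because an arc has infinitely
  many disjoint translates, and it vanishes there: those elements are products of conjugates of one
  generator \<open>x\<close> of Thompson's group F (any two dyadic partitions are related by moving carets), and the pentagon
  relation reads \<open>x\<^sup>2 = x\<^sup>3\<close> modulo commutators. Hence the stabilizer of 0 in the standard action has a
  bounded \<open>\<rho>\<close>-orbit and therefore a \<open>\<rho>\<close>-fixed point \<open>p\<close>. The map \<open>j : g 0 \<mapsto> \<rho>(g) p\<close> is equivariant and
  strictly increasing on the dyadic numbers, and \<open>h y = sup {x. j x \<le> y}\<close> is the semi-conjugacy.
\<close>

section \<open>Piecewise linear dyadic maps\<close>

text \<open>The homogenized quasimorphism takes the value 1 on \<tau>, so it cannot vanish on the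
  whole group, and its zero set need not be closed under composition. What can be had is additivity
  inside one arc. The locale \<open>arc_kernel\<close> therefore asks for closure under products and
  inverses only among elements supported in one arc, but for invariance under all conjugations. One
  generation argument then serves three sets: the orientation-preserving elements, the elements
  acting trivially on the fixed points of \<rho>(\<tau>), and the zeros of the homogenization. The
  exponents 2 and 3 are the lengths of the two sides of the pentagon. All its edges are conjugate
  generators, and generators conjugate inside an arc differ by a commutator. On the fixed points of
  \<rho>(\<tau>) commutators of arc elements act trivially because the half turn, itself trivial
  there, separates the supports.\<close>

definition dyadic_affine_on :: "(real \<Rightarrow> real) \<Rightarrow> real \<Rightarrow> real \<Rightarrow> bool" where
  "dyadic_affine_on f a b \<longleftrightarrow> (\<exists>m::int. \<exists>c\<in>dyadic. \<forall>x\<in>{a..b}. f x = 2 powi m * x + c)"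

text \<open>The nodes of the binary tree of dyadic bisections. The parity of \<open>k\<close>
  decides whether the sibling of the interval lies to its right or to its left.\<close>

definition std_interval :: "real \<Rightarrow> real \<Rightarrow> bool" where
  "std_interval u v \<longleftrightarrow> (\<exists>k m::int. u = of_int k * 2 powi m \<and> v = of_int (k + 1) * 2 powi m)"

text \<open>The pieces are closed, share their endpoint and have positive slopes, so continuity and
  strict monotonicity follow by induction, without a list of breakpoints to carry along.\<close>

inductive pl_on :: "(real \<Rightarrow> real) \<Rightarrow> real \<Rightarrow> real \<Rightarrow> bool" for f where
  affine: "a \<in> dyadic \<Longrightarrow> b \<in> dyadic \<Longrightarrow> a < b \<Longrightarrow> dyadic_affine_on f a b \<Longrightarrow> pl_on f a b"
| glue: "pl_on f a b \<Longrightarrow> pl_on f b c \<Longrightarrow> pl_on f a c"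

lemma dyadic_of_int [simp]: "of_int k \<in> dyadic"
  unfolding dyadic_iff by (rule exI[of _ k], rule exI[of _ 0]) simp

lemma dyadic_simps [simp]: "0 \<in> dyadic" "1 \<in> dyadic"
  using dyadic_of_int[of 0] dyadic_of_int[of 1] by simp_all

lemma dyadic_mult: "x \<in> dyadic \<Longrightarrow> y \<in> dyadic \<Longrightarrow> x * y \<in> dyadic"
proof -
  assume "x \<in> dyadic" "y \<in> dyadic"
  then obtain p q :: int and m n :: nat where "x = of_int p / 2 ^ m" "y = of_int q / 2 ^ n"
    by (auto simp: dyadic_iff)
  then have "x * y = of_int (p * q) / 2 ^ (m + n)"
    by (simp add: power_add)
  then show ?thesis unfolding dyadic_iff by blast
qed

lemma dyadic_diff: "x \<in> dyadic \<Longrightarrow> y \<in> dyadic \<Longrightarrow> x - y \<in> dyadic"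
  using dyadic_add[OF _ dyadic_minus, of x y] by simp

lemma dyadic_powi [simp]: "2 powi m \<in> dyadic"
  using dyadic_scale[of 1 m] by simp

lemma dyadic_half: "x \<in> dyadic \<Longrightarrow> x / 2 \<in> dyadic"
  using dyadic_scale[of x "-1"] by (simp add: power_int_minus)

lemma dyadic_numeral [simp]: "numeral k \<in> dyadic"
  using dyadic_of_int[of "numeral k"] by simp

lemma dyadic_mid: "x \<in> dyadic \<Longrightarrow> y \<in> dyadic \<Longrightarrow> (x + y) / 2 \<in> dyadic"
  by (intro dyadic_half dyadic_add)

lemma dyadic_affine_on_mono:
  "dyadic_affine_on f a b \<Longrightarrow> a \<le> c \<Longrightarrow> d \<le> b \<Longrightarrow> dyadic_affine_on f c d"
  unfolding dyadic_affine_on_def by (meson atLeastAtMost_iff order_trans)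

lemma pl_on_dyadic: "pl_on f a b \<Longrightarrow> a \<in> dyadic \<and> b \<in> dyadic \<and> a < b"
  by (induction rule: pl_on.induct) auto

lemma pl_on_cong:
  assumes "pl_on f a b" "\<And>x. x \<in> {a..b} \<Longrightarrow> g x = f x"
  shows "pl_on g a b"
  using assms
proof (induction rule: pl_on.induct)
  case (affine a b)
  then show ?case by (intro pl_on.affine) (auto simp: dyadic_affine_on_def)
next
  case (glue a b c)
  then show ?case using pl_on_dyadic[OF glue.hyps(1)] pl_on_dyadic[OF glue.hyps(2)]
    by (intro pl_on.glue[of g a b c]) auto
qed

lemma pl_on_strict_mono: "pl_on f a b \<Longrightarrow> strict_mono_on {a..b} f"
proof (induction rule: pl_on.induct)
  case (affine a b)
  then show ?case by (auto simp: dyadic_affine_on_def intro!: strict_mono_onI)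
next
  case (glue a b c)
  show ?case
  proof (rule strict_mono_onI)
    fix x y assume xy: "x \<in> {a..c}" "y \<in> {a..c}" "x < y"
    have b: "a < b" "b < c" using pl_on_dyadic[OF glue.hyps(1)] pl_on_dyadic[OF glue.hyps(2)] by auto
    consider "y \<le> b" | "b \<le> x" | "x < b" "b < y" by linarith
    then show "f x < f y"
    proof cases
      case 3
      then have "f x < f b" "f b < f y"
        using strict_mono_onD[OF glue.IH(1), of x b] strict_mono_onD[OF glue.IH(2), of b y] xy b by auto
      then show ?thesis by simp
    qed (use xy b strict_mono_onD[OF glue.IH(1), of x y] strict_mono_onD[OF glue.IH(2), of x y] in auto)
  qed
qed

lemma dyadic_eventually_integer:
  assumes "x \<in> dyadic"
  shows "\<forall>\<^sub>F n in sequentially. \<exists>k::int. x * 2 powi (int n + m) = of_int k"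
proof -
  obtain p q :: int where x: "x = of_int p / 2 powi q" using assms by (auto simp: dyadic_def)
  have "\<exists>k::int. x * 2 powi (int n + m) = of_int k" if "n \<ge> nat (q - m)" for n
  proof -
    have "x * 2 powi (int n + m) = of_int p * 2 powi (int n + m - q)"
      unfolding x by (simp add: power_int_diff)
    also have "\<dots> = of_int (p * 2 ^ nat (int n + m - q))"
      using that by (simp add: power_int_def)
    finally show ?thesis by blast
  qed
  then show ?thesis unfolding eventually_sequentially by blast
qed

text \<open>On a piece \<open>2 powi m * x + c\<close> a cell of length \<open>1 / 2 ^ n\<close>
  goes to a cell of the grid with unit \<open>2 powi (m - int n)\<close> once \<open>c\<close> is a
  multiple of that unit, which holds for all large \<open>n\<close>. Having this for all large
  \<open>n\<close> lets glued pieces agree on a common grid.\<close>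

lemma pl_on_grid:
  assumes "pl_on f a b"
  shows "\<forall>\<^sub>F n in sequentially. (\<exists>k::int. a = of_int k / 2 ^ n) \<and> (\<exists>k::int. b = of_int k / 2 ^ n) \<and>
     (\<forall>k::int. a \<le> of_int k / 2 ^ n \<and> of_int (k + 1) / 2 ^ n \<le> b \<longrightarrow>
       dyadic_affine_on f (of_int k / 2 ^ n) (of_int (k + 1) / 2 ^ n) \<and>
       std_interval (f (of_int k / 2 ^ n)) (f (of_int (k + 1) / 2 ^ n)))"
  using assms
proof (induction rule: pl_on.induct)
  case (affine a b)
  from affine obtain m :: int and c where c: "c \<in> dyadic" and f: "\<And>x. x \<in> {a..b} \<Longrightarrow> f x = 2 powi m * x + c"
    unfolding dyadic_affine_on_def by blast
  have "\<forall>\<^sub>F n in sequentially. \<exists>k::int. a * 2 powi (int n + 0) = of_int k"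
    "\<forall>\<^sub>F n in sequentially. \<exists>k::int. b * 2 powi (int n + 0) = of_int k"
    "\<forall>\<^sub>F n in sequentially. \<exists>k::int. c * 2 powi (int n + (- m)) = of_int k"
    using affine c by (blast intro: dyadic_eventually_integer)+
  then show ?case
  proof eventually_elim
    case (elim n)
    then obtain ka kb kc :: int where k: "a * 2 ^ n = of_int ka" "b * 2 ^ n = of_int kb"
      "c * 2 powi (int n - m) = of_int kc" by auto
    have c: "c = of_int kc * 2 powi (m - int n)"
      using k(3) by (simp add: power_int_diff field_simps)
    have *: "2 powi m * (of_int k / 2 ^ n) + c = of_int (k + kc) * 2 powi (m - int n)" for k
      unfolding c by (simp add: power_int_diff field_simps)
    have "std_interval (f (of_int k / 2 ^ n)) (f (of_int (k + 1) / 2 ^ n))"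
      if "a \<le> of_int k / 2 ^ n \<and> of_int (k + 1) / 2 ^ n \<le> b" for k
    proof -
      have "of_int k / 2 ^ n \<le> (of_int (k + 1) / 2 ^ n :: real)" by (simp add: divide_right_mono)
      then have "f (of_int k / 2 ^ n) = of_int (k + kc) * 2 powi (m - int n)"
        "f (of_int (k + 1) / 2 ^ n) = of_int (k + kc + 1) * 2 powi (m - int n)"
        using that *[of k] *[of "k + 1"] f[of "of_int k / 2 ^ n"] f[of "of_int (k + 1) / 2 ^ n"]
        by (simp_all add: ac_simps)
      then show ?thesis unfolding std_interval_def by blast
    qed
    moreover have "a = of_int ka / 2 ^ n" "b = of_int kb / 2 ^ n" using k by (simp_all add: field_simps)
    ultimately show ?case using affine.hyps dyadic_affine_on_mono by blast
  qed
next
  case (glue a b c)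
  from glue.IH show ?case
  proof eventually_elim
    case (elim n)
    then obtain kb :: int where b: "b = of_int kb / 2 ^ n" by blast
    \<comment> \<open>\<open>b\<close> is itself a node, so no cell straddles it and each cell
      belongs to one of the two pieces.\<close>
    have "of_int (k + 1) / 2 ^ n \<le> b \<or> b \<le> of_int k / 2 ^ n" for k
    proof (cases "k + 1 \<le> kb")
      case True
      then show ?thesis unfolding b by (metis divide_right_mono of_int_le_iff zero_le_numeral zero_le_power)
    next
      case False
      then have "kb \<le> k" by simp
      then show ?thesis unfolding b by (metis divide_right_mono of_int_le_iff zero_le_numeral zero_le_power)
    qed
    then show ?case using elim by blast
  qed
qed

lemma closed_affine_if_open:
  assumes "a < b" "continuous_on UNIV f" "\<And>x. x \<in> {a<..<b} \<Longrightarrow> f x = 2 powi m * x + (c::real)" "x \<in> {a..b}"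
  shows "f x = 2 powi m * x + c"
proof -
  have "x \<in> closure {a<..<b}" using assms by simp
  moreover have "closed {x. f x = 2 powi m * x + c}"
    by (intro closed_Collect_eq assms continuous_intros)
  then have "closure {a<..<b} \<subseteq> {x. f x = 2 powi m * x + c}"
    using assms(3) by (intro closure_minimal) auto
  ultimately show ?thesis by blast
qed

lemma T_tildeD:
  assumes "g \<in> carrier T_tilde"
  shows "\<exists>h. homeomorphism UNIV UNIV g h" "g (x + of_int n) = g x + of_int n" "pl_dyadic g"
    "continuous_on UNIV g" "bij g" "strict_mono g"
proof -
  show *: "\<exists>h. homeomorphism UNIV UNIV g h" and "g (x + of_int n) = g x + of_int n" "pl_dyadic g"
    using assms by (auto simp: T_tilde_def homeo_line_def)
  then show "continuous_on UNIV g" "bij g"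
    by (auto simp: homeomorphism_def bij_def inj_def intro: surjI) metis+
  show "strict_mono g" using assms T_tilde_subset_plus by (auto simp: homeo_line_plus_def)
qed

text \<open>Cut at the points of \<open>S\<close> one at a time. \<open>B\<close> is the breakpoint
  set on the whole line, possibly infinite; \<open>S\<close> covers its part inside the
  interval.\<close>

lemma pl_on_finite_breaks:
  assumes "finite S" "S \<subseteq> dyadic" "continuous_on UNIV f"
    and aff: "\<And>C. connected C \<Longrightarrow> C \<inter> B = {} \<Longrightarrow> \<exists>m::int. \<exists>c \<in> dyadic. \<forall>x \<in> C. f x = 2 powi m * x + c"
    and "a < b" "a \<in> dyadic" "b \<in> dyadic" "{a<..<b} \<inter> B \<subseteq> S"
  shows "pl_on f a b"
  using \<open>finite S\<close> \<open>S \<subseteq> dyadic\<close> \<open>a < b\<close> \<open>a \<in> dyadic\<close> \<open>b \<in> dyadic\<close> \<open>{a<..<b} \<inter> B \<subseteq> S\<close>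
proof (induction S arbitrary: a b rule: finite_induct)
  case empty
  then obtain m :: int and c where "c \<in> dyadic" "\<And>x. x \<in> {a<..<b} \<Longrightarrow> f x = 2 powi m * x + c"
    using aff[of "{a<..<b}"] by force
  then have "dyadic_affine_on f a b" unfolding dyadic_affine_on_def
    using closed_affine_if_open[OF \<open>a < b\<close> assms(3)] by blast
  then show ?case using empty by (intro pl_on.affine) auto
next
  case (insert s S)
  show ?case
  proof (cases "s \<in> {a<..<b}")
    case True
    have "{a<..<s} \<subseteq> {a<..<b} - {s}" "{s<..<b} \<subseteq> {a<..<b} - {s}" using True by auto
    then have "{a<..<s} \<inter> B \<subseteq> S" "{s<..<b} \<inter> B \<subseteq> S" using insert.prems(5) by blast+
    then have "pl_on f a s" "pl_on f s b" using insert True by (auto intro!: insert.IH)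
    then show ?thesis by (rule pl_on.glue)
  next
    case False
    then show ?thesis using insert by (intro insert.IH) auto
  qed
qed

lemma T_tilde_pl_on:
  assumes g: "g \<in> carrier T_tilde" and "a \<in> dyadic" "b \<in> dyadic" "a < b"
  shows "pl_on g a b"
proof -
  obtain B where B: "closed B" "discrete B" "B \<subseteq> dyadic"
    and aff: "\<And>C. connected C \<Longrightarrow> C \<inter> B = {} \<Longrightarrow> \<exists>m::int. \<exists>c \<in> dyadic. \<forall>x \<in> C. g x = 2 powi m * x + c"
    using T_tildeD(3)[OF g] unfolding pl_dyadic_iff by metis
  have "compact ({a..b} \<inter> B)" using B by (simp add: compact_Int_closed)
  moreover have "discrete ({a..b} \<inter> B)" using B discrete_imp_not_islimpt  discrete_subset[of B "{a..b} \<inter> B"] by auto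
  ultimately have "finite ({a..b} \<inter> B)" using discrete_compact_finite_iff by blast
  then show ?thesis
    using aff assms B(3) by (intro pl_on_finite_breaks[where B = B and S = "{a..b} \<inter> B"] T_tildeD(4)) auto
qed

text \<open>A grid that resolves \<open>f\<close> on one period is carried to the whole line by
  periodicity. All its nodes together, whether or not \<open>f\<close> breaks there, serve as the
  closed discrete set in \<open>pl_dyadic\<close>.\<close>

lemma T_tildeI:
  fixes f :: "real \<Rightarrow> real"
  assumes per: "\<And>x. f (x + 1) = f x + 1" and pl: "pl_on f a (a + 1)"
  shows "f \<in> carrier T_tilde"
proof -
  have per_n: "f (x + of_nat n) = f x + of_nat n" for x n
    by (induction n) (auto simp: per add.assoc[symmetric] add.commute[of 1])
  have per_i: "f (x + of_int n) = f x + of_int n" for x n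
  proof (cases "n \<ge> 0")
    case True
    then show ?thesis using per_n[of x "nat n"] by simp
  next
    case False
    then show ?thesis using per_n[of "x + of_int n" "nat (-n)"] by simp
  qed
  obtain n where n: "\<exists>k::int. a = of_int k / 2 ^ n"
     "\<And>k::int. a \<le> of_int k / 2 ^ n \<and> of_int (k + 1) / 2 ^ n \<le> a + 1 \<Longrightarrow>
       dyadic_affine_on f (of_int k / 2 ^ n) (of_int (k + 1) / 2 ^ n)"
    using eventually_happens'[OF _ pl_on_grid[OF pl]] by auto
  then obtain ka :: int where ka: "a = of_int ka / 2 ^ n" by blast
  have aff: "dyadic_affine_on f (of_int k / 2 ^ n) (of_int (k + 1) / 2 ^ n)" for k :: int
  proof -
    \<comment> \<open>A period consists of \<open>2 ^ n\<close> cells: cell \<open>k\<close> is the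
      translate by \<open>l\<close> of cell \<open>j\<close>, which lies in the given
      period.\<close>
    define l where "l = (k - ka) div 2 ^ n"
    define j where "j = ka + (k - ka) mod 2 ^ n"
    have k: "k = j + l * 2 ^ n" unfolding j_def l_def by (simp add: algebra_simps)
    have "(k - ka) mod 2 ^ n < 2 ^ n" "0 \<le> (k - ka) mod 2 ^ n" by simp_all
    then have j: "ka \<le> j" "j + 1 \<le> ka + 2 ^ n" unfolding j_def by linarith+
    have "dyadic_affine_on f (of_int j / 2 ^ n) (of_int (j + 1) / 2 ^ n)"
    proof (rule n(2), intro conjI)
      show "a \<le> of_int j / 2 ^ n" unfolding ka using j(1) by (simp add: divide_right_mono)
      have "of_int (j + 1) \<le> (of_int (ka + 2 ^ n) :: real)" using j(2) by linarith
      then have "of_int (j + 1) / 2 ^ n \<le> (of_int (ka + 2 ^ n) / 2 ^ n :: real)"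
        by (intro divide_right_mono) auto
      then show "of_int (j + 1) / 2 ^ n \<le> a + 1" unfolding ka by (simp add: add_divide_distrib)
    qed
    then obtain m :: int and c where c: "c \<in> dyadic"
      and f: "\<And>x. x \<in> {of_int j / 2 ^ n..of_int (j + 1) / 2 ^ n} \<Longrightarrow> f x = 2 powi m * x + c"
      unfolding dyadic_affine_on_def by blast
    have "f x = 2 powi m * x + (c - 2 powi m * of_int l + of_int l)"
      if "x \<in> {of_int k / 2 ^ n..of_int (k + 1) / 2 ^ n}" for x
    proof -
      have "x - of_int l \<in> {of_int j / 2 ^ n..of_int (j + 1) / 2 ^ n}"
        using that unfolding k by (simp add: field_simps)
      then show ?thesis using f[of "x - of_int l"] per_i[of "x - of_int l" l] by (simp add: algebra_simps)
    qed
    moreover have "c - 2 powi m * of_int l + of_int l \<in> dyadic"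
      by (intro dyadic_add dyadic_diff c dyadic_mult) auto
    ultimately show ?thesis unfolding dyadic_affine_on_def by blast
  qed
  have floor: "x \<in> {of_int \<lfloor>x * 2 ^ n\<rfloor> / 2 ^ n..of_int (\<lfloor>x * 2 ^ n\<rfloor> + 1) / 2 ^ n}" for x :: real
    by (simp add: field_simps) linarith
  have pl_step: "pl_on f (of_int k / 2 ^ n) (of_int (k + 1) / 2 ^ n)" for k :: int
    by (intro pl_on.affine aff) (unfold dyadic_iff, blast, blast, simp add: divide_strict_right_mono)
  have pl_k: "pl_on f (of_int k / 2 ^ n) (of_int (k + 1 + int i) / 2 ^ n)" for k i
  proof (induction i)
    case 0
    then show ?case using pl_step[of k] by simp
  next
    case (Suc i)
    then show ?case using pl_on.glue[OF Suc.IH pl_step] by (simp add: add_ac)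
  qed
  have ex_pl: "\<exists>u v. u < x \<and> y < v \<and> pl_on f u v" if "x \<le> y" for x y
  proof -
    \<comment> \<open>Starting one cell early keeps \<open>x\<close> in the interior even when it is
      a node.\<close>
    define k where "k = \<lfloor>x * 2 ^ n\<rfloor> - 1"
    define i where "i = nat (\<lfloor>y * 2 ^ n\<rfloor> - k)"
    have le: "\<lfloor>x * 2 ^ n\<rfloor> \<le> \<lfloor>y * 2 ^ n\<rfloor>" using that by (intro floor_mono) simp
    have "of_int k / 2 ^ n < x" unfolding k_def by (simp add: field_simps) linarith
    moreover have "int i = \<lfloor>y * 2 ^ n\<rfloor> - k" using le unfolding i_def k_def by simp
    then have "y < of_int (k + 1 + int i) / 2 ^ n" by (simp add: field_simps) linarith
    ultimately show ?thesis using pl_k by blast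
  qed
  have mono: "strict_mono f"
  proof (rule strict_monoI)
    fix x y :: real assume "x < y"
    then obtain u v where "u < x" "y < v" "pl_on f u v" using ex_pl[of x y] by auto
    then show "f x < f y" using strict_mono_onD[OF pl_on_strict_mono, of f u v x y] \<open>x < y\<close> by auto
  qed
  have affc: "continuous_on {of_int k / 2 ^ n..of_int (k + 1) / 2 ^ n} f" for k :: int
  proof -
    obtain m :: int and c where f: "\<And>x. x \<in> {of_int k / 2 ^ n..of_int (k + 1) / 2 ^ n} \<Longrightarrow> f x = 2 powi m * x + c"
      using aff[of k] unfolding dyadic_affine_on_def by blast
    have "continuous_on {of_int k / 2 ^ n..of_int (k + 1) / 2 ^ n} (\<lambda>x. 2 powi m * x + c)"
      by (intro continuous_intros)
    then show ?thesis using f by (metis (no_types, lifting) continuous_on_cong)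
  qed
  have cont_pl: "pl_on f u v \<Longrightarrow> continuous_on {u..v} f" for u v
  proof (induction rule: pl_on.induct)
    case (affine a b)
    then obtain m :: int and c where f: "\<And>x. x \<in> {a..b} \<Longrightarrow> f x = 2 powi m * x + c"
      unfolding dyadic_affine_on_def by blast
    have "continuous_on {a..b} (\<lambda>x. 2 powi m * x + c)" by (intro continuous_intros)
    then show ?case using f by (metis (no_types, lifting) continuous_on_cong)
  next
    case (glue a b c)
    then have "continuous_on ({a..b} \<union> {b..c}) f" by (intro continuous_on_closed_Un) auto
    then show ?case using pl_on_dyadic[OF glue.hyps(1)] pl_on_dyadic[OF glue.hyps(2)]
      by (simp add: ivl_disj_un_two_touch)
  qed
  have cont: "continuous_on UNIV f"
  proof (subst continuous_on_eq_continuous_at, simp, intro ballI)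
    fix x :: real
    obtain u v where uv: "u < x" "x < v" "pl_on f u v" using ex_pl[of x x] by auto
    then have "continuous_on {u<..<v} f" using cont_pl continuous_on_subset
      by (metis greaterThanLessThan_subseteq_atLeastAtMost_iff order_refl)
    then show "isCont f x" using uv by (simp add: continuous_on_eq_continuous_at)
  qed
  have surj: "\<exists>x. f x = y" for y
  proof -
    define n where "n = \<lfloor>y - f 0\<rfloor>"
    have "f (of_int n) \<le> y" "y \<le> f (of_int n + 1)"
      using per_i[of 0 n] per[of "of_int n"] unfolding n_def by (simp_all, linarith+)
    then show ?thesis using IVT'[of f "of_int n" y "of_int n + 1"] cont continuous_on_subset by force
  qed
  have "inj f" using mono by (rule strict_mono_imp_inj_on)
  then obtain g where "homeomorphism UNIV (range f) f g"
    using invariance_of_domain_homeomorphism[of UNIV f] cont by auto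
  moreover have "range f = UNIV" using surj by (metis surj_def)
  ultimately have "homeomorphism UNIV UNIV f g" by simp
  moreover have "pl_dyadic f"
  proof -
    let ?B = "range (\<lambda>k::int. of_int k / 2 ^ n :: real)"
    have "uniform_discrete ?B"
      unfolding uniform_discrete_def
    proof (intro exI[of _ "1 / 2 ^ n"] conjI ballI impI)
      fix x y assume "x \<in> ?B" "y \<in> ?B" "dist x y < 1 / 2 ^ n"
      then obtain k l :: int where kl: "x = of_int k / 2 ^ n" "y = of_int l / 2 ^ n" by blast
      with \<open>dist x y < 1 / 2 ^ n\<close> have "\<bar>of_int k - of_int l\<bar> / 2 ^ n < (1 / 2 ^ n :: real)"
        by (simp add: dist_real_def diff_divide_distrib[symmetric])
      then have "\<bar>of_int (k - l)\<bar> < (1::real)" by (simp add: divide_less_cancel)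
      then have "k = l" by linarith
      then show "x = y" using kl by simp
    qed simp
    then have "closed ?B" "discrete ?B"
      by (simp_all add: uniform_discrete_imp_closed uniform_discrete_imp_discrete)
    moreover have "?B \<subseteq> dyadic" using dyadic_iff by blast
    moreover have "\<exists>m::int. \<exists>c \<in> dyadic. \<forall>x \<in> C. f x = 2 powi m * x + c"
      if C: "connected C" "C \<inter> ?B = {}" for C
    proof (cases "C = {}")
      case False
      then obtain x where x: "x \<in> C" by blast
      define k where "k = \<lfloor>x * 2 ^ n\<rfloor>"
      have "of_int k / 2 ^ n \<notin> C" "of_int (k + 1) / 2 ^ n \<notin> C" using C(2) by blast+
      moreover have "of_int k / 2 ^ n \<le> x" "x \<le> of_int (k + 1) / 2 ^ n"
        using floor[of x] unfolding k_def by simp_all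
      ultimately have "C \<subseteq> {of_int k / 2 ^ n..of_int (k + 1) / 2 ^ n}"
        using connectedD_interval[OF C(1) x] connectedD_interval[OF C(1) _ x]
        by (metis (no_types, lifting) atLeastAtMost_iff linear subsetI)
      then show ?thesis using aff[of k] unfolding dyadic_affine_on_def by blast
    qed (use dyadic_simps in blast)
    ultimately show ?thesis unfolding pl_dyadic_iff by (intro exI[of _ ?B]) blast
  qed
  ultimately show ?thesis using per_i by (auto simp: T_tilde_def homeo_line_def)
qed

section \<open>Affine pieces and interpolation\<close>

text \<open>Proportions instead of a slope: composition and inversion become immediate, and
  midpoints go to midpoints, which is what the calculus of subdivisions rests on.\<close>

definition maps_affinely :: "(real \<Rightarrow> real) \<Rightarrow> real \<Rightarrow> real \<Rightarrow> real \<Rightarrow> real \<Rightarrow> bool" where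
  "maps_affinely g u v u' v' \<longleftrightarrow> (\<forall>s\<in>{0..1}. g (u + s * (v - u)) = u' + s * (v' - u'))"

lemma maps_affinelyD:
  assumes "maps_affinely g u v u' v'"
  shows "g u = u'" "g v = v'"
  using bspec[OF assms[unfolded maps_affinely_def], of 0] bspec[OF assms[unfolded maps_affinely_def], of 1] by simp_all

lemma interval_param:
  fixes x :: real
  assumes "u < v" "x \<in> {u..v}"
  shows "\<exists>s\<in>{0..1}. x = u + s * (v - u)"
  using assms by (intro bexI[of _ "(x - u) / (v - u)"]) (auto simp: field_simps)

lemma param_interval:
  fixes s :: real
  assumes "u < v" "s \<in> {0..1}"
  shows "u + s * (v - u) \<in> {u..v}"
proof -
  have "0 \<le> s * (v - u)" "s * (v - u) \<le> 1 * (v - u)"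
    using assms by (auto intro: mult_nonneg_nonneg mult_right_mono)
  then show ?thesis by simp
qed

lemma maps_affinely_cong:
  assumes "maps_affinely g u v u' v'" "u < v" "\<And>x. x \<in> {u..v} \<Longrightarrow> h x = g x"
  shows "maps_affinely h u v u' v'"
  unfolding maps_affinely_def
proof
  fix s :: real assume "s \<in> {0..1}"
  then show "h (u + s * (v - u)) = u' + s * (v' - u')"
    using assms(1) assms(3)[OF param_interval[OF \<open>u < v\<close>]] by (simp add: maps_affinely_def)
qed

lemma maps_affinely_unique:
  assumes "maps_affinely g u v u' v'" "maps_affinely h u v u' v'" "u < v" "x \<in> {u..v}"
  shows "g x = h x"
  using interval_param[OF assms(3,4)] assms(1,2) by (auto simp: maps_affinely_def)

lemma maps_affinely_comp: "maps_affinely g u v u' v' \<Longrightarrow> maps_affinely h u' v' u'' v'' \<Longrightarrow> maps_affinely (h \<circ> g) u v u'' v''"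
  by (simp add: maps_affinely_def)

lemma maps_affinely_inverse: "maps_affinely g u v u' v' \<Longrightarrow> (\<And>x. h (g x) = x) \<Longrightarrow> maps_affinely h u' v' u v"
  unfolding maps_affinely_def by metis

lemma maps_affinely_id: "u < v \<Longrightarrow> (\<And>x. x \<in> {u..v} \<Longrightarrow> g x = x) \<Longrightarrow> maps_affinely g u v u v"
  unfolding maps_affinely_def using param_interval by blast

lemma maps_affinely_halves:
  assumes "maps_affinely g u v u' v'"
  shows "maps_affinely g u ((u + v) / 2) u' ((u' + v') / 2)" "maps_affinely g ((u + v) / 2) v ((u' + v') / 2) v'"
proof -
  have *: "g (u + s * (v - u)) = u' + s * (v' - u')" if "s \<in> {0..1}" for s
    using assms that by (simp add: maps_affinely_def)
  show "maps_affinely g u ((u + v) / 2) u' ((u' + v') / 2)" unfolding maps_affinely_def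
  proof
    fix s :: real assume "s \<in> {0..1}"
    moreover have "u + s * ((u + v) / 2 - u) = u + s / 2 * (v - u)" by (simp add: field_simps)
    ultimately show "g (u + s * ((u + v) / 2 - u)) = u' + s * ((u' + v') / 2 - u')"
      using *[of "s / 2"] by (simp only:) (simp add: field_simps)
  qed
  show "maps_affinely g ((u + v) / 2) v ((u' + v') / 2) v'" unfolding maps_affinely_def
  proof
    fix s :: real assume "s \<in> {0..1}"
    moreover have "(u + v) / 2 + s * (v - (u + v) / 2) = u + (1 + s) / 2 * (v - u)" by (simp add: field_simps)
    ultimately show "g ((u + v) / 2 + s * (v - (u + v) / 2)) = (u' + v') / 2 + s * (v' - (u' + v') / 2)"
      using *[of "(1 + s) / 2"] by (simp only:) (simp add: field_simps)
  qed
qed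

text \<open>The two halves have the same slope because the interior point is the midpoint both in
  the source and in the target.\<close>

lemma maps_affinely_join:
  assumes "maps_affinely g u ((u + v) / 2) u' ((u' + v') / 2)" "maps_affinely g ((u + v) / 2) v ((u' + v') / 2) v'"
  shows "maps_affinely g u v u' v'"
  unfolding maps_affinely_def
proof
  fix s :: real assume s: "s \<in> {0..1}"
  show "g (u + s * (v - u)) = u' + s * (v' - u')"
  proof (cases "s \<le> 1 / 2")
    case True
    then have "2 * s \<in> {0..1}" using s by simp
    then have "g (u + (2 * s) * ((u + v) / 2 - u)) = u' + (2 * s) * ((u' + v') / 2 - u')"
      using assms(1) unfolding maps_affinely_def by blast
    moreover have "u + (2 * s) * ((u + v) / 2 - u) = u + s * (v - u)"
      "u' + (2 * s) * ((u' + v') / 2 - u') = u' + s * (v' - u')" by (simp_all add: field_simps)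
    ultimately show ?thesis by (simp only:)
  next
    case False
    then have "2 * s - 1 \<in> {0..1}" using s by simp
    then have "g ((u + v) / 2 + (2 * s - 1) * (v - (u + v) / 2)) = (u' + v') / 2 + (2 * s - 1) * (v' - (u' + v') / 2)"
      using assms(2) unfolding maps_affinely_def by blast
    moreover have "(u + v) / 2 + (2 * s - 1) * (v - (u + v) / 2) = u + s * (v - u)"
      "(u' + v') / 2 + (2 * s - 1) * (v' - (u' + v') / 2) = u' + s * (v' - u')" by (simp_all add: field_simps)
    ultimately show ?thesis by (simp only:)
  qed
qed

lemma pl_on_affine_ex:
  assumes "u \<in> dyadic" "v \<in> dyadic" "u' \<in> dyadic" "u < v" "v' - u' = 2 powi k * (v - u)"
  obtains f where "pl_on f u v" "maps_affinely f u v u' v'"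
proof
  let ?f = "\<lambda>x. 2 powi k * x + (u' - 2 powi k * u)"
  have "u' - 2 powi k * u \<in> dyadic" using assms by (intro dyadic_diff dyadic_mult) auto
  then show "pl_on ?f u v"
    using assms by (intro pl_on.affine) (auto simp: dyadic_affine_on_def)
  show "maps_affinely ?f u v u' v'" unfolding maps_affinely_def assms(5) by (simp add: algebra_simps)
qed

lemma pl_on_glue_ex:
  assumes "pl_on f a b" "pl_on g b c" "f b = g b"
  obtains h where "pl_on h a c" "\<And>x. x \<in> {a..b} \<Longrightarrow> h x = f x" "\<And>x. x \<in> {b..c} \<Longrightarrow> h x = g x"
proof
  let ?h = "\<lambda>x. if x \<le> b then f x else g x"
  show "?h x = f x" if "x \<in> {a..b}" for x using that by simp
  show *: "?h x = g x" if "x \<in> {b..c}" for x using that assms(3) by auto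
  show "pl_on ?h a c"
    using pl_on.glue[OF pl_on_cong[OF assms(1), of ?h] pl_on_cong[OF assms(2), of ?h]] * by simp
qed

lemma T_tilde_extend:
  assumes pl: "pl_on f a (a + 1)" and "f (a + 1) = f a + 1"
  obtains g where "g \<in> carrier T_tilde" "\<And>x. x \<in> {a..a + 1} \<Longrightarrow> g x = f x"
proof
  let ?g = "\<lambda>x. f (x - of_int \<lfloor>x - a\<rfloor>) + of_int \<lfloor>x - a\<rfloor>"
  show *: "?g x = f x" if "x \<in> {a..a + 1}" for x
  proof (cases "x = a + 1")
    case False
    then have "\<lfloor>x - a\<rfloor> = 0" using that by (simp add: floor_eq_iff)
    then show ?thesis by simp
  qed (simp add: assms)
  show "?g \<in> carrier T_tilde"
  proof (rule T_tildeI)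
    have "\<lfloor>x + 1 - a\<rfloor> = \<lfloor>x - a\<rfloor> + 1" for x by linarith
    then show "?g (x + 1) = ?g x + 1" for x by simp
    show "pl_on ?g a (a + 1)" using pl_on_cong[OF pl, of ?g] * by blast
  qed
qed

text \<open>Cut \<open>[a, b]\<close> into \<open>Suc p\<close> pieces of length
  \<open>2 powi k\<close> and \<open>[c, d]\<close> into \<open>Suc q\<close> pieces of length
  \<open>2 powi l\<close>. Any piece maps affinely onto any other with a power of two as slope, so
  it is enough to equalize the numbers of pieces by halving some of them.\<close>

lemma pl_on_interpolate:
  assumes "a \<in> dyadic" "b \<in> dyadic" "c \<in> dyadic" "d \<in> dyadic" "a < b" "c < d"
  obtains f where "pl_on f a b" "f a = c" "f b = d"
proof -
  have aff: "\<exists>f. pl_on f a (a + 2 powi k) \<and> maps_affinely f a (a + 2 powi k) c (c + 2 powi l)"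
    if "a \<in> dyadic" "c \<in> dyadic" for a c :: real and k l :: int
  proof -
    have "c + 2 powi l - c = 2 powi (l - k) * (a + 2 powi k - a)" by (simp add: power_int_diff)
    moreover have "a + 2 powi k \<in> dyadic" "a < a + 2 powi k" using that by (simp_all add: dyadic_add)
    ultimately show ?thesis using pl_on_affine_ex[OF that(1) _ that(2)] by metis
  qed
  have gen: "\<exists>f. pl_on f a (a + real (Suc p) * 2 powi k) \<and> f a = c \<and> f (a + real (Suc p) * 2 powi k) = c + real (Suc q) * 2 powi l"
    if "a \<in> dyadic" "c \<in> dyadic" for a c :: real and k l :: int and p q :: nat
    using that
  proof (induction "p + q" arbitrary: p q a c k l rule: less_induct)
    case less
    have dyn: "real n \<in> dyadic" for n using dyadic_of_int[of "int n"] by simp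
    have glue: ?case if f: "maps_affinely f a a' c c'" "pl_on f a a'"
       and g: "pl_on g a' (a' + real (Suc p') * 2 powi k')" "g a' = c'" "g (a' + real (Suc p') * 2 powi k') = c' + real (Suc q') * 2 powi l'"
       and e: "a' + real (Suc p') * 2 powi k' = a + real (Suc p) * 2 powi k" "c' + real (Suc q') * 2 powi l' = c + real (Suc q) * 2 powi l"
      for a' c' f g p' q' k' l'
    proof -
      have "f a' = g a'" using maps_affinelyD[OF f(1)] g by simp
      then obtain h where h: "pl_on h a (a + real (Suc p) * 2 powi k)" "\<And>x. x \<in> {a..a'} \<Longrightarrow> h x = f x"
          "\<And>x. x \<in> {a'..a + real (Suc p) * 2 powi k} \<Longrightarrow> h x = g x"
        using pl_on_glue_ex[OF f(2), of g] g(1) e(1) by metis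
      then have "h a = c" using maps_affinelyD[OF f(1)] pl_on_dyadic[OF f(2)] by simp
      moreover have "h (a + real (Suc p) * 2 powi k) = c + real (Suc q) * 2 powi l"
        using h(3)[of "a + real (Suc p) * 2 powi k"] g e pl_on_dyadic[OF g(1)] by simp
      ultimately show ?thesis using h by blast
    qed
    show ?case
    proof (cases p; cases q)
      assume [simp]: "p = 0" "q = 0"
      obtain f where f: "pl_on f a (a + 2 powi k)" "maps_affinely f a (a + 2 powi k) c (c + 2 powi l)"
        using aff less.prems by blast
      show ?thesis using f(1) maps_affinelyD[OF f(2)] by auto
    next
      \<comment> \<open>A single source piece faces several target pieces: one half of it takes up a
        target piece, the other half is again a single piece, so \<open>p + q\<close> drops by one.
        The next case is symmetric.\<close>
      fix q' assume [simp]: "p = 0" "q = Suc q'"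
      obtain f where f: "pl_on f a (a + 2 powi (k - 1))" "maps_affinely f a (a + 2 powi (k - 1)) c (c + 2 powi l)"
        using aff less.prems by blast
      have "\<exists>g. pl_on g (a + 2 powi (k - 1)) (a + 2 powi (k - 1) + real (Suc 0) * 2 powi (k - 1)) \<and> g (a + 2 powi (k - 1)) = c + 2 powi l \<and>
          g (a + 2 powi (k - 1) + real (Suc 0) * 2 powi (k - 1)) = c + 2 powi l + real (Suc q') * 2 powi l"
        by (rule less.hyps) (simp_all add: dyadic_add less.prems)
      then obtain g where g: "pl_on g (a + 2 powi (k - 1)) (a + 2 powi (k - 1) + real (Suc 0) * 2 powi (k - 1))"
         "g (a + 2 powi (k - 1)) = c + 2 powi l" "g (a + 2 powi (k - 1) + real (Suc 0) * 2 powi (k - 1)) = c + 2 powi l + real (Suc q') * 2 powi l"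
        by blast
      show ?thesis by (rule glue[OF f(2,1) g]) (auto simp: power_int_diff field_simps)
    next
      fix p' assume [simp]: "p = Suc p'" "q = 0"
      obtain f where f: "pl_on f a (a + 2 powi k)" "maps_affinely f a (a + 2 powi k) c (c + 2 powi (l - 1))"
        using aff less.prems by blast
      have "\<exists>g. pl_on g (a + 2 powi k) (a + 2 powi k + real (Suc p') * 2 powi k) \<and> g (a + 2 powi k) = c + 2 powi (l - 1) \<and>
          g (a + 2 powi k + real (Suc p') * 2 powi k) = c + 2 powi (l - 1) + real (Suc 0) * 2 powi (l - 1)"
        by (rule less.hyps) (simp_all add: dyadic_add less.prems)
      then obtain g where g: "pl_on g (a + 2 powi k) (a + 2 powi k + real (Suc p') * 2 powi k)"
         "g (a + 2 powi k) = c + 2 powi (l - 1)" "g (a + 2 powi k + real (Suc p') * 2 powi k) = c + 2 powi (l - 1) + real (Suc 0) * 2 powi (l - 1)"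
        by blast
      show ?thesis by (rule glue[OF f(2,1) g]) (auto simp: power_int_diff field_simps)
    next
      fix p' q' assume [simp]: "p = Suc p'" "q = Suc q'"
      obtain f where f: "pl_on f a (a + 2 powi k)" "maps_affinely f a (a + 2 powi k) c (c + 2 powi l)"
        using aff less.prems by blast
      have "\<exists>g. pl_on g (a + 2 powi k) (a + 2 powi k + real (Suc p') * 2 powi k) \<and> g (a + 2 powi k) = c + 2 powi l \<and>
          g (a + 2 powi k + real (Suc p') * 2 powi k) = c + 2 powi l + real (Suc q') * 2 powi l"
        by (rule less.hyps) (simp_all add: dyadic_add less.prems)
      then obtain g where g: "pl_on g (a + 2 powi k) (a + 2 powi k + real (Suc p') * 2 powi k)"
         "g (a + 2 powi k) = c + 2 powi l" "g (a + 2 powi k + real (Suc p') * 2 powi k) = c + 2 powi l + real (Suc q') * 2 powi l"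
        by blast
      show ?thesis by (rule glue[OF f(2,1) g]) (auto simp: field_simps)
    qed
  qed
  have ex: "\<exists>p k. x = real (Suc p) * 2 powi k" if "x \<in> dyadic" "x > 0" for x
  proof -
    obtain p q :: int where x: "x = of_int p / 2 powi q" using \<open>x \<in> dyadic\<close> by (auto simp: dyadic_def)
    then have "of_int p = x * 2 powi q" by simp
    also have "\<dots> > 0" using \<open>x > 0\<close> by simp
    finally have "p > 0" by simp
    then have "x = real (Suc (nat p - 1)) * 2 powi (- q)" using x by (simp add: power_int_minus field_simps of_nat_diff)
    then show ?thesis by blast
  qed
  obtain p k where pk: "b - a = real (Suc p) * 2 powi k" using ex[of "b - a"] assms by (auto intro: dyadic_diff)
  obtain q l where ql: "d - c = real (Suc q) * 2 powi l" using ex[of "d - c"] assms by (auto intro: dyadic_diff)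
  have "a + real (Suc p) * 2 powi k = b" "c + real (Suc q) * 2 powi l = d" using pk ql by linarith+
  then show ?thesis using gen[OF assms(1,3), of p k q l] that by metis
qed

section \<open>The group structure on the lifted Thompson group\<close>

lemma group_T_tilde: "group T_tilde"
proof -
  have "T_tilde = homeo_line\<lparr>carrier := carrier T_tilde\<rparr>" by (simp add: T_tilde_def)
  then show ?thesis using subgroup.subgroup_is_group[OF subgroup_T_tilde group_homeo_line] by simp
qed

interpretation T: group T_tilde by (rule group_T_tilde)

lemma T_tilde_mult [simp]: "f \<otimes>\<^bsub>T_tilde\<^esub> g = f \<circ> g"
  by (simp add: T_tilde_def homeo_line_def)

lemma T_tilde_one [simp]: "\<one>\<^bsub>T_tilde\<^esub> = id"
  by (simp add: T_tilde_def homeo_line_def)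

abbreviation tinv :: "(real \<Rightarrow> real) \<Rightarrow> real \<Rightarrow> real" where
  "tinv \<equiv> m_inv T_tilde"

lemma T_comp [simp]: "f \<in> carrier T_tilde \<Longrightarrow> g \<in> carrier T_tilde \<Longrightarrow> f \<circ> g \<in> carrier T_tilde"
  using T.m_closed[of f g] by simp

lemma T_id [simp]: "id \<in> carrier T_tilde"
  using T.one_closed by simp

lemma tinv_comp [simp]: "f \<in> carrier T_tilde \<Longrightarrow> tinv f \<circ> f = id" "f \<in> carrier T_tilde \<Longrightarrow> f \<circ> tinv f = id"
  using T.l_inv[of f] T.r_inv[of f] by simp_all

lemma tinv_apply [simp]: "f \<in> carrier T_tilde \<Longrightarrow> tinv f (f x) = x" "f \<in> carrier T_tilde \<Longrightarrow> f (tinv f x) = x"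
  using tinv_comp[of f] by (metis comp_apply id_apply)+

lemma T_less_iff: "f \<in> carrier T_tilde \<Longrightarrow> f x < f y \<longleftrightarrow> x < y"
  using T_tildeD(6) strict_mono_less by blast

lemma T_le_iff: "f \<in> carrier T_tilde \<Longrightarrow> f x \<le> f y \<longleftrightarrow> x \<le> y"
  using T_tildeD(6) strict_mono_less_eq by blast

lemma T_eq_iff: "f \<in> carrier T_tilde \<Longrightarrow> f x = f y \<longleftrightarrow> x = y"
  by (metis tinv_apply(1))

lemma T_plus_one: "f \<in> carrier T_tilde \<Longrightarrow> f (x + 1) = f x + 1"
  using T_tildeD(2)[of f x 1] by simp

lemma T_dyadic: "f \<in> carrier T_tilde \<Longrightarrow> x \<in> dyadic \<Longrightarrow> f x \<in> dyadic"
  using T_tildeD(1,3) pl_dyadic_image by blast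

definition translation :: "real \<Rightarrow> real \<Rightarrow> real" where
  "translation z x = x + z"

lemma translation_T: "z \<in> dyadic \<Longrightarrow> translation z \<in> carrier T_tilde"
proof (rule T_tildeI[where a = 0])
  assume "z \<in> dyadic"
  then show "pl_on (translation z) 0 (0 + 1)"
    by (intro pl_on.affine) (auto simp: dyadic_affine_on_def translation_def intro!: exI[of _ 0])
qed (simp add: translation_def)

section \<open>Elements supported in an arc\<close>

definition dyadic_arc :: "real \<Rightarrow> real \<Rightarrow> bool" where
  "dyadic_arc a b \<longleftrightarrow> a \<in> dyadic \<and> b \<in> dyadic \<and> a < b \<and> b < a + 1"

text \<open>Fixing \<open>[b, a + 1]\<close> pointwise means being supported in \<open>(a, b) + \<int>\<close>.\<close>

definition supp_in :: "real \<Rightarrow> real \<Rightarrow> (real \<Rightarrow> real) set" where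
  "supp_in a b = {g \<in> carrier T_tilde. \<forall>x\<in>{b..a + 1}. g x = x}"

lemma supp_in_T [dest]: "g \<in> supp_in a b \<Longrightarrow> g \<in> carrier T_tilde"
  by (simp add: supp_in_def)

lemma supp_in_fix: "g \<in> supp_in a b \<Longrightarrow> x \<in> {b..a + 1} \<Longrightarrow> g x = x"
  by (simp add: supp_in_def)

lemma supp_in_fix_ends:
  assumes "g \<in> supp_in a b" "dyadic_arc a b"
  shows "g a = a" "g b = b"
proof -
  have "g (a + 1) = a + 1" "g b = b" using assms by (auto simp: supp_in_def dyadic_arc_def)
  then show "g a = a" "g b = b" using T_plus_one[of g a] assms by auto
qed

lemma supp_in_mono: "g \<in> supp_in a b \<Longrightarrow> c \<le> a \<Longrightarrow> b \<le> d \<Longrightarrow> dyadic_arc c d \<Longrightarrow> g \<in> supp_in c d"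
  by (auto simp: supp_in_def)

lemma supp_in_id [simp]: "id \<in> supp_in a b"
  by (simp add: supp_in_def)

lemma supp_in_comp: "f \<in> supp_in a b \<Longrightarrow> g \<in> supp_in a b \<Longrightarrow> f \<circ> g \<in> supp_in a b"
  by (auto simp: supp_in_def)

lemma supp_in_inv:
  assumes "f \<in> supp_in a b"
  shows "tinv f \<in> supp_in a b"
proof -
  have "tinv f x = x" if "x \<in> {b..a + 1}" for x
    using supp_in_fix[OF assms that] tinv_apply(1)[OF supp_in_T[OF assms], of x] by simp
  then show ?thesis using supp_in_T[OF assms] by (simp add: supp_in_def)
qed

lemma supp_in_conj:
  assumes "f \<in> supp_in a b" "t \<in> carrier T_tilde"
  shows "t \<circ> f \<circ> tinv t \<in> supp_in (t a) (t b)"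
proof -
  have "f (tinv t x) = tinv t x" if "t b \<le> x" "x \<le> t (a + 1)" for x
  proof (rule supp_in_fix[OF assms(1)])
    show "tinv t x \<in> {b..a + 1}"
      using that T_le_iff[OF assms(2), of b "tinv t x"] T_le_iff[OF assms(2), of "tinv t x" "a + 1"] assms(2) by simp
  qed
  then show ?thesis using assms T_plus_one[OF assms(2), of a] by (auto simp: supp_in_def)
qed

lemma supp_in_maps:
  assumes "g \<in> supp_in a b" "dyadic_arc a b" "x \<in> {a..b}"
  shows "g x \<in> {a..b}"
  using supp_in_fix_ends[OF assms(1,2)] T_le_iff[of g a x] T_le_iff[of g x b] assms by auto

lemma T_tilde_eqI:
  assumes "f \<in> carrier T_tilde" "g \<in> carrier T_tilde" "\<And>x. x \<in> {a..a + 1} \<Longrightarrow> f x = g x"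
  shows "f = g"
proof
  fix x
  define n where "n = \<lfloor>x - a\<rfloor>"
  have "x - of_int n \<in> {a..a + 1}" unfolding n_def by (simp, linarith)
  then have "f (x - of_int n) = g (x - of_int n)" using assms(3) by blast
  then show "f x = g x"
    using T_tildeD(2)[OF assms(1), of "x - of_int n" n] T_tildeD(2)[OF assms(2), of "x - of_int n" n] by simp
qed

lemma supp_in_eqI:
  assumes "f \<in> supp_in a b" "g \<in> supp_in a b" "\<And>x. x \<in> {a..b} \<Longrightarrow> f x = g x"
  shows "f = g"
proof (rule T_tilde_eqI[where a = a])
  show "f x = g x" if "x \<in> {a..a + 1}" for x
    using that assms(3)[of x] supp_in_fix[OF assms(1), of x] supp_in_fix[OF assms(2), of x] by (cases "x \<le> b") auto
qed (use assms(1,2) in auto)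

text \<open>The inequalities say that the arcs, projected to the circle, meet at most in endpoints.
  Each map preserves its own arc and fixes the other one pointwise.\<close>

lemma supp_in_commute:
  assumes f: "f \<in> supp_in a b" and g: "g \<in> supp_in c d" and ab: "dyadic_arc a b" and cd: "dyadic_arc c d"
    and "b \<le> c" "d \<le> a + 1"
  shows "f \<circ> g = g \<circ> f"
proof (rule T_tilde_eqI[where a = a])
  \<comment> \<open>\<open>g\<close> is known to be the identity on \<open>{d..c + 1}\<close>, which
    contains \<open>x + 1\<close> rather than \<open>x\<close>; periodicity brings this
    back.\<close>
  have g_fix: "g x = x" if "x \<in> {a..b}" for x
    using supp_in_fix[OF g, of "x + 1"] T_plus_one[of g x] that assms by auto
  have f_fix: "f x = x" if "x \<in> {c..d}" for x
    using supp_in_fix[OF f, of x] that assms by auto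
  show "(f \<circ> g) x = (g \<circ> f) x" if x: "x \<in> {a..a + 1}" for x
  proof -
    consider "x \<in> {a..b}" | "x \<in> {c..d}" | "x \<notin> {a..b}" "x \<notin> {c..d}" by blast
    then show ?thesis
    proof cases
      case 1
      then show ?thesis using supp_in_maps[OF f ab] g_fix by simp
    next
      case 2
      then show ?thesis using supp_in_maps[OF g cd] f_fix by simp
    next
      case 3
      have "f x = x" using supp_in_fix[OF f, of x] 3 x by simp
      moreover have "g x = x"
      proof (cases "x < c")
        case True
        then show ?thesis using supp_in_fix[OF g, of "x + 1"] T_plus_one[of g x] 3 x assms by auto
      next
        case False
        then show ?thesis using supp_in_fix[OF g, of x] 3 x assms by (auto simp: dyadic_arc_def)
      qed
      ultimately show ?thesis by simp
    qed
  qed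
qed (use supp_in_T[OF f] supp_in_T[OF g] in simp_all)

lemma supp_in_extend:
  assumes f: "pl_on f a b" "f a = a" "f b = b" and "dyadic_arc a b"
  obtains g where "g \<in> supp_in a b" "\<And>x. x \<in> {a..b} \<Longrightarrow> g x = f x"
proof -
  have ab: "a \<in> dyadic" "b \<in> dyadic" "a < b" "b < a + 1" using assms by (auto simp: dyadic_arc_def)
  have "pl_on (\<lambda>x. x) b (a + 1)"
    using ab by (intro pl_on.affine) (auto simp: dyadic_affine_on_def intro!: dyadic_add exI[of _ 0] bexI[of _ 0])
  then obtain h where h: "pl_on h a (a + 1)" "\<And>x. x \<in> {a..b} \<Longrightarrow> h x = f x" "\<And>x. x \<in> {b..a + 1} \<Longrightarrow> h x = x"
    using pl_on_glue_ex[OF f(1), of "\<lambda>x. x" "a + 1"] f(3) by metis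
  obtain g where g: "g \<in> carrier T_tilde" "\<And>x. x \<in> {a..a + 1} \<Longrightarrow> g x = h x"
    using T_tilde_extend[OF h(1)] h(2)[of a] h(3)[of "a + 1"] ab f(2) by auto
  show ?thesis
  proof
    show "g \<in> supp_in a b" using g h ab by (auto simp: supp_in_def)
    show "g x = f x" if "x \<in> {a..b}" for x using g h ab that by auto
  qed
qed

text \<open>The arc and its complement \<open>[b, a + 1]\<close> are interpolated separately;
  sending \<open>a + 1\<close> to \<open>c + 1\<close> makes the result extend periodically.\<close>

lemma dyadic_arc_transitive:
  assumes "dyadic_arc a b" "dyadic_arc c d"
  obtains t where "t \<in> carrier T_tilde" "t a = c" "t b = d"
proof -
  have *: "a \<in> dyadic" "b \<in> dyadic" "a < b" "b < a + 1" "c \<in> dyadic" "d \<in> dyadic" "c < d" "d < c + 1"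
    using assms by (auto simp: dyadic_arc_def)
  obtain f where f: "pl_on f a b" "f a = c" "f b = d" using pl_on_interpolate[of a b c d] * by auto
  have "a + 1 \<in> dyadic" "c + 1 \<in> dyadic" using * by (auto intro: dyadic_add)
  then obtain g where g: "pl_on g b (a + 1)" "g b = d" "g (a + 1) = c + 1"
    using pl_on_interpolate[of b "a + 1" d "c + 1"] * by auto
  obtain h where h: "pl_on h a (a + 1)" "\<And>x. x \<in> {a..b} \<Longrightarrow> h x = f x" "\<And>x. x \<in> {b..a + 1} \<Longrightarrow> h x = g x"
    using pl_on_glue_ex[OF f(1) g(1)] f g by auto
  have "h (a + 1) = h a + 1" using h(2)[of a] h(3)[of "a + 1"] f g * by simp
  then obtain t where t: "t \<in> carrier T_tilde" "\<And>x. x \<in> {a..a + 1} \<Longrightarrow> t x = h x"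
    using T_tilde_extend[OF h(1)] by blast
  show ?thesis by (rule that[OF t(1)]) (use t h f g * in auto)
qed

lemma supp_in_transitive:
  assumes "dyadic_arc a b" "u \<in> dyadic" "v \<in> dyadic" "u \<in> {a<..<b}" "v \<in> {a<..<b}"
  obtains g where "g \<in> supp_in a b" "g u = v"
proof -
  have *: "a \<in> dyadic" "b \<in> dyadic" "a < b" "b < a + 1" using assms by (auto simp: dyadic_arc_def)
  obtain f1 where f1: "pl_on f1 a u" "f1 a = a" "f1 u = v" using pl_on_interpolate[of a u a v] * assms by auto
  obtain f2 where f2: "pl_on f2 u b" "f2 u = v" "f2 b = b" using pl_on_interpolate[of u b v b] * assms by auto
  obtain h where h: "pl_on h a b" "\<And>x. x \<in> {a..u} \<Longrightarrow> h x = f1 x" "\<And>x. x \<in> {u..b} \<Longrightarrow> h x = f2 x"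
    using pl_on_glue_ex[OF f1(1) f2(1)] f1 f2 by auto
  have "h a = a" "h b = b" "h u = v" using h(2)[of a] h(3)[of b] h(2)[of u] f1 f2 assms by auto
  then show ?thesis using supp_in_extend[OF h(1) _ _ assms(1)] that assms
    by (metis atLeastAtMost_iff greaterThanLessThan_iff less_imp_le)
qed

section \<open>Caret shifts and their conjugacy\<close>

lemma maps_affinely_join_ex:
  assumes "a \<in> dyadic" "m \<in> dyadic" "b \<in> dyadic" "a' \<in> dyadic" "m' \<in> dyadic" "a < m" "m < b"
    "m' - a' = 2 powi k * (m - a)" "b' - m' = 2 powi l * (b - m)"
  obtains f where "pl_on f a b" "maps_affinely f a m a' m'" "maps_affinely f m b m' b'"
proof -
  obtain f1 where f1: "pl_on f1 a m" "maps_affinely f1 a m a' m'" using assms pl_on_affine_ex by blast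
  obtain f2 where f2: "pl_on f2 m b" "maps_affinely f2 m b m' b'" using assms pl_on_affine_ex by blast
  obtain h where h: "pl_on h a b" "\<And>x. x \<in> {a..m} \<Longrightarrow> h x = f1 x" "\<And>x. x \<in> {m..b} \<Longrightarrow> h x = f2 x"
    using pl_on_glue_ex[OF f1(1) f2(1)] maps_affinelyD[OF f1(2)] maps_affinelyD[OF f2(2)] by auto
  show ?thesis
    using that[OF h(1)] maps_affinely_cong[OF f1(2) \<open>a < m\<close> h(2)] maps_affinely_cong[OF f2(2) \<open>m < b\<close> h(3)] by blast
qed

text \<open>The standard generator of Thompson's group F: it moves the subdivision point of \<open>[a, m]\<close> to \<open>[m, b]\<close>.\<close>

definition caret_shift :: "real \<Rightarrow> real \<Rightarrow> real \<Rightarrow> (real \<Rightarrow> real) \<Rightarrow> bool" where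
  "caret_shift a m b g \<longleftrightarrow> g \<in> supp_in a b \<and> maps_affinely g a ((a + m) / 2) a m \<and>
     maps_affinely g ((a + m) / 2) m m ((m + b) / 2) \<and> maps_affinely g m b ((m + b) / 2) b"

text \<open>The caret shift has slopes \<open>2\<close>, \<open>(b - m) / (m - a)\<close> and
  \<open>1 / 2\<close>; lengths that are powers of two make the middle one admissible. The halves
  may have different lengths, as neighbouring cells of a partition do.\<close>

definition caret_triple :: "real \<Rightarrow> real \<Rightarrow> real \<Rightarrow> bool" where
  "caret_triple a m b \<longleftrightarrow> dyadic_arc a b \<and> m \<in> dyadic \<and> a < m \<and> m < b \<and>
     (\<exists>k::int. m - a = 2 powi k) \<and> (\<exists>k::int. b - m = 2 powi k)"

lemma caret_shift_ex:
  assumes "caret_triple a m b"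
  obtains g where "caret_shift a m b g"
proof -
  obtain k l :: int where *: "a \<in> dyadic" "b \<in> dyadic" "a < m" "m < b" "m \<in> dyadic" "m - a = 2 powi k" "b - m = 2 powi l"
    "dyadic_arc a b" using assms by (auto simp: caret_triple_def dyadic_arc_def)
  have mid: "(a + m) / 2 \<in> dyadic" "(m + b) / 2 \<in> dyadic" using * by (auto intro: dyadic_mid)
  have eq: "m - a = 2 powi 1 * ((a + m) / 2 - a)" "(m + b) / 2 - m = 2 powi (l - k) * (m - (a + m) / 2)"
    "b - (m + b) / 2 = 2 powi (-1) * (b - m)"
  proof -
    have "2 powi (l - k) * (m - a) = b - m" unfolding *(6,7) by (simp add: power_int_diff)
    then show "(m + b) / 2 - m = 2 powi (l - k) * (m - (a + m) / 2)" by (simp add: field_simps)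
  qed (simp_all add: field_simps power_int_minus)
  obtain f1 where f1: "pl_on f1 a m" "maps_affinely f1 a ((a + m) / 2) a m" "maps_affinely f1 ((a + m) / 2) m m ((m + b) / 2)"
    by (rule maps_affinely_join_ex[OF _ _ _ _ _ _ _ eq(1,2)]) (use * mid in auto)
  obtain f2 where f2: "pl_on f2 m b" "maps_affinely f2 m b ((m + b) / 2) b"
    by (rule pl_on_affine_ex[OF _ _ _ _ eq(3)]) (use * mid in auto)
  obtain h where h: "pl_on h a b" "\<And>x. x \<in> {a..m} \<Longrightarrow> h x = f1 x" "\<And>x. x \<in> {m..b} \<Longrightarrow> h x = f2 x"
    using pl_on_glue_ex[OF f1(1) f2(1)] maps_affinelyD[OF f1(3)] maps_affinelyD[OF f2(2)] by auto
  have ends: "h a = a" "h b = b" using h(2)[of a] h(3)[of b] maps_affinelyD[OF f1(2)] maps_affinelyD[OF f2(2)] * by auto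
  obtain g where g: "g \<in> supp_in a b" "\<And>x. x \<in> {a..b} \<Longrightarrow> g x = h x"
    using supp_in_extend[OF h(1) ends \<open>dyadic_arc a b\<close>] by blast
  show ?thesis
  proof
    show "caret_shift a m b g" unfolding caret_shift_def
    proof (intro conjI g(1))
      show "maps_affinely g a ((a + m) / 2) a m" by (rule maps_affinely_cong[OF f1(2)]) (use g h * in auto)
      show "maps_affinely g ((a + m) / 2) m m ((m + b) / 2)" by (rule maps_affinely_cong[OF f1(3)]) (use g h * in auto)
      show "maps_affinely g m b ((m + b) / 2) b" by (rule maps_affinely_cong[OF f2(2)]) (use g h * in auto)
    qed
  qed
qed

lemma caret_shift_unique:
  assumes "caret_shift a m b f" "caret_shift a m b g" "caret_triple a m b"
  shows "f = g"
proof (rule supp_in_eqI)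
  show "f \<in> supp_in a b" "g \<in> supp_in a b" using assms by (auto simp: caret_shift_def)
  fix x assume x: "x \<in> {a..b}"
  have am: "a < m" "m < b" using assms by (auto simp: caret_triple_def)
  consider "x \<in> {a..(a + m) / 2}" | "x \<in> {(a + m) / 2..m}" | "x \<in> {m..b}" using x by fastforce
  then show "f x = g x"
  proof cases
    case 1
    then show ?thesis using assms maps_affinely_unique[of f a "(a + m) / 2" a m g x] am by (simp add: caret_shift_def)
  next
    case 2
    then show ?thesis using assms maps_affinely_unique[of f "(a + m) / 2" m m "(m + b) / 2" g x] am by (simp add: caret_shift_def)
  next
    case 3
    then show ?thesis using assms maps_affinely_unique[of f m b "(m + b) / 2" b g x] am by (simp add: caret_shift_def)
  qed
qed

text \<open>Being affine on both halves, \<open>t\<close> takes their midpoints to the midpoints of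
  the image halves, so the pattern of the three pieces is carried over.\<close>

lemma caret_shift_conj:
  assumes X: "caret_shift a m b g" and t: "t \<in> carrier T_tilde" "maps_affinely t a m a' m'" "maps_affinely t m b m' b'"
  shows "caret_shift a' m' b' (t \<circ> g \<circ> tinv t)"
proof -
  note X = X[unfolded caret_shift_def]
  have inv: "maps_affinely (tinv t) a' m' a m" "maps_affinely (tinv t) m' b' m b"
    using maps_affinely_inverse[OF t(2), of "tinv t"] maps_affinely_inverse[OF t(3), of "tinv t"] t(1) by auto
  have "t a = a'" "t b = b'" using maps_affinelyD[OF t(2)] maps_affinelyD[OF t(3)] by auto
  then have "t \<circ> g \<circ> tinv t \<in> supp_in a' b'" using supp_in_conj[OF _ t(1), of g a b] X by simp
  moreover have "maps_affinely (t \<circ> g \<circ> tinv t) a' ((a' + m') / 2) a' m'"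
    using X by (intro maps_affinely_comp[OF maps_affinely_halves(1)[OF inv(1)]] maps_affinely_comp[OF _ t(2)]) auto
  moreover have "maps_affinely (t \<circ> g \<circ> tinv t) ((a' + m') / 2) m' m' ((m' + b') / 2)"
    using X by (intro maps_affinely_comp[OF maps_affinely_halves(2)[OF inv(1)]] maps_affinely_comp[OF _ maps_affinely_halves(1)[OF t(3)]]) auto
  moreover have "maps_affinely (t \<circ> g \<circ> tinv t) m' b' ((m' + b') / 2) b'"
    using X by (intro maps_affinely_comp[OF inv(2)] maps_affinely_comp[OF _ maps_affinely_halves(2)[OF t(3)]]) auto
  ultimately show ?thesis unfolding caret_shift_def by blast
qed

lemma caret_triple_ratio:
  assumes "caret_triple a m b" "caret_triple a' m' b'"
  shows "\<exists>k::int. m' - a' = 2 powi k * (m - a)" "\<exists>k::int. b' - m' = 2 powi k * (b - m)"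
proof -
  obtain k l k' l' :: int where "m - a = 2 powi k" "b - m = 2 powi l" "m' - a' = 2 powi k'" "b' - m' = 2 powi l'"
    using assms by (auto simp: caret_triple_def)
  then have "m' - a' = 2 powi (k' - k) * (m - a)" "b' - m' = 2 powi (l' - l) * (b - m)" by (simp_all add: power_int_diff)
  then show "\<exists>k::int. m' - a' = 2 powi k * (m - a)" "\<exists>k::int. b' - m' = 2 powi k * (b - m)" by blast+
qed

lemma caret_triple_transitive:
  assumes "caret_triple a m b" "caret_triple a' m' b'"
  obtains t where "t \<in> carrier T_tilde" "maps_affinely t a m a' m'" "maps_affinely t m b m' b'"
proof -
  obtain k l :: int where eq: "m' - a' = 2 powi k * (m - a)" "b' - m' = 2 powi l * (b - m)"
    using caret_triple_ratio[OF assms] by blast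
  have *: "a \<in> dyadic" "m \<in> dyadic" "b \<in> dyadic" "a' \<in> dyadic" "m' \<in> dyadic" "b' \<in> dyadic" "a < m" "m < b"
    "b < a + 1" "b' < a' + 1" using assms by (auto simp: caret_triple_def dyadic_arc_def)
  obtain f1 where f1: "pl_on f1 a b" "maps_affinely f1 a m a' m'" "maps_affinely f1 m b m' b'"
    by (rule maps_affinely_join_ex[OF _ _ _ _ _ _ _ eq]) (use * in auto)
  have "a + 1 \<in> dyadic" "a' + 1 \<in> dyadic" using * by (auto intro: dyadic_add)
  then obtain f2 where f2: "pl_on f2 b (a + 1)" "f2 b = b'" "f2 (a + 1) = a' + 1"
    using pl_on_interpolate[of b "a + 1" b' "a' + 1"] * by auto
  obtain h where h: "pl_on h a (a + 1)" "\<And>x. x \<in> {a..b} \<Longrightarrow> h x = f1 x" "\<And>x. x \<in> {b..a + 1} \<Longrightarrow> h x = f2 x"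
    using pl_on_glue_ex[OF f1(1) f2(1)] maps_affinelyD[OF f1(3)] f2 by auto
  have "h (a + 1) = h a + 1" using h(2)[of a] h(3)[of "a + 1"] f2 maps_affinelyD[OF f1(2)] * by auto
  then obtain t where t: "t \<in> carrier T_tilde" "\<And>x. x \<in> {a..a + 1} \<Longrightarrow> t x = h x"
    using T_tilde_extend[OF h(1)] by blast
  show ?thesis
  proof (rule that[OF t(1)])
    show "maps_affinely t a m a' m'" by (rule maps_affinely_cong[OF f1(2)]) (use t h * in auto)
    show "maps_affinely t m b m' b'" by (rule maps_affinely_cong[OF f1(3)]) (use t h * in auto)
  qed
qed

text \<open>With the conjugator inside \<open>supp_in A B\<close>, two conjugate caret shifts differ
  by a commutator of elements of that arc. The strict inequalities leave gaps in which the
  conjugator is interpolated back to the fixed ends \<open>A\<close> and \<open>B\<close>.\<close>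

lemma caret_triple_transitive_supp:
  assumes "caret_triple a m b" "caret_triple a' m' b'" "dyadic_arc A B" "A < a" "A < a'" "b < B" "b' < B"
  obtains t where "t \<in> supp_in A B" "maps_affinely t a m a' m'" "maps_affinely t m b m' b'"
proof -
  obtain k l :: int where eq: "m' - a' = 2 powi k * (m - a)" "b' - m' = 2 powi l * (b - m)"
    using caret_triple_ratio[OF assms(1,2)] by blast
  have *: "a \<in> dyadic" "m \<in> dyadic" "b \<in> dyadic" "a' \<in> dyadic" "m' \<in> dyadic" "b' \<in> dyadic" "a < m" "m < b"
    "A \<in> dyadic" "B \<in> dyadic" using assms by (auto simp: caret_triple_def dyadic_arc_def)
  obtain f0 where f0: "pl_on f0 A a" "f0 A = A" "f0 a = a'"
    using pl_on_interpolate[of A a A a'] * assms by auto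
  obtain f1 where f1: "pl_on f1 a b" "maps_affinely f1 a m a' m'" "maps_affinely f1 m b m' b'"
    by (rule maps_affinely_join_ex[OF _ _ _ _ _ _ _ eq]) (use * in auto)
  obtain f2 where f2: "pl_on f2 b B" "f2 b = b'" "f2 B = B"
    using pl_on_interpolate[of b B b' B] * assms by auto
  obtain g where g: "pl_on g a B" "\<And>x. x \<in> {a..b} \<Longrightarrow> g x = f1 x" "\<And>x. x \<in> {b..B} \<Longrightarrow> g x = f2 x"
    using pl_on_glue_ex[OF f1(1) f2(1)] maps_affinelyD[OF f1(3)] f2 by auto
  have "g a = a'" using g(2)[of a] maps_affinelyD[OF f1(2)] * by simp
  then obtain h where h: "pl_on h A B" "\<And>x. x \<in> {A..a} \<Longrightarrow> h x = f0 x" "\<And>x. x \<in> {a..B} \<Longrightarrow> h x = g x"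
    using pl_on_glue_ex[OF f0(1) g(1)] f0 by auto
  have "h A = A" "h B = B" using h(2)[of A] h(3)[of B] g(3)[of B] f0 f2 assms * by auto
  then obtain t where t: "t \<in> supp_in A B" "\<And>x. x \<in> {A..B} \<Longrightarrow> t x = h x"
    using supp_in_extend[OF h(1) _ _ \<open>dyadic_arc A B\<close>] by blast
  show ?thesis
  proof (rule that[OF t(1)])
    show "maps_affinely t a m a' m'" by (rule maps_affinely_cong[OF f1(2)]) (use t h g assms * in auto)
    show "maps_affinely t m b m' b'" by (rule maps_affinely_cong[OF f1(3)]) (use t h g assms * in auto)
  qed
qed

section \<open>Standard dyadic partitions\<close>

text \<open>Both sides turn the left comb with four leaves into the right comb. This takes two
  rotations at the root, or three rotations when one starts at the left child and ends at the right
  child: the associativity pentagon.\<close>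

lemma caret_shift_pentagon:
  assumes "caret_triple a m b" and X: "caret_shift a m b f" and X0: "caret_shift a ((a + m) / 2) m f0"
    and X1: "caret_shift m ((m + b) / 2) b f1"
  shows "f \<circ> f = f1 \<circ> f \<circ> f0"
proof -
  define c where "c = (a + m) / 2"
  define d where "d = (m + b) / 2"
  define q where "q = (a + c) / 2"
  have am: "a < m" "m < b" "dyadic_arc a b" using assms(1) by (auto simp: caret_triple_def)
  then have lt: "a < q" "q < c" "c < m" "m < d" "d < b" "b < a + 1"
    unfolding q_def c_def d_def by (auto simp: dyadic_arc_def)
  note X = X[unfolded caret_shift_def, folded c_def d_def]
  note X0 = X0[unfolded caret_shift_def, folded c_def, folded q_def]
  note X1 = X1[unfolded caret_shift_def, folded d_def]
  have f: "maps_affinely f a c a m" "maps_affinely f c m m d" "maps_affinely f m b d b"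
    using X by (simp_all)
  have f0: "maps_affinely f0 a q a c" "maps_affinely f0 q c c ((c + m) / 2)" "maps_affinely f0 c m ((c + m) / 2) m" "maps_affinely f0 m b m b"
    using X0 maps_affinely_id[of m b f0] supp_in_fix[of f0 a m] lt am by (auto simp: dyadic_arc_def)
  have f1: "maps_affinely f1 m ((m + d) / 2) m d" "maps_affinely f1 ((m + d) / 2) d d ((d + b) / 2)" "maps_affinely f1 d b ((d + b) / 2) b" "maps_affinely f1 a m a m"
  proof -
    have "f1 x = x" if "x \<in> {a..m}" for x
      using supp_in_fix[of f1 m b "x + 1"] T_plus_one[of f1 x] X1 that lt by auto
    then show "maps_affinely f1 a m a m" using maps_affinely_id[of a m f1] am by blast
  qed (use X1 in simp_all)
  have ff: "maps_affinely (f \<circ> f) a q a m" "maps_affinely (f \<circ> f) q c m d" "maps_affinely (f \<circ> f) c m d ((d + b) / 2)" "maps_affinely (f \<circ> f) m b ((d + b) / 2) b"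
  proof -
    have "maps_affinely f a q a c" "maps_affinely f q c c m"
      using maps_affinely_halves[OF f(1)] unfolding q_def c_def by simp_all
    then show "maps_affinely (f \<circ> f) a q a m" "maps_affinely (f \<circ> f) q c m d" using f(1,2) maps_affinely_comp by blast+
    have "maps_affinely f m d d ((d + b) / 2)" "maps_affinely f d b ((d + b) / 2) b"
      using maps_affinely_halves[OF f(3)] unfolding d_def by simp_all
    then show "maps_affinely (f \<circ> f) c m d ((d + b) / 2)" "maps_affinely (f \<circ> f) m b ((d + b) / 2) b"
      using f(2,3) maps_affinely_comp by blast+
  qed
  have gg: "maps_affinely (f1 \<circ> (f \<circ> f0)) a q a m" "maps_affinely (f1 \<circ> (f \<circ> f0)) q c m d"
    "maps_affinely (f1 \<circ> (f \<circ> f0)) c m d ((d + b) / 2)" "maps_affinely (f1 \<circ> (f \<circ> f0)) m b ((d + b) / 2) b"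
    using maps_affinely_comp[OF maps_affinely_comp[OF f0(1) f(1)] f1(4)] maps_affinely_comp[OF maps_affinely_comp[OF f0(2) maps_affinely_halves(1)[OF f(2)]] f1(1)]
      maps_affinely_comp[OF maps_affinely_comp[OF f0(3) maps_affinely_halves(2)[OF f(2)]] f1(2)]
      maps_affinely_comp[OF maps_affinely_comp[OF f0(4) f(3)] f1(3)] by blast+
  have "f \<circ> f = f1 \<circ> (f \<circ> f0)"
  proof (rule supp_in_eqI)
    have "f0 \<in> supp_in a b" using supp_in_mono[of f0 a m a b] X0 am by auto
    moreover have "f1 \<in> supp_in a b" using supp_in_mono[of f1 m b a b] X1 am by auto
    ultimately show "f \<circ> f \<in> supp_in a b" "f1 \<circ> (f \<circ> f0) \<in> supp_in a b" using X by (simp_all add: supp_in_comp)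
    fix x assume "x \<in> {a..b}"
    then consider "x \<in> {a..q}" | "x \<in> {q..c}" | "x \<in> {c..m}" | "x \<in> {m..b}" by fastforce
    then show "(f \<circ> f) x = (f1 \<circ> (f \<circ> f0)) x"
      using maps_affinely_unique[OF ff(1) gg(1)] maps_affinely_unique[OF ff(2) gg(2)] maps_affinely_unique[OF ff(3) gg(3)]
        maps_affinely_unique[OF ff(4) gg(4)] lt by cases auto
  qed
  then show ?thesis by (simp add: comp_assoc)
qed

definition consecutive :: "real set \<Rightarrow> real \<Rightarrow> real \<Rightarrow> bool" where
  "consecutive S u v \<longleftrightarrow> u \<in> S \<and> v \<in> S \<and> u < v \<and> (\<forall>s\<in>S. s \<le> u \<or> v \<le> s)"

definition std_partition :: "real set \<Rightarrow> bool" where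
  "std_partition S \<longleftrightarrow> (\<forall>u v. consecutive S u v \<longrightarrow> std_interval u v)"

text \<open>If both sets are standard partitions, this is a tree pair diagram for \<open>g\<close>:
  the cells of \<open>S\<close> are the leaves of the domain tree, those of \<open>S'\<close> the
  leaves of the range tree.\<close>

definition carries :: "(real \<Rightarrow> real) \<Rightarrow> real set \<Rightarrow> real set \<Rightarrow> bool" where
  "carries g S S' \<longleftrightarrow> g ` S = S' \<and> (\<forall>u v. consecutive S u v \<longrightarrow> maps_affinely g u v (g u) (g v))"

lemma consecutive_between: "consecutive S u v \<Longrightarrow> s \<in> S \<Longrightarrow> s \<le> u \<or> v \<le> s"
  by (simp add: consecutive_def)

lemma consecutiveD: "consecutive S u v \<Longrightarrow> u \<in> S \<and> v \<in> S \<and> u < v"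
  by (simp add: consecutive_def)

lemma consecutive_unique:
  assumes "consecutive S u v" "consecutive S u v'"
  shows "v = v'"
  using consecutive_between[OF assms(1), of v'] consecutive_between[OF assms(2), of v]
    consecutiveD[OF assms(1)] consecutiveD[OF assms(2)] by linarith

lemma powi_le_iff: "(2::real) powi m \<le> 2 powi n \<longleftrightarrow> m \<le> n"
  using power_int_strict_increasing[of n m "2::real"] power_int_increasing[of m n "2::real"] by linarith

lemma consecutive_succ:
  assumes "finite S" "x \<in> S" "y \<in> S" "x < y"
  obtains t where "consecutive S x t"
proof
  let ?A = "{s \<in> S. x < s}"
  have A: "finite ?A" "?A \<noteq> {}" using assms by auto
  have "s \<le> x \<or> Min ?A \<le> s" if "s \<in> S" for s
    using Min_le[OF A(1), of s] that by (cases "x < s") auto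
  then show "consecutive S x (Min ?A)"
    using Min_in[OF A] \<open>x \<in> S\<close> by (simp add: consecutive_def)
qed

lemma consecutive_pred:
  assumes "finite S" "x \<in> S" "y \<in> S" "y < x"
  obtains t where "consecutive S t x"
proof
  let ?A = "{s \<in> S. s < x}"
  have A: "finite ?A" "?A \<noteq> {}" using assms by auto
  have "s \<le> Max ?A \<or> x \<le> s" if "s \<in> S" for s
    using Max_ge[OF A(1), of s] that by (cases "s < x") auto
  then show "consecutive S (Max ?A) x"
    using Max_in[OF A] \<open>x \<in> S\<close> by (simp add: consecutive_def)
qed

lemma consecutive_image:
  assumes "g \<in> carrier T_tilde"
  shows "consecutive (g ` S) (g u) (g v) \<longleftrightarrow> consecutive S u v"
proof -
  have "g x \<in> g ` S \<longleftrightarrow> x \<in> S" for x using T_eq_iff[OF assms] by auto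
  then show ?thesis using T_less_iff[OF assms] T_le_iff[OF assms] by (simp add: consecutive_def)
qed

lemma consecutive_insert_mid:
  assumes "consecutive S u v"
  shows "consecutive (insert ((u + v) / 2) S) u ((u + v) / 2)" "consecutive (insert ((u + v) / 2) S) ((u + v) / 2) v"
  using assms by (auto simp: consecutive_def)

lemma carries_comp:
  assumes "f \<in> carrier T_tilde" "carries f S S'" "carries g S' S''"
  shows "carries (g \<circ> f) S S''"
proof -
  have S': "S' = f ` S" using assms(2) by (simp add: carries_def)
  have "maps_affinely (g \<circ> f) u v (g (f u)) (g (f v))" if "consecutive S u v" for u v
  proof (rule maps_affinely_comp)
    show "maps_affinely f u v (f u) (f v)" using assms(2) that by (simp add: carries_def)
    have "consecutive S' (f u) (f v)" unfolding S' using that consecutive_image[OF assms(1)] by blast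
    then show "maps_affinely g (f u) (f v) (g (f u)) (g (f v))" using assms(3) by (simp add: carries_def)
  qed
  then show ?thesis using S' assms(3) by (simp add: carries_def image_comp)
qed

lemma carries_inv:
  assumes "f \<in> carrier T_tilde" "carries f S S'"
  shows "carries (tinv f) S' S"
proof -
  have S': "f ` S = S'" using assms by (simp add: carries_def)
  then have S: "tinv f ` S' = S" using assms(1) by (auto simp: image_image)
  have "maps_affinely (tinv f) u v (tinv f u) (tinv f v)" if "consecutive S' u v" for u v
  proof -
    have "consecutive S (tinv f u) (tinv f v)"
      using that consecutive_image[OF assms(1), of S "tinv f u" "tinv f v"] S' assms(1) by simp
    then have "maps_affinely f (tinv f u) (tinv f v) (f (tinv f u)) (f (tinv f v))"
      using assms(2) by (simp add: carries_def)
    then show ?thesis using maps_affinely_inverse[of f _ _ u v "tinv f"] assms(1) by simp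
  qed
  then show ?thesis using S by (simp add: carries_def)
qed

lemma std_intervalD:
  assumes "std_interval u v"
  shows "u \<in> dyadic" "v \<in> dyadic" "u < v" "\<exists>k::int. v - u = 2 powi k"
proof -
  obtain k m :: int where uv: "u = of_int k * 2 powi m" "v = of_int (k + 1) * 2 powi m"
    using assms by (auto simp: std_interval_def)
  show "u \<in> dyadic" "v \<in> dyadic" unfolding uv by (intro dyadic_mult dyadic_of_int dyadic_powi)+
  have "v - u = 2 powi m" unfolding uv by (simp add: algebra_simps)
  then show "\<exists>k::int. v - u = 2 powi k" by blast
  have "0 < (2::real) powi m" by simp
  then show "u < v" using \<open>v - u = 2 powi m\<close> by linarith
qed

text \<open>An odd numerator is in lowest terms, so the same number has no representation over a
  strictly coarser unit.\<close>

lemma std_interval_odd_exponent: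
  assumes "of_int i * 2 powi m' = of_int j * (2 powi m :: real)" "m \<le> m'" "odd j"
  shows "m' = m" "i = j"
proof -
  have "of_int i * 2 powi (m' - m) = (of_int j :: real)"
    using assms(1) by (simp add: power_int_diff field_simps)
  moreover have "(2::real) powi (m' - m) = of_int (2 ^ nat (m' - m))"
    using assms(2) by (simp add: power_int_def)
  ultimately have "of_int (i * 2 ^ nat (m' - m)) = (of_int j :: real)" by simp
  then have ij: "i * 2 ^ nat (m' - m) = j" by (simp only: of_int_eq_iff)
  then have "nat (m' - m) = 0" using assms(3) by (metis dvd_mult dvd_power gr0I)
  then show "m' = m" "i = j" using assms(2) ij by auto
qed

text \<open>A shortest cell is a deepest leaf, so its sibling is a leaf too. Concretely, the
  endpoint shared with the sibling has an odd numerator at level \<open>m\<close>; the neighbouring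
  cell, being at least as long, must then sit at the same level. A single cell is excluded because
  the sibling of \<open>[0, 1 / 2]\<close> lies outside.\<close>

lemma std_partition_sibling:
  assumes S: "finite S" "0 \<in> S" "1 / 2 \<in> S" "S \<subseteq> {0..1 / 2}" "std_partition S" "card S > 2"
  obtains u m v where "consecutive S u m" "consecutive S m v" "m = (u + v) / 2" "std_interval u v"
proof -
  let ?P = "{(p, q). consecutive S p q}"
  have "?P \<subseteq> S \<times> S" by (auto simp: consecutive_def)
  then have fin: "finite ?P" using S(1) finite_subset by blast
  obtain t where "consecutive S 0 t" using consecutive_succ[OF S(1,2,3)] by auto
  then have "?P \<noteq> {}" by blast
  then obtain p q where pq: "consecutive S p q" and min: "\<And>p' q'. consecutive S p' q' \<Longrightarrow> q - p \<le> q' - p'"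
    using ex_min_if_finite[of "(\<lambda>(p, q). q - p) ` ?P"] fin by (auto simp: not_less image_iff) 
  obtain k m :: int where k: "p = of_int k * 2 powi m" "q = of_int (k + 1) * 2 powi m"
    using pq S(5) unfolding std_partition_def std_interval_def by blast
  have len: "q - p = 2 powi m" unfolding k by (simp add: algebra_simps)
  have pow_le: "m \<le> m'" if "consecutive S p' q'" "q' - p' = 2 powi m'" for p' q' m'
    using min[OF that(1)] that(2) len by (simp add: powi_le_iff)
  have half: "(2::real) powi (i + 1) = 2 * 2 powi i" "(2::real) powi (1 + i) = 2 * 2 powi i" for i
    by (simp_all add: power_int_add)
  show ?thesis
  proof (cases "even k")
    case True
    then obtain j where j: "k = 2 * j" by (elim evenE)
    \<comment> \<open>Otherwise \<open>1 / 2\<close> would have the odd numerator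
      \<open>k + 1\<close> at level \<open>m\<close>, so \<open>m = - 1\<close>,
      \<open>p = 0\<close>, and the partition would consist of a single cell.\<close>
    have q: "q < 1 / 2"
    proof (rule ccontr)
      assume "\<not> q < 1 / 2"
      moreover have "q \<le> 1 / 2" "0 \<le> p" using pq S(4) by (auto simp: consecutive_def)
      ultimately have q: "q = 1 / 2" by simp
      have "(2::real) powi m \<le> 2 powi (- 1)" using len q \<open>0 \<le> p\<close> by (simp add: power_int_minus)
      then have "m \<le> - 1" by (simp only: powi_le_iff)
      then have "m = - 1 \<and> 1 = k + 1"
        using std_interval_odd_exponent[of 1 "- 1" "k + 1" m] k(2) q True by (simp add: power_int_minus)
      then have "p = 0" using k by simp
      have "S \<subseteq> {0, 1 / 2}"
      proof
        fix s assume "s \<in> S"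
        then show "s \<in> {0, 1 / 2}" using consecutive_between[OF pq, of s] \<open>p = 0\<close> q S(4) by auto
      qed
      then have "card S \<le> 2" using card_mono[of "{0, 1 / 2}" S] by auto
      then show False using S(6) by simp
    qed
    then obtain r where r: "consecutive S q r" using consecutive_succ[OF S(1), of q "1 / 2"] pq S(3) by (auto simp: consecutive_def)
    then obtain k' m' :: int where k': "q = of_int k' * 2 powi m'" "r = of_int (k' + 1) * 2 powi m'"
      using S(5) unfolding std_partition_def std_interval_def by blast
    then have "m \<le> m'" using pow_le[OF r, of m'] by (simp add: algebra_simps)
    then have "m' = m" "k' = k + 1" using std_interval_odd_exponent[of k' m' "k + 1" m] k(2) k'(1) True by auto
    then have r': "r = of_int (k + 2) * 2 powi m" using k' by simp
    show ?thesis
    proof (rule that[OF pq r])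
      show "q = (p + r) / 2" unfolding k r' by (simp add: algebra_simps)
      show "std_interval p r" unfolding std_interval_def k r' j
        by (rule exI[of _ j], rule exI[of _ "m + 1"]) (simp add: half algebra_simps)
    qed
  next
    case False
    then obtain j where j: "k = 2 * j + 1" by (elim oddE)
    have "p \<noteq> 0" using k False by auto
    then have "0 < p" using consecutiveD[OF pq] S(4) by force
    then obtain t where t: "consecutive S t p" using consecutive_pred[OF S(1), of p 0] pq S(2) by (auto simp: consecutive_def)
    then obtain k' m' :: int where k': "t = of_int k' * 2 powi m'" "p = of_int (k' + 1) * 2 powi m'"
      using S(5) unfolding std_partition_def std_interval_def by blast
    then have "m \<le> m'" using pow_le[OF t, of m'] by (simp add: algebra_simps)
    then have "m' = m" "k' + 1 = k" using std_interval_odd_exponent[of "k' + 1" m' k m] k(1) k'(2) False by auto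
    then have t': "t = of_int (k - 1) * 2 powi m" using k' by simp
    show ?thesis
    proof (rule that[OF t pq])
      show "p = (t + q) / 2" unfolding k t' by (simp add: algebra_simps)
      show "std_interval t q" unfolding std_interval_def k t' j
        by (rule exI[of _ j], rule exI[of _ "m + 1"]) (simp add: half algebra_simps)
    qed
  qed
qed

lemma consecutive_remove:
  assumes "consecutive S u m" "consecutive S m v"
  shows "consecutive (S - {m}) u v" "consecutive (S - {m}) p q \<Longrightarrow> consecutive S p q \<or> p = u \<and> q = v"
proof -
  have "s \<le> u \<or> v \<le> s" if "s \<in> S - {m}" for s
    using consecutive_between[OF assms(1), of s] consecutive_between[OF assms(2), of s] that by auto
  then show "consecutive (S - {m}) u v" using consecutiveD[OF assms(1)] consecutiveD[OF assms(2)]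
    by (simp add: consecutive_def)
  assume pq: "consecutive (S - {m}) p q"
  show "consecutive S p q \<or> p = u \<and> q = v"
  proof (cases "m \<in> {p<..<q}")
    case True
    have uv: "u \<in> S - {m}" "v \<in> S - {m}" "u < m" "m < v" using assms by (auto simp: consecutive_def)
    have pq': "p \<in> S" "q \<in> S" using pq by (auto simp: consecutive_def)
    show ?thesis
      using consecutive_between[OF pq uv(1)] consecutive_between[OF pq uv(2)] uv True
        consecutive_between[OF assms(1) pq'(1)] consecutive_between[OF assms(2) pq'(2)] by auto
  next
    case False
    then show ?thesis using pq by (auto simp: consecutive_def)
  qed
qed

lemma std_partition_remove:
  assumes "std_partition S" "consecutive S u m" "consecutive S m v" "std_interval u v"
  shows "std_partition (S - {m})"
  using assms consecutive_remove(2)[OF assms(2,3)] unfolding std_partition_def by blast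

text \<open>An extra subdivision point in the cell \<open>[u, v]\<close> is traded for one in its
  right neighbour \<open>[v, w]\<close>, while all other cells are fixed. The bound
  \<open>b < a + 1\<close> keeps them away from the integer translates of
  \<open>(u, w)\<close>.\<close>

lemma caret_shift_carries:
  assumes uvw: "consecutive S u v" "consecutive S v w" "caret_triple u v w" and X: "caret_shift u v w g"
    and S: "S \<subseteq> {a..b}" "b < a + 1"
  shows "carries g (insert ((u + v) / 2) S) (insert ((v + w) / 2) S)"
proof -
  note X = X[unfolded caret_shift_def]
  have g: "g \<in> supp_in u w" "maps_affinely g u ((u + v) / 2) u v" "maps_affinely g ((u + v) / 2) v v ((v + w) / 2)" "maps_affinely g v w ((v + w) / 2) w"
    using X by auto
  have in_S: "u \<in> S" "v \<in> S" "w \<in> S" "u < v" "v < w" using uvw by (auto simp: consecutive_def)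
  then have ab: "a \<le> u" "w \<le> b" using S by auto
  have fix_out: "g x = x" if "x \<in> {a..b}" "x \<le> u \<or> w \<le> x" for x
    using that supp_in_fix[OF g(1), of x] supp_in_fix[OF g(1), of "x + 1"] T_plus_one[of g x] g(1) S ab by force
  have out: "x \<le> u \<or> x = v \<or> w \<le> x" if "x \<in> S" for x
    using consecutive_between[OF uvw(1) that] consecutive_between[OF uvw(2) that] by linarith
  have gv: "g ((u + v) / 2) = v" "g v = (v + w) / 2" using maps_affinelyD[OF g(2)] maps_affinelyD[OF g(4)] by auto
  have im: "g x = x" if "x \<in> S - {v}" for x using that out[of x] fix_out[of x] S by blast
  have "g ` insert ((u + v) / 2) S = insert v (insert ((v + w) / 2) (g ` (S - {v})))"
    using gv in_S by (metis image_insert insert_Diff)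
  also have "g ` (S - {v}) = S - {v}" using im by simp
  also have "insert v (insert ((v + w) / 2) (S - {v})) = insert ((v + w) / 2) S" using in_S by auto
  finally have 1: "g ` insert ((u + v) / 2) S = insert ((v + w) / 2) S" .
  have "maps_affinely g p q (g p) (g q)" if pq: "consecutive (insert ((u + v) / 2) S) p q" for p q
  proof -
    have "p \<in> insert ((u + v) / 2) S" using pq by (simp add: consecutive_def)
    then consider "p = u" | "p = (u + v) / 2" | "p = v" | "p < u" | "w \<le> p"
      using out[of p] by (metis insert_iff order_le_less)
    then show ?thesis
    proof cases
      case 1
      then have q: "q = (u + v) / 2" using consecutive_unique consecutive_insert_mid(1)[OF uvw(1)] pq by blast
      show ?thesis unfolding 1 q maps_affinelyD[OF g(2)] by (rule g(2))
    next
      case 2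
      then have q: "q = v" using consecutive_unique consecutive_insert_mid(2)[OF uvw(1)] pq by blast
      show ?thesis unfolding 2 q maps_affinelyD[OF g(3)] by (rule g(3))
    next
      case 3
      have "consecutive (insert ((u + v) / 2) S) v w" using uvw by (auto simp: consecutive_def)
      then have q: "q = w" using consecutive_unique pq 3 by blast
      show ?thesis unfolding 3 q maps_affinelyD[OF g(4)] by (rule g(4))
    next
      case 4
      have "q \<le> u" using consecutive_between[OF pq, of u] 4 in_S by simp
      moreover have "p \<in> S" using pq 4 in_S by (auto simp: consecutive_def)
      then have "a \<le> p" using S by auto
      ultimately have "g x = x" if "x \<in> {p..q}" for x using fix_out[of x] that ab in_S by auto
      then show ?thesis using maps_affinely_id[of p q g] pq by (auto simp: consecutive_def)
    next
      case 5
      then have "p \<in> S" "q \<in> S" using pq in_S by (auto simp: consecutive_def)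
      then have "a \<le> p" "q \<le> b" using S by auto
      then have "g x = x" if "x \<in> {p..q}" for x using fix_out[of x] that ab in_S 5 by auto
      then show ?thesis using maps_affinely_id[of p q g] pq by (auto simp: consecutive_def)
    qed
  qed
  then show ?thesis using 1 by (simp add: carries_def)
qed

text \<open>Cancellation of a common caret in a tree pair. Since \<open>g\<close> preserves
  consecutiveness, \<open>g u = u'\<close> forces the midpoint and then \<open>v\<close> onto their
  counterparts, and the two affine halves merge.\<close>

lemma carries_remove_mid:
  assumes g: "g \<in> carrier T_tilde" "carries g (insert ((u + v) / 2) S) (insert ((u' + v') / 2) S')"
    and S: "consecutive S u v" "consecutive S' u' v'" "(u + v) / 2 \<notin> S" "(u' + v') / 2 \<notin> S'" and gu: "g u = u'"
  shows "carries g S S'"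
proof -
  let ?m = "(u + v) / 2" and ?m' = "(u' + v') / 2"
  have im: "g ` insert ?m S = insert ?m' S'" using g by (simp add: carries_def)
  have "consecutive (insert ?m' S') (g u) (g ?m)"
    using consecutive_image[OF g(1), of "insert ?m S" u ?m] im consecutive_insert_mid(1)[OF S(1)] by simp
  then have gm: "g ?m = ?m'" using consecutive_insert_mid(1)[OF S(2)] gu consecutive_unique by blast
  have "consecutive (insert ?m' S') (g ?m) (g v)"
    using consecutive_image[OF g(1), of "insert ?m S" ?m v] im consecutive_insert_mid(2)[OF S(1)] by simp
  then have gv: "g v = v'" using consecutive_insert_mid(2)[OF S(2)] gm consecutive_unique by metis
  have inj: "inj g" using T_eq_iff[OF g(1)] by (auto simp: inj_def)
  have "g ` S = g ` (insert ?m S - {?m})" using S(3) by simp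
  also have "\<dots> = insert ?m' S' - {?m'}" unfolding image_set_diff[OF inj] im by (simp only: image_insert image_empty gm)
  also have "\<dots> = S'" using S(4) by simp
  finally have "g ` S = S'" .
  moreover have "maps_affinely g p q (g p) (g q)" if pq: "consecutive S p q" for p q
  proof (cases "p = u")
    case True
    then have "q = v" using pq S(1) consecutive_unique by blast
    have "maps_affinely g u ?m u' ?m'" "maps_affinely g ?m v ?m' v'"
      using g(2) consecutive_insert_mid[OF S(1)] gu gm gv unfolding carries_def by metis+
    then show ?thesis using maps_affinely_join True \<open>q = v\<close> gu gv by blast
  next
    case False
    have "?m \<notin> {p<..<q}"
    proof
      assume "?m \<in> {p<..<q}"
      moreover have "u < ?m" "?m < v" using S(1) by (auto simp: consecutive_def)
      ultimately have "u < q" "p < v" by auto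
      then show False
        using consecutive_between[OF S(1), of p] consecutive_between[OF pq, of u] consecutiveD[OF pq] consecutiveD[OF S(1)] False
        by auto
    qed
    then have "?m \<le> p \<or> q \<le> ?m" by (simp only: greaterThanLessThan_iff) linarith
    then have "consecutive (insert ?m S) p q" using pq unfolding consecutive_def by blast
    then show ?thesis using g by (simp add: carries_def)
  qed
  ultimately show ?thesis by (simp add: carries_def)
qed

lemma dyadic_affine_on_maps_affinely: "dyadic_affine_on g u v \<Longrightarrow> u < v \<Longrightarrow> maps_affinely g u v (g u) (g v)"
proof -
  assume "dyadic_affine_on g u v" "u < v"
  then obtain m :: int and c where g: "\<And>x. x \<in> {u..v} \<Longrightarrow> g x = 2 powi m * x + c"
    unfolding dyadic_affine_on_def by blast
  show ?thesis unfolding maps_affinely_def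
  proof
    fix s :: real assume "s \<in> {0..1}"
    then have "g (u + s * (v - u)) = 2 powi m * (u + s * (v - u)) + c" using g param_interval[OF \<open>u < v\<close>] by blast
    also have "\<dots> = g u + s * (g v - g u)" using g[of u] g[of v] \<open>u < v\<close> by (simp add: algebra_simps)
    finally show "g (u + s * (v - u)) = g u + s * (g v - g u)" .
  qed
qed

text \<open>Existence of a tree pair: by \<open>pl_on_grid\<close> a fine uniform grid has a
  standard, in general not uniform, image.\<close>

lemma supp_in_grid:
  assumes g: "g \<in> supp_in 0 (1 / 2)"
  obtains S where "finite S" "0 \<in> S" "1 / 2 \<in> S" "S \<subseteq> {0..1 / 2}" "std_partition S" "std_partition (g ` S)" "carries g S (g ` S)"
proof -
  have gT: "g \<in> carrier T_tilde" using g by blast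
  have "pl_on g 0 (1 / 2)" by (rule T_tilde_pl_on[OF gT]) (auto intro: dyadic_half)
  then obtain n where n: "\<exists>k::int. 1 / 2 = (of_int k / 2 ^ n :: real)"
     "\<And>k::int. 0 \<le> (of_int k / 2 ^ n :: real) \<and> of_int (k + 1) / 2 ^ n \<le> (1 / 2 :: real) \<Longrightarrow>
       dyadic_affine_on g (of_int k / 2 ^ n) (of_int (k + 1) / 2 ^ n) \<and>
       std_interval (g (of_int k / 2 ^ n)) (g (of_int (k + 1) / 2 ^ n))"
    using eventually_happens'[OF _ pl_on_grid] by (metis (no_types, lifting) sequentially_bot)
  then obtain l :: int where l: "1 / 2 = (of_int l / 2 ^ n :: real)" by blast
  let ?f = "\<lambda>k::int. of_int k / 2 ^ n :: real"
  have le: "?f i \<le> ?f j \<longleftrightarrow> i \<le> j" for i j by (simp add: divide_le_cancel)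
  have lt: "?f i < ?f j \<longleftrightarrow> i < j" for i j by (simp add: divide_less_cancel)
  have "?f 0 < ?f l" unfolding l[symmetric] by simp
  then have l0: "0 < l" by (simp only: lt)
  let ?S = "?f ` {0..l}"
  have cons: "\<exists>k. u = ?f k \<and> v = ?f (k + 1) \<and> 0 \<le> u \<and> v \<le> 1 / 2" if "consecutive ?S u v" for u v
  proof -
    obtain i j where ij: "u = ?f i" "v = ?f j" "i \<in> {0..l}" "j \<in> {0..l}" "?f i < ?f j"
      using consecutiveD[OF \<open>consecutive ?S u v\<close>] by blast
    then have "i < j" by (simp only: lt)
    have "j = i + 1"
    proof (rule ccontr)
      assume "j \<noteq> i + 1"
      then have "i + 1 \<in> {0..l}" "i < i + 1" "i + 1 < j" using ij(3,4) \<open>i < j\<close> by auto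
      then have "?f (i + 1) \<in> ?S" "u < ?f (i + 1)" "?f (i + 1) < v" unfolding ij(1,2) lt by blast+
      then show False using consecutive_between[OF that] by fastforce
    qed
    moreover have "?f 0 \<le> u" "v \<le> ?f l" using ij unfolding ij(1,2) le by auto
    ultimately show ?thesis using ij l by auto
  qed
  show ?thesis
  proof
    show "finite ?S" by simp
    show "0 \<in> ?S" using l0 by (intro image_eqI[of _ _ 0]) auto
    show "1 / 2 \<in> ?S" using l l0 by (intro image_eqI[of _ _ l]) auto
    show "?S \<subseteq> {0..1 / 2}"
    proof
      fix x assume "x \<in> ?S"
      then obtain i where "x = ?f i" "0 \<le> i" "i \<le> l" by auto
      then have "?f 0 \<le> x" "x \<le> ?f l" by (simp_all only: le)
      then show "x \<in> {0..1 / 2}" unfolding l[symmetric] by simp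
    qed
    show "std_partition ?S" unfolding std_partition_def
    proof (intro allI impI)
      fix u v assume "consecutive ?S u v"
      then obtain k where "u = ?f k" "v = ?f (k + 1)" using cons by blast
      then show "std_interval u v" unfolding std_interval_def
        by - (rule exI[of _ k], rule exI[of _ "- int n"], simp add: power_int_minus field_simps)
    qed
    show "std_partition (g ` ?S)" unfolding std_partition_def
    proof (intro allI impI)
      fix u v assume uv: "consecutive (g ` ?S) u v"
      then obtain u' v' where u': "u = g u'" "v = g v'" by (auto simp: consecutive_def)
      then have "consecutive ?S u' v'" using uv consecutive_image[OF gT] by blast
      then obtain k where "u' = ?f k" "v' = ?f (k + 1)" "0 \<le> u'" "v' \<le> 1 / 2" using cons by blast
      then show "std_interval u v" using n(2)[of k] u' by simp
    qed
    show "carries g ?S (g ` ?S)" unfolding carries_def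
    proof (intro conjI refl allI impI)
      fix u v assume uv: "consecutive ?S u v"
      then obtain k where "u = ?f k" "v = ?f (k + 1)" "0 \<le> u" "v \<le> 1 / 2" using cons by blast
      then show "maps_affinely g u v (g u) (g v)" using n(2)[of k] uv dyadic_affine_on_maps_affinely[of g u v] by (auto simp: consecutive_def)
    qed
  qed
qed

section \<open>Generation by caret shifts\<close>

lemma dyadic_arc_half: "dyadic_arc 0 (1 / 2)"
  by (auto simp: dyadic_arc_def intro: dyadic_half)

text \<open>Conjugation ranges over the whole group, so any arc can be moved to
  \<open>[0, 1 / 2]\<close>, where the restricted closure rules apply.\<close>

locale arc_kernel =
  fixes K :: "(real \<Rightarrow> real) set"
  assumes subset: "K \<subseteq> carrier T_tilde"
    and conj: "g \<in> K \<Longrightarrow> t \<in> carrier T_tilde \<Longrightarrow> t \<circ> g \<circ> tinv t \<in> K"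
    and comp: "f \<in> K \<Longrightarrow> g \<in> K \<Longrightarrow> f \<in> supp_in 0 (1 / 2) \<Longrightarrow> g \<in> supp_in 0 (1 / 2) \<Longrightarrow> f \<circ> g \<in> K"
    and inv: "f \<in> K \<Longrightarrow> f \<in> supp_in 0 (1 / 2) \<Longrightarrow> tinv f \<in> K"
    and commutator: "f \<in> supp_in 0 (1 / 2) \<Longrightarrow> g \<in> supp_in 0 (1 / 2) \<Longrightarrow> f \<circ> g \<circ> tinv f \<circ> tinv g \<in> K"
begin

lemma id: "id \<in> K"
  using commutator[of id id] T.inv_one by simp

(* Modulo commutators the three generators in the pentagon relation agree, so x^2 = x^3. *)
lemma caret_shift_one: "\<exists>g\<in>K. caret_shift (1 / 8) (1 / 4) (3 / 8) g"
proof -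
  have dyadics: "(1/8 :: real) \<in> dyadic" "(1/4 :: real) \<in> dyadic" "(3/8 :: real) \<in> dyadic"
    "(3/16 :: real) \<in> dyadic" "(5/16 :: real) \<in> dyadic"
    using dyadic_scale[of 1 "-3"] dyadic_scale[of 1 "-2"] dyadic_scale[of 3 "-3"] dyadic_scale[of 3 "-4"]
      dyadic_scale[of 5 "-4"] by (simp_all add: power_int_minus)
  have eighth: "\<exists>k::int. (1 / 8 :: real) = 2 powi k" "\<exists>k::int. (1 / 16 :: real) = 2 powi k"
    by (rule exI[of _ "- 3"], simp add: power_int_minus) (rule exI[of _ "- 4"], simp add: power_int_minus)
  \<comment> \<open>\<open>[1 / 8, 3 / 8]\<close> leaves room inside \<open>[0, 1 / 2]\<close> on
    both sides, and its two halves carry the smaller carets of the pentagon.\<close>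
  have tr: "caret_triple (1/8) (1/4) (3/8)" "caret_triple (1/8) (3/16) (1/4)" "caret_triple (1/4) (5/16) (3/8)"
    unfolding caret_triple_def dyadic_arc_def using dyadics eighth by simp_all
  obtain f f0 f1 where f: "caret_shift (1/8) (1/4) (3/8) f" "caret_shift (1/8) (3/16) (1/4) f0"
    "caret_shift (1/4) (5/16) (3/8) f1" using tr caret_shift_ex by metis
  obtain t0 where t0: "t0 \<in> supp_in 0 (1 / 2)" "maps_affinely t0 (1/8) (1/4) (1/8) (3/16)" "maps_affinely t0 (1/4) (3/8) (3/16) (1/4)"
    using caret_triple_transitive_supp[OF tr(1) tr(2) dyadic_arc_half] by auto
  obtain t1 where t1: "t1 \<in> supp_in 0 (1 / 2)" "maps_affinely t1 (1/8) (1/4) (1/4) (5/16)" "maps_affinely t1 (1/4) (3/8) (5/16) (3/8)"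
    using caret_triple_transitive_supp[OF tr(1) tr(3) dyadic_arc_half] by auto
  have fs: "f \<in> supp_in 0 (1 / 2)"
    using f(1) supp_in_mono[OF _ _ _ dyadic_arc_half] by (auto simp: caret_shift_def)
  note T = supp_in_T[OF fs] supp_in_T[OF t0(1)] supp_in_T[OF t1(1)]
  have f0: "f0 = t0 \<circ> f \<circ> tinv t0"
    using caret_shift_unique[OF f(2) caret_shift_conj[OF f(1) T(2) t0(2,3)] tr(2)] .
  have f1: "f1 = t1 \<circ> f \<circ> tinv t1"
    using caret_shift_unique[OF f(3) caret_shift_conj[OF f(1) T(3) t1(2,3)] tr(3)] .
  define k0 where "k0 = t0 \<circ> f \<circ> tinv t0 \<circ> tinv f"
  define k1 where "k1 = t1 \<circ> f \<circ> tinv t1 \<circ> tinv f"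
  have k: "k0 \<in> K" "k1 \<in> K" unfolding k0_def k1_def using commutator t0(1) t1(1) fs by blast+
  have ks: "k0 \<in> supp_in 0 (1 / 2)" "k1 \<in> supp_in 0 (1 / 2)"
    unfolding k0_def k1_def by (intro supp_in_comp supp_in_inv fs t0 t1)+
  note kT = supp_in_T[OF ks(1)] supp_in_T[OF ks(2)]
  have f0k: "f0 = k0 \<circ> f" and f1k: "f1 = k1 \<circ> f" unfolding f0 f1 k0_def k1_def
    by (simp_all add: comp_assoc T)
  have "f \<circ> f = f1 \<circ> f \<circ> f0"
    using caret_shift_pentagon[OF tr(1) f(1), of f0 f1] f(2,3) by simp
  then have pent: "f \<circ> f = (k1 \<circ> f) \<circ> f \<circ> (k0 \<circ> f)" by (simp only: f0k f1k)
  \<comment> \<open>Cancelling \<open>f \<circ> f\<close> in the relation leaves \<open>f\<close> as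
    the product of \<open>tinv k0\<close> and a conjugate of \<open>tinv k1\<close>; the conjugator
    is the inverse square of \<open>f\<close>.\<close>
  define t where "t = tinv (f \<circ> f)"
  have tT: "t \<in> carrier T_tilde" "tinv t = f \<circ> f" unfolding t_def using T T.inv_inv[of "f \<circ> f"] by simp_all
  have ts: "t \<in> supp_in 0 (1 / 2)" unfolding t_def by (intro supp_in_comp supp_in_inv fs)
  have "f = tinv k0 \<circ> (t \<circ> tinv k1 \<circ> tinv t)"
  proof
    fix x
    have "f (f x) = k1 (f (f (k0 (f x))))" using fun_cong[OF pent, of x] by simp
    then have "tinv k1 (f (f x)) = f (f (k0 (f x)))" using kT(2) by simp
    moreover have "t (f (f y)) = y" for y using tinv_apply(1)[of "f \<circ> f" y] T unfolding t_def by simp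
    ultimately have "t (tinv k1 (f (f x))) = k0 (f x)" by simp
    then show "f x = (tinv k0 \<circ> (t \<circ> tinv k1 \<circ> tinv t)) x" using tT kT by simp
  qed
  moreover have "\<dots> \<in> K"
    by (intro comp conj inv k ks tT supp_in_comp supp_in_inv ts)
  ultimately show ?thesis using f(1) by auto
qed

text \<open>The whole group acts transitively on caret triples, so all caret shifts are conjugate to
  the one found, wherever their arcs lie.\<close>

lemma caret_shift_mem:
  assumes "caret_triple a m b" "caret_shift a m b g"
  shows "g \<in> K"
proof -
  obtain f where f: "f \<in> K" "caret_shift (1 / 8) (1 / 4) (3 / 8) f" using caret_shift_one by blast
  have "(1/8 :: real) \<in> dyadic" "(1/4 :: real) \<in> dyadic" "(3/8 :: real) \<in> dyadic"
    using dyadic_scale[of 1 "-3"] dyadic_scale[of 1 "-2"] dyadic_scale[of 3 "-3"] by (simp_all add: power_int_minus)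
  moreover have "\<exists>k::int. (1 / 8 :: real) = 2 powi k"
    by (rule exI[of _ "- 3"], simp add: power_int_minus)
  ultimately have "caret_triple (1 / 8) (1 / 4) (3 / 8)"
    by (simp add: caret_triple_def dyadic_arc_def)
  then obtain t where t: "t \<in> carrier T_tilde" "maps_affinely t (1 / 8) (1 / 4) a m" "maps_affinely t (1 / 4) (3 / 8) m b"
    using caret_triple_transitive assms(1) by blast
  have "g = t \<circ> f \<circ> tinv t"
    using caret_shift_unique[OF assms(2) caret_shift_conj[OF f(2) t] assms(1)] .
  then show ?thesis using conj[OF f(1) t(1)] by simp
qed

text \<open>A caret on the cell \<open>[u, v]\<close> slides to the first cell by one inverse caret
  shift per cell passed. Bringing both carets of a tree pair to the same place is what allows them
  to be cancelled.\<close>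

lemma move_caret:
  assumes S: "finite S" "0 \<in> S" "S \<subseteq> {0..1 / 2}" "std_partition S"
    and uv: "consecutive S u v" and w: "consecutive S 0 w"
  shows "\<exists>e \<in> supp_in 0 (1 / 2) \<inter> K. carries e (insert ((u + v) / 2) S) (insert ((0 + w) / 2) S)"
  using uv
proof (induction "card {s \<in> S. s < u}" arbitrary: u v rule: less_induct)
  case less
  show ?case
  proof (cases "u = 0")
    case True
    then have "v = w" using less.prems w consecutive_unique by blast
    have "carries id T T" for T by (auto simp: carries_def consecutive_def intro: maps_affinely_id)
    then show ?thesis using id True \<open>v = w\<close> by (intro bexI[of _ id]) auto
  next
    case False
    have u: "u \<in> S" "v \<in> S" "u < v" using consecutiveD[OF less.prems] by auto
    then have "0 < u" using False S(3) by force
    then obtain t where t: "consecutive S t u" using consecutive_pred[OF S(1) u(1) S(2)] by blast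
    have std: "std_interval t u" "std_interval u v" using t less.prems S(4) by (auto simp: std_partition_def)
    have tu: "0 \<le> t" "t < u" "v \<le> 1 / 2" using consecutiveD[OF t] u S(3) by auto
    have tr: "caret_triple t u v"
      using std_intervalD[OF std(1)] std_intervalD[OF std(2)] tu by (auto simp: caret_triple_def dyadic_arc_def)
    then obtain X where X: "caret_shift t u v X" using caret_shift_ex by blast
    have XK: "X \<in> K" by (rule caret_shift_mem[OF tr X])
    have Xs: "X \<in> supp_in 0 (1 / 2)"
      using X supp_in_mono[of X t v 0 "1 / 2"] dyadic_arc_half tu by (auto simp: caret_shift_def)
    have XT: "X \<in> carrier T_tilde" using Xs by blast
    have "carries X (insert ((t + u) / 2) S) (insert ((u + v) / 2) S)"
      by (rule caret_shift_carries[OF t less.prems tr X S(3)]) simp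
    then have Xinv: "carries (tinv X) (insert ((u + v) / 2) S) (insert ((t + u) / 2) S)"
      by (rule carries_inv[OF XT])
    have "{s \<in> S. s < t} \<subset> {s \<in> S. s < u}" using consecutiveD[OF t] by auto
    then have "card {s \<in> S. s < t} < card {s \<in> S. s < u}" using S(1) by (intro psubset_card_mono) auto
    then obtain e where e: "e \<in> supp_in 0 (1 / 2)" "e \<in> K" "carries e (insert ((t + u) / 2) S) (insert ((0 + w) / 2) S)"
      using less.hyps[OF _ t] by blast
    have "carries (e \<circ> tinv X) (insert ((u + v) / 2) S) (insert ((0 + w) / 2) S)"
      using carries_comp[OF _ Xinv e(3)] XT by simp
    moreover have "e \<circ> tinv X \<in> K" using e Xs XK by (intro comp inv supp_in_inv) auto
    moreover have "e \<circ> tinv X \<in> supp_in 0 (1 / 2)" using e Xs by (intro supp_in_comp supp_in_inv) auto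
    ultimately show ?thesis by blast
  qed
qed

text \<open>Induction on the size of the tree pair. Each of the two partitions has a sibling pair,
  that is, a removable caret, but possibly at different places. Elements of \<open>K\<close> slide
  both carets to the first cell; the corrected map \<open>h\<close> fixes 0, hence matches the first
  cells, and cancelling the caret leaves a pair with one cell less.\<close>

lemma carries_std_mem:
  assumes "finite S" "0 \<in> S" "1 / 2 \<in> S" "S \<subseteq> {0..1 / 2}" "std_partition S" "std_partition (g ` S)"
    "carries g S (g ` S)" "g \<in> supp_in 0 (1 / 2)"
  shows "g \<in> K"
  using assms
proof (induction "card S" arbitrary: S g rule: less_induct)
  case less
  note S = less.prems(1-5) and g = less.prems(6-8)
  have gT: "g \<in> carrier T_tilde" using g by blast
  have g0: "g 0 = 0" "g (1 / 2) = 1 / 2" using supp_in_fix_ends[OF g(3) dyadic_arc_half] by auto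
  show ?case
  proof (cases "card S > 2")
    case False
    have "{0, 1 / 2} = S"
    proof (rule card_subset_eq[OF S(1)])
      show "{0, 1 / 2} \<subseteq> S" using S by simp
      then have "card {0, 1 / 2 :: real} \<le> card S" using card_mono S(1) by blast
      then show "card {0, 1 / 2 :: real} = card S" using False by simp
    qed
    then have "consecutive S 0 (1 / 2)" by (auto simp: consecutive_def)
    then have "maps_affinely g 0 (1 / 2) 0 (1 / 2)" using g(2) g0 unfolding carries_def by metis
    then have "g = id"
      using supp_in_eqI[OF g(3) supp_in_id] maps_affinely_unique[OF _ maps_affinely_id[of 0 "1 / 2" "\<lambda>x. x"], of g] by simp
    then show ?thesis using id by simp
  next
    case True
    have inj: "inj g" using T_eq_iff[OF gT] by (auto simp: inj_def)
    let ?T = "g ` S"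
    have T: "finite ?T" "0 \<in> ?T" "1 / 2 \<in> ?T" "?T \<subseteq> {0..1 / 2}" "card ?T > 2"
      using S g0 supp_in_maps[OF g(3) dyadic_arc_half] True card_image[of g S] inj_on_subset[OF inj]
      by (auto intro: rev_image_eqI)
    obtain u m v where u: "consecutive S u m" "consecutive S m v" "m = (u + v) / 2" "std_interval u v"
      using std_partition_sibling[OF S True] by blast
    obtain u' m' v' where u': "consecutive ?T u' m'" "consecutive ?T m' v'" "m' = (u' + v') / 2" "std_interval u' v'"
      using std_partition_sibling[OF T(1-4) g(1) T(5)] by blast
    define S0 where "S0 = S - {m}"
    define T0 where "T0 = ?T - {m'}"
    have SS: "S = insert ((u + v) / 2) S0" "?T = insert ((u' + v') / 2) T0"
      using u u' by (auto simp: S0_def T0_def consecutive_def)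
    have cons: "consecutive S0 u v" "consecutive T0 u' v'"
      unfolding S0_def T0_def using consecutive_remove(1) u u' by blast+
    have "m \<noteq> 0" "m \<noteq> 1 / 2" "m' \<noteq> 0" "m' \<noteq> 1 / 2"
      using consecutiveD[OF u(1)] consecutiveD[OF u(2)] consecutiveD[OF u'(1)] consecutiveD[OF u'(2)]
        subsetD[OF S(4), of u] subsetD[OF S(4), of v] subsetD[OF T(4), of u'] subsetD[OF T(4), of v'] by auto
    then have S0: "finite S0" "0 \<in> S0" "1 / 2 \<in> S0" "S0 \<subseteq> {0..1 / 2}" "std_partition S0"
      and T0: "finite T0" "0 \<in> T0" "1 / 2 \<in> T0" "T0 \<subseteq> {0..1 / 2}" "std_partition T0"
      using S T std_partition_remove[OF S(5) u(1,2,4)] std_partition_remove[OF g(1) u'(1,2,4)]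
      unfolding S0_def T0_def by (simp_all, blast+)
    obtain w where w: "consecutive S0 0 w" using consecutive_succ[OF S0(1-3)] by auto
    obtain w' where w': "consecutive T0 0 w'" using consecutive_succ[OF T0(1-3)] by auto
    obtain e where e: "e \<in> supp_in 0 (1 / 2)" "e \<in> K" "carries e S (insert ((0 + w) / 2) S0)"
      using move_caret[OF S0(1,2,4,5) cons(1) w] SS by auto
    obtain f where f: "f \<in> supp_in 0 (1 / 2)" "f \<in> K" "carries f ?T (insert ((0 + w') / 2) T0)"
      using move_caret[OF T0(1,2,4,5) cons(2) w'] SS by auto
    have eT: "e \<in> carrier T_tilde" "f \<in> carrier T_tilde" using e f by auto
    define h where "h = f \<circ> g \<circ> tinv e"
    have hs: "h \<in> supp_in 0 (1 / 2)" unfolding h_def using e f g by (intro supp_in_comp supp_in_inv)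
    have "carries (f \<circ> (g \<circ> tinv e)) (insert ((0 + w) / 2) S0) (insert ((0 + w') / 2) T0)"
      using carries_comp[OF _ carries_comp[OF _ carries_inv[OF eT(1) e(3)] g(2)] f(3)] eT gT by simp
    then have h: "carries h (insert ((0 + w) / 2) S0) (insert ((0 + w') / 2) T0)"
      by (simp add: h_def comp_assoc)
    have mid: "(0 + w) / 2 \<notin> S0" "(0 + w') / 2 \<notin> T0"
      using consecutive_between[OF w, of "(0 + w) / 2"] consecutive_between[OF w', of "(0 + w') / 2"]
        consecutiveD[OF w] consecutiveD[OF w'] by auto
    have "h 0 = 0" using supp_in_fix_ends[OF hs dyadic_arc_half] by simp
    then have h0: "carries h S0 T0"
      using carries_remove_mid[OF _ h w w' mid] hs by blast
    then have "h ` S0 = T0" by (simp add: carries_def)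
    moreover have "card S0 < card S" unfolding S0_def using S(1) u consecutiveD[OF u(1)] by (intro card_Diff1_less) simp_all
    ultimately have "h \<in> K" using less.hyps[of S0 h] S0 T0(5) h0 hs by simp
    have "g = tinv f \<circ> (h \<circ> e)" unfolding h_def using eT by (auto simp: fun_eq_iff)
    then show ?thesis using comp[OF inv[OF f(2,1)] comp[OF \<open>h \<in> K\<close> e(2) hs e(1)]] supp_in_inv[OF f(1)] supp_in_comp[OF hs e(1)]
      by simp
  qed
qed

lemma supp_in_subset:
  assumes "dyadic_arc a b"
  shows "supp_in a b \<subseteq> K"
proof
  fix g assume g: "g \<in> supp_in a b"
  obtain t where t: "t \<in> carrier T_tilde" "t a = 0" "t b = 1 / 2"
    using dyadic_arc_transitive[OF assms dyadic_arc_half] .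
  have h: "t \<circ> g \<circ> tinv t \<in> supp_in 0 (1 / 2)" (is "?h \<in> _") using supp_in_conj[OF g t(1)] t by simp
  obtain S where "finite S" "0 \<in> S" "1 / 2 \<in> S" "S \<subseteq> {0..1 / 2}" "std_partition S" "std_partition (?h ` S)" "carries ?h S (?h ` S)"
    using supp_in_grid[OF h] .
  then have "?h \<in> K" using carries_std_mem h by blast
  then have "tinv t \<circ> ?h \<circ> tinv (tinv t) \<in> K" by (rule conj) (use t in simp)
  also have "tinv t \<circ> ?h \<circ> tinv (tinv t) = g" using t T.inv_inv[of t] by (auto simp: fun_eq_iff)
  finally show "g \<in> K" .
qed

end

section \<open>Fragmentation into elements supported in arcs\<close>

lemma half_transitive:
  assumes z: "z \<in> dyadic" "0 < z" "z < 1"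
  obtains a b f where "dyadic_arc a b" "f \<in> supp_in a b" "f (1 / 2) = z" "f 0 = 0"
proof -
  have half: "(1/2::real) \<in> dyadic" "(1/4::real) \<in> dyadic" "(3/4::real) \<in> dyadic"
    using dyadic_half[of 1] dyadic_half[of "1/2"] dyadic_scale[of 3 "-2"] by (simp_all add: power_int_minus)
  obtain a b f where f: "dyadic_arc a b" "f \<in> supp_in a b" "f (1 / 2) = z" "0 \<le> a" "b \<le> 1"
  \<comment> \<open>An arc has length below 1, so no single one reaches every \<open>z\<close> in
    \<open>(0, 1)\<close>. The two arcs used here overlap, contain \<open>1 / 2\<close> and avoid 0
    in their interiors.\<close>
  proof (cases "z < 3 / 4")
    case True
    have "dyadic_arc 0 (3 / 4)" using half by (simp add: dyadic_arc_def)
    moreover obtain f where "f \<in> supp_in 0 (3 / 4)" "f (1 / 2) = z"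
      by (rule supp_in_transitive[OF \<open>dyadic_arc 0 (3 / 4)\<close> half(1) z(1)]) (use z True in auto)
    ultimately show ?thesis using that by simp
  next
    case False
    have "dyadic_arc (1 / 4) 1" using half by (simp add: dyadic_arc_def)
    moreover obtain f where "f \<in> supp_in (1 / 4) 1" "f (1 / 2) = z"
      by (rule supp_in_transitive[OF \<open>dyadic_arc (1 / 4) 1\<close> half(1) z(1)]) (use z False in auto)
    ultimately show ?thesis using that by simp
  qed
  have "f 1 = 1" using supp_in_fix[OF f(2), of 1] f by auto
  then have "f 0 = 0" using T_plus_one[of f 0] f(2) by auto
  then show ?thesis using that f by blast
qed

text \<open>The stabilizer of 0 contains elements supported in no proper arc. Once \<open>f\<close>
  has corrected the value at \<open>1 / 2\<close>, the remainder fixes 0 and \<open>1 / 2\<close>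
  and restricts to the two half circles separately.\<close>

lemma stabilizer_fragmentation:
  assumes g: "g \<in> carrier T_tilde" "g 0 = 0"
  obtains a b f f1 f2 where "dyadic_arc a b" "f \<in> supp_in a b" "f1 \<in> supp_in 0 (1 / 2)" "f2 \<in> supp_in (1 / 2) 1"
    "g = f \<circ> (f1 \<circ> f2)"
proof -
  have half: "(1/2::real) \<in> dyadic" using dyadic_half[of 1] by simp
  have z: "g (1 / 2) \<in> dyadic" "0 < g (1 / 2)" "g (1 / 2) < 1"
    using T_dyadic[OF g(1) half] T_less_iff[OF g(1), of 0 "1 / 2"] T_less_iff[OF g(1), of "1 / 2" 1]
      T_plus_one[OF g(1), of 0] g(2) by auto
  obtain a b f where f: "dyadic_arc a b" "f \<in> supp_in a b" "f (1 / 2) = g (1 / 2)" and f0: "f 0 = 0"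
    using half_transitive[OF z] by metis
  have fT: "f \<in> carrier T_tilde" using f by blast
  define h where "h = tinv f \<circ> g"
  have hT: "h \<in> carrier T_tilde" unfolding h_def using fT g by simp
  have "tinv f (f 0) = 0" "tinv f (f (1 / 2)) = 1 / 2" using fT by simp_all
  then have h: "h 0 = 0" "h (1 / 2) = 1 / 2" unfolding h_def using f f0 g by simp_all
  then have h1: "h 1 = 1" using T_plus_one[OF hT, of 0] by simp
  obtain f1 where f1: "f1 \<in> supp_in 0 (1 / 2)" "\<And>x. x \<in> {0..1 / 2} \<Longrightarrow> f1 x = h x"
    using supp_in_extend[OF T_tilde_pl_on[OF hT, of 0 "1 / 2"] h dyadic_arc_half] half by auto
  have "dyadic_arc (1 / 2) 1" using half by (simp add: dyadic_arc_def)
  then obtain f2 where f2: "f2 \<in> supp_in (1 / 2) 1" "\<And>x. x \<in> {1 / 2..1} \<Longrightarrow> f2 x = h x"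
    using supp_in_extend[OF T_tilde_pl_on[OF hT, of "1 / 2" 1] h(2) h1] half by auto
  have "h = f1 \<circ> f2"
  proof (rule T_tilde_eqI[where a = 0])
    show "h \<in> carrier T_tilde" by fact
    show "f1 \<circ> f2 \<in> carrier T_tilde" using f1 f2 by (intro T_comp) auto
    fix x :: real assume x: "x \<in> {0..0 + 1}"
    show "h x = (f1 \<circ> f2) x"
    proof (cases "x \<le> 1 / 2")
      case True
      then have "f2 (x + 1) = x + 1" using supp_in_fix[OF f2(1), of "x + 1"] x by simp
      then have "f2 x = x" using T_plus_one[of f2 x] f2(1) by auto
      then show ?thesis using f1(2) x True by simp
    next
      case False
      then have "f2 x = h x" using f2(2) x by simp
      moreover have "1 / 2 \<le> h x" "h x \<le> 1"
        using T_le_iff[OF hT, of "1 / 2" x] T_le_iff[OF hT, of x 1] h h1 x False by auto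
      then have "f1 (h x) = h x" using supp_in_fix[OF f1(1), of "h x"] by simp
      ultimately show ?thesis by simp
    qed
  qed
  moreover have "g = f \<circ> h" using fT by (simp add: h_def fun_eq_iff)
  ultimately have "g = f \<circ> (f1 \<circ> f2)" by simp
  then show ?thesis using that f f1 f2 by blast
qed

text \<open>\<open>g 0\<close> is dyadic, so a translation moves \<open>g\<close> into the
  stabilizer of 0, where its three arc factors lie in \<open>K\<close>.\<close>

lemma normal_subgroup_eq_T_tilde:
  assumes K: "K \<subseteq> carrier T_tilde"
    and conj: "\<And>g t. g \<in> K \<Longrightarrow> t \<in> carrier T_tilde \<Longrightarrow> t \<circ> g \<circ> tinv t \<in> K"
    and comp: "\<And>f g. f \<in> K \<Longrightarrow> g \<in> K \<Longrightarrow> f \<circ> g \<in> K"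
    and inv: "\<And>f. f \<in> K \<Longrightarrow> tinv f \<in> K"
    and commutator: "\<And>f g. f \<in> supp_in 0 (1 / 2) \<Longrightarrow> g \<in> supp_in 0 (1 / 2) \<Longrightarrow> f \<circ> g \<circ> tinv f \<circ> tinv g \<in> K"
    and translation: "\<And>z. z \<in> dyadic \<Longrightarrow> translation z \<in> K"
  shows "K = carrier T_tilde"
proof
  show "carrier T_tilde \<subseteq> K"
  proof
    interpret arc_kernel K by standard (use assms in auto)
    fix g assume g: "g \<in> carrier T_tilde"
    define h where "h = translation (- g 0) \<circ> g"
    have d: "g 0 \<in> dyadic" using T_dyadic[OF g] by simp
    have "h \<in> carrier T_tilde" "h 0 = 0"
      unfolding h_def using g translation_T[OF dyadic_minus[OF d]] by (simp_all add: translation_def)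
    then obtain a b f f1 f2 where f: "dyadic_arc a b" "f \<in> supp_in a b" "f1 \<in> supp_in 0 (1 / 2)" "f2 \<in> supp_in (1 / 2) 1"
      "h = f \<circ> (f1 \<circ> f2)" using stabilizer_fragmentation by metis
    have "dyadic_arc (1 / 2) 1" using dyadic_half[of 1] by (simp add: dyadic_arc_def)
    then have "f \<in> K" "f1 \<in> K" "f2 \<in> K"
      using subsetD[OF supp_in_subset f(2)] subsetD[OF supp_in_subset f(3)] subsetD[OF supp_in_subset f(4)]
        f(1) dyadic_arc_half by blast+
    then have "h \<in> K" unfolding f(5) by (intro assms(3))
    then have "translation (g 0) \<circ> h \<in> K" using assms(3) translation d by blast
    moreover have "translation (g 0) \<circ> h = g" by (auto simp: h_def translation_def)
    ultimately show "g \<in> K" by simp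
  qed
qed (rule K)

section \<open>Homogeneous quasimorphisms\<close>

locale quasimorphism = group G for G (structure) +
  fixes N :: "'a \<Rightarrow> real" and D :: real
  assumes quasi: "x \<in> carrier G \<Longrightarrow> y \<in> carrier G \<Longrightarrow> \<bar>N (x \<otimes> y) - N x - N y\<bar> \<le> D"
begin

definition homogenization :: "'a \<Rightarrow> real" where
  "homogenization x = lim (\<lambda>n. N (x [^] n) / real n)"

lemma quasi_pow: "x \<in> carrier G \<Longrightarrow> \<bar>N (x [^] Suc n) - real (Suc n) * N x\<bar> \<le> real n * D"
proof (induction n)
  case (Suc n)
  then have "\<bar>N (x [^] Suc n) - real (Suc n) * N x\<bar> \<le> real n * D"
    "\<bar>N (x [^] Suc n \<otimes> x) - N (x [^] Suc n) - N x\<bar> \<le> D" using quasi[of "x [^] Suc n" x] by simp_all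
  moreover have "x [^] Suc (Suc n) = x [^] Suc n \<otimes> x" by simp
  ultimately show ?case by (simp only:) (simp add: algebra_simps)
qed simp

lemma D_nonneg: "0 \<le> D"
  by (rule order_trans[OF abs_ge_zero quasi[OF one_closed one_closed]])

lemma quasi_pow': "x \<in> carrier G \<Longrightarrow> n > 0 \<Longrightarrow> \<bar>N (x [^] n) - real n * N x\<bar> \<le> real n * D"
  using quasi_pow[of x "n - 1"] D_nonneg mult_right_mono[of "real (n - 1)" "real n" D] by simp

text \<open>Both quotients are compared with \<open>N (x [^] (n * m)) / (n * m)\<close>.\<close>

lemma homogenization_Cauchy:
  assumes "x \<in> carrier G" "n > 0" "m > 0"
  shows "\<bar>N (x [^] n) / real n - N (x [^] m) / real m\<bar> \<le> D / real n + D / real m"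
proof -
  have "\<bar>N (x [^] (n * m)) - real m * N (x [^] n)\<bar> \<le> real m * D"
    using quasi_pow'[of "x [^] n" m] assms by (simp add: nat_pow_pow)
  moreover have "\<bar>N (x [^] (n * m)) - real n * N (x [^] m)\<bar> \<le> real n * D"
    using quasi_pow'[of "x [^] m" n] assms by (simp add: nat_pow_pow mult.commute)
  ultimately have "\<bar>real m * N (x [^] n) - real n * N (x [^] m)\<bar> \<le> (real m + real n) * D"
    by (simp add: algebra_simps)
  moreover have "N (x [^] n) / real n - N (x [^] m) / real m = (real m * N (x [^] n) - real n * N (x [^] m)) / (real n * real m)"
    using assms by (simp add: field_simps)
  moreover have "D / real n + D / real m = (real m + real n) * D / (real n * real m)"
    using assms by (simp add: field_simps)
  ultimately show ?thesis using assms by (simp add: divide_right_mono abs_mult)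
qed

lemma homogenization_tendsto:
  assumes x: "x \<in> carrier G"
  shows "(\<lambda>n. N (x [^] n) / real n) \<longlonglongrightarrow> homogenization x"
proof -
  have "Cauchy (\<lambda>n. N (x [^] n) / real n)"
  proof (rule metric_CauchyI)
    fix e :: real assume e: "0 < e"
    obtain M :: nat where M: "2 * D / e < real M" using reals_Archimedean2 by blast
    have small: "D / real n < e / 2" if "n \<ge> Suc M" for n
    proof -
      have "2 * D / e < real n" using M that by linarith
      then show ?thesis using e that by (simp add: field_simps)
    qed
    show "\<exists>M. \<forall>m\<ge>M. \<forall>n\<ge>M. dist (N (x [^] m) / real m) (N (x [^] n) / real n) < e"
    proof (intro exI[of _ "Suc M"] allI impI)
      fix m n assume mn: "m \<ge> Suc M" "n \<ge> Suc M"
      show "dist (N (x [^] m) / real m) (N (x [^] n) / real n) < e"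
        using homogenization_Cauchy[OF x, of m n] small[OF mn(1)] small[OF mn(2)] mn
        unfolding dist_real_def by linarith
    qed
  qed
  then show ?thesis unfolding homogenization_def
    by (simp add: Cauchy_convergent_iff convergent_LIMSEQ_iff)
qed

lemma limit_eq_if_bounded_diff:
  assumes "(\<lambda>n. f n / real n) \<longlonglongrightarrow> a" "(\<lambda>n. g n / real n) \<longlonglongrightarrow> b" "\<And>n. \<bar>f n - g n\<bar> \<le> C"
  shows "a = (b::real)"
proof -
  have "(\<lambda>n. f n / real n - g n / real n) \<longlonglongrightarrow> a - b" using assms by (intro tendsto_diff)
  moreover have "(\<lambda>n. f n / real n - g n / real n) \<longlonglongrightarrow> 0"
  proof (rule Lim_null_comparison)
    show "\<forall>\<^sub>F n in sequentially. norm (f n / real n - g n / real n) \<le> C / real n"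
      using assms(3) by (intro always_eventually allI) (simp add: diff_divide_distrib[symmetric] divide_right_mono)
    show "(\<lambda>n. C / real n) \<longlonglongrightarrow> 0" by (rule lim_const_over_n)
  qed
  ultimately show ?thesis using LIMSEQ_unique by fastforce
qed

lemma homogenization_near: "x \<in> carrier G \<Longrightarrow> \<bar>N x - homogenization x\<bar> \<le> D"
proof -
  assume x: "x \<in> carrier G"
  have "(\<lambda>n. \<bar>N x - N (x [^] n) / real n\<bar>) \<longlonglongrightarrow> \<bar>N x - homogenization x\<bar>"
    by (intro tendsto_intros homogenization_tendsto x)
  moreover have "\<bar>N x - N (x [^] n) / real n\<bar> \<le> D" if "n \<ge> 1" for n
  proof -
    have "N x - N (x [^] n) / real n = - (N (x [^] n) - real n * N x) / real n" using that by (simp add: field_simps)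
    then have "\<bar>N x - N (x [^] n) / real n\<bar> = \<bar>N (x [^] n) - real n * N x\<bar> / real n" by (simp add: abs_minus_commute)
    also have "\<dots> \<le> real n * D / real n" using quasi_pow'[OF x, of n] that by (intro divide_right_mono) auto
    finally show ?thesis using that by simp
  qed
  ultimately show ?thesis using LIMSEQ_le_const2 by blast
qed

text \<open>One \<open>D\<close> comes from \<open>quasi\<close>, and one from each of the three
  values replaced by means of \<open>homogenization_near\<close>.\<close>

lemma homogenization_quasi:
  assumes "x \<in> carrier G" "y \<in> carrier G"
  shows "\<bar>homogenization (x \<otimes> y) - homogenization x - homogenization y\<bar> \<le> 4 * D"
  using quasi[OF assms] homogenization_near[OF assms(1)] homogenization_near[OF assms(2)]
    homogenization_near[of "x \<otimes> y"] assms by simp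

text \<open>The powers of the conjugate are \<open>t \<otimes> x [^] n \<otimes> inv t\<close>; the
  outer factors contribute a bounded amount, which disappears after division by
  \<open>n\<close>.\<close>

lemma homogenization_conj:
  assumes x: "x \<in> carrier G" and t: "t \<in> carrier G"
  shows "homogenization (t \<otimes> x \<otimes> inv t) = homogenization x"
proof (rule limit_eq_if_bounded_diff)
  show "(\<lambda>n. N ((t \<otimes> x \<otimes> inv t) [^] n) / real n) \<longlonglongrightarrow> homogenization (t \<otimes> x \<otimes> inv t)"
    "(\<lambda>n. N (x [^] n) / real n) \<longlonglongrightarrow> homogenization x" using assms homogenization_tendsto by simp_all
  fix n :: nat
  have "(t \<otimes> x \<otimes> inv t) [^] n = t \<otimes> x [^] n \<otimes> inv t"
  proof (induction n)
    case (Suc n)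
    have "(t \<otimes> x \<otimes> inv t) [^] Suc n = t \<otimes> x [^] n \<otimes> inv t \<otimes> (t \<otimes> x \<otimes> inv t)" using Suc by simp
    also have "\<dots> = t \<otimes> x [^] n \<otimes> (inv t \<otimes> t) \<otimes> x \<otimes> inv t" using assms by (simp only: m_assoc m_closed inv_closed nat_pow_closed)
    finally show ?case using assms by (simp add: m_assoc)
  qed (use t in simp)
  moreover have "\<bar>N (t \<otimes> x [^] n \<otimes> inv t) - N (t \<otimes> x [^] n) - N (inv t)\<bar> \<le> D"
    "\<bar>N (t \<otimes> x [^] n) - N t - N (x [^] n)\<bar> \<le> D" using assms by (auto intro!: quasi)
  ultimately show "\<bar>N ((t \<otimes> x \<otimes> inv t) [^] n) - N (x [^] n)\<bar> \<le> \<bar>N t\<bar> + \<bar>N (inv t)\<bar> + 2 * D" by simp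
qed

lemma homogenization_commuting:
  assumes "x \<in> carrier G" "y \<in> carrier G" "x \<otimes> y = y \<otimes> x"
  shows "homogenization (x \<otimes> y) = homogenization x + homogenization y"
proof (rule limit_eq_if_bounded_diff)
  show "(\<lambda>n. N ((x \<otimes> y) [^] n) / real n) \<longlonglongrightarrow> homogenization (x \<otimes> y)"
    using assms homogenization_tendsto by simp
  show "(\<lambda>n. (N (x [^] n) + N (y [^] n)) / real n) \<longlonglongrightarrow> homogenization x + homogenization y"
    unfolding add_divide_distrib by (intro tendsto_add homogenization_tendsto assms)
  show "\<bar>N ((x \<otimes> y) [^] n) - (N (x [^] n) + N (y [^] n))\<bar> \<le> D" for n :: nat
    using quasi[of "x [^] n" "y [^] n"] assms(1,2) pow_mult_distrib[OF assms(3,1,2)] by (simp add: algebra_simps)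
qed

lemma homogenization_one: "homogenization \<one> = 0"
  using homogenization_commuting[of \<one> \<one>] by simp

lemma homogenization_inv: "x \<in> carrier G \<Longrightarrow> homogenization (inv x) = - homogenization x"
  using homogenization_commuting[of x "inv x"] homogenization_one by simp

(* A product of n commuting conjugates of x has value n q(x), whereas the defect of additivity stays
   bounded independently of n. *)
lemma homogenization_additive_if_displaced:
  assumes t: "\<And>i::nat. t i \<in> carrier G" and H: "H \<subseteq> carrier G" "x \<in> H" "y \<in> H" "x \<otimes> y \<in> H"
    and comm: "\<And>i j u v. i \<noteq> j \<Longrightarrow> u \<in> H \<Longrightarrow> v \<in> H \<Longrightarrow>
      (t i \<otimes> u \<otimes> inv t i) \<otimes> (t j \<otimes> v \<otimes> inv t j) = (t j \<otimes> v \<otimes> inv t j) \<otimes> (t i \<otimes> u \<otimes> inv t i)"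
  shows "homogenization (x \<otimes> y) = homogenization x + homogenization y"
proof -
  define c where "c i u = t i \<otimes> u \<otimes> inv t i" for i u
  define P where "P u n = rec_nat \<one> (\<lambda>i r. r \<otimes> c i u) n" for u n
  have P: "P u 0 = \<one>" "P u (Suc n) = P u n \<otimes> c n u" for u n by (simp_all add: P_def)
  have c_cl: "c i u \<in> carrier G" if "u \<in> H" for i u using that t H by (auto simp: c_def)
  have P_cl: "P u n \<in> carrier G" if "u \<in> H" for u n by (induction n) (use that c_cl P in auto)
  \<comment> \<open>Only conjugates with different indices have to commute: \<open>P u n\<close>
    uses the indices below \<open>n\<close>, and \<open>j\<close> is at least
    \<open>n\<close>.\<close>
  have cP: "c j v \<otimes> P u n = P u n \<otimes> c j v" if "u \<in> H" "v \<in> H" "n \<le> j" for u v n j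
    using \<open>n \<le> j\<close>
  proof (induction n)
    case 0
    then show ?case using c_cl that by (simp add: P)
  next
    case (Suc n)
    have "c j v \<otimes> P u (Suc n) = (c j v \<otimes> P u n) \<otimes> c n u" using P c_cl P_cl that by (simp add: m_assoc)
    also have "\<dots> = P u n \<otimes> (c j v \<otimes> c n u)" using Suc c_cl P_cl that by (simp add: m_assoc)
    also have "c j v \<otimes> c n u = c n u \<otimes> c j v" unfolding c_def using Suc that by (intro comm) auto
    finally show ?case using P c_cl P_cl that by (simp add: m_assoc)
  qed
  have qP: "homogenization (P u n) = real n * homogenization u" if u: "u \<in> H" for u n
  proof (induction n)
    case 0
    then show ?case by (simp add: P homogenization_one)
  next
    case (Suc n)
    have "homogenization (P u (Suc n)) = homogenization (P u n) + homogenization (c n u)"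
      unfolding P using P_cl c_cl cP[OF u u order_refl, symmetric] u by (intro homogenization_commuting) auto
    also have "homogenization (c n u) = homogenization u" unfolding c_def using u H t by (intro homogenization_conj) auto
    finally show ?case using Suc by (simp add: algebra_simps)
  qed
  have Pxy: "P (x \<otimes> y) n = P x n \<otimes> P y n" for n
  proof (induction n)
    case (Suc n)
    have xy: "x \<in> carrier G" "y \<in> carrier G" using H by auto
    have "c n x \<otimes> c n y = t n \<otimes> x \<otimes> (inv t n \<otimes> t n) \<otimes> y \<otimes> inv t n"
      unfolding c_def using xy t by (simp only: m_assoc m_closed inv_closed)
    then have cxy: "c n (x \<otimes> y) = c n x \<otimes> c n y" unfolding c_def using xy t by (simp add: m_assoc)
    have "P (x \<otimes> y) (Suc n) = P x n \<otimes> (P y n \<otimes> c n x) \<otimes> c n y"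
      using Suc P cxy P_cl c_cl H by (simp add: m_assoc)
    also have "P y n \<otimes> c n x = c n x \<otimes> P y n" using cP H by simp
    finally show ?case using P P_cl c_cl H by (simp add: m_assoc)
  qed (simp add: P)
  define d where "d = homogenization (x \<otimes> y) - homogenization x - homogenization y"
  have bound: "real n * \<bar>d\<bar> \<le> 4 * D" for n
  proof -
    have "\<bar>homogenization (P x n \<otimes> P y n) - homogenization (P x n) - homogenization (P y n)\<bar> \<le> 4 * D"
      using P_cl H by (intro homogenization_quasi) auto
    then have "\<bar>real n * d\<bar> \<le> 4 * D" using qP H unfolding Pxy[symmetric] d_def by (simp add: algebra_simps)
    then show ?thesis by (simp add: abs_mult)
  qed
  have "d = 0"
  proof (rule ccontr)
    assume "d \<noteq> 0"
    then obtain n :: nat where "4 * D / \<bar>d\<bar> < real n" using reals_Archimedean2 by blast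
    then show False using bound[of n] \<open>d \<noteq> 0\<close> by (simp add: field_simps)
  qed
  then show ?thesis by (simp add: d_def)
qed

end

text \<open>The homogenization vanishes on the elements of every arc. An element of the stabilizer
  of 0 is a product of three such elements, and quasi-additivity bounds its value by a fixed
  multiple of the defect.\<close>

lemma quasimorphism_bounded_on_stabilizer:
  assumes "quasimorphism T_tilde N D"
  obtains C where "\<And>g. g \<in> carrier T_tilde \<Longrightarrow> g 0 = 0 \<Longrightarrow> \<bar>N g\<bar> \<le> C"
proof -
  interpret q: quasimorphism T_tilde N D by fact
  let ?H = "supp_in 0 (1 / 2)" and ?q = q.homogenization
  \<comment> \<open>These arcs have disjoint interiors and shrink to 0; they supply infinitely many
    commuting copies of the arc group within one period.\<close>
  have arc: "dyadic_arc (1 / 2 ^ (i + 2)) (1 / 2 ^ (i + 1))" for i :: nat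
  proof -
    have "(1::real) / 2 ^ n \<in> dyadic" for n :: nat
      unfolding dyadic_iff by (rule exI[of _ 1], rule exI[of _ n]) simp
    moreover have "(1::real) / 2 ^ (i + 1) \<le> 1" using one_le_power[of "2::real" "i + 1"] by simp
    then have "(1::real) / 2 ^ (i + 1) < 1 / 2 ^ (i + 2) + 1" by (intro add_strict_increasing) auto
    moreover have "(1::real) / 2 ^ (i + 2) < 1 / 2 ^ (i + 1)" by (simp add: field_simps)
    ultimately show ?thesis unfolding dyadic_arc_def by blast
  qed
  have "\<exists>t\<in>carrier T_tilde. t 0 = 1 / 2 ^ (i + 2) \<and> t (1 / 2) = 1 / 2 ^ (i + 1)" for i :: nat
    using dyadic_arc_transitive[OF dyadic_arc_half arc[of i]] by metis
  then obtain t :: "nat \<Rightarrow> real \<Rightarrow> real" where t: "\<And>i. t i \<in> carrier T_tilde" "\<And>i. t i 0 = 1 / 2 ^ (i + 2)"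
    "\<And>i. t i (1 / 2) = 1 / 2 ^ (i + 1)" by metis
  have lt: "(t i \<circ> u \<circ> tinv (t i)) \<circ> (t j \<circ> v \<circ> tinv (t j)) = (t j \<circ> v \<circ> tinv (t j)) \<circ> (t i \<circ> u \<circ> tinv (t i))"
    if "i < j" "u \<in> ?H" "v \<in> ?H" for i j u v
  proof -
    have "(2::real) ^ (i + 2) \<le> 2 ^ (j + 1)" using that by (intro power_increasing) auto
    then have "(1::real) / 2 ^ (j + 1) \<le> 1 / 2 ^ (i + 2)" by (intro divide_left_mono) auto
    moreover have "(1::real) / 2 ^ (i + 1) \<le> 1" using one_le_power[of "2::real" "i + 1"] by simp
    then have "(1::real) / 2 ^ (i + 1) \<le> 1 / 2 ^ (j + 2) + 1" by (intro add_increasing) auto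
    moreover have "t i \<circ> u \<circ> tinv (t i) \<in> supp_in (1 / 2 ^ (i + 2)) (1 / 2 ^ (i + 1))"
      "t j \<circ> v \<circ> tinv (t j) \<in> supp_in (1 / 2 ^ (j + 2)) (1 / 2 ^ (j + 1))"
      using supp_in_conj[OF that(2) t(1)[of i]] supp_in_conj[OF that(3) t(1)[of j]] t by simp_all
    ultimately show ?thesis using supp_in_commute[OF _ _ arc[of j] arc[of i]] by simp
  qed
  have comm: "(t i \<circ> u \<circ> tinv (t i)) \<circ> (t j \<circ> v \<circ> tinv (t j)) = (t j \<circ> v \<circ> tinv (t j)) \<circ> (t i \<circ> u \<circ> tinv (t i))"
    if "i \<noteq> j" "u \<in> ?H" "v \<in> ?H" for i j u v
    using lt[of i j u v] lt[of j i v u] that by (cases "i < j") auto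
  have add: "?q (f \<circ> g) = ?q f + ?q g" if "f \<in> ?H" "g \<in> ?H" for f g
    using q.homogenization_additive_if_displaced[of t ?H f g] t(1) that comm supp_in_comp by auto
  have inv: "?q (tinv f) = - ?q f" if "f \<in> carrier T_tilde" for f
    using q.homogenization_inv that .
  interpret arc_kernel "{g \<in> carrier T_tilde. ?q g = 0}"
  proof
    show "t \<circ> g \<circ> tinv t \<in> {g \<in> carrier T_tilde. ?q g = 0}"
      if "g \<in> {g \<in> carrier T_tilde. ?q g = 0}" "t \<in> carrier T_tilde" for g t
      using that q.homogenization_conj[of g t] by simp
    \<comment> \<open>On the arc group the homogenization is a homomorphism to the abelian group of
      reals, so it kills commutators.\<close>
    show "f \<circ> g \<circ> tinv f \<circ> tinv g \<in> {g \<in> carrier T_tilde. ?q g = 0}" if fg: "f \<in> ?H" "g \<in> ?H" for f g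
      using fg add supp_in_comp supp_in_inv inv[OF supp_in_T[OF fg(1)]] inv[OF supp_in_T[OF fg(2)]]
        supp_in_T[OF fg(1)] supp_in_T[OF fg(2)] by simp
  qed (auto simp: add inv)
  \<comment> \<open>Two products cost \<open>4 * D\<close> each, and the passage back from the
    homogenization to \<open>N\<close> costs \<open>D\<close>.\<close>
  have "\<bar>N g\<bar> \<le> 9 * D" if "g \<in> carrier T_tilde" "g 0 = 0" for g
  proof -
    obtain a b f f1 f2 where f: "dyadic_arc a b" "f \<in> supp_in a b" "f1 \<in> supp_in 0 (1 / 2)" "f2 \<in> supp_in (1 / 2) 1"
      "g = f \<circ> (f1 \<circ> f2)" using stabilizer_fragmentation[OF \<open>g \<in> carrier T_tilde\<close> \<open>g 0 = 0\<close>] by metis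
    have "dyadic_arc (1 / 2) 1" using dyadic_half[of 1] by (simp add: dyadic_arc_def)
    then have z: "?q f = 0" "?q f1 = 0" "?q f2 = 0"
      using subsetD[OF supp_in_subset f(2)] subsetD[OF supp_in_subset f(3)] subsetD[OF supp_in_subset f(4)]
        f(1) dyadic_arc_half by blast+
    have T: "f \<in> carrier T_tilde" "f1 \<in> carrier T_tilde" "f2 \<in> carrier T_tilde" using f by auto
    have "\<bar>?q (f1 \<circ> f2)\<bar> \<le> 4 * D" using q.homogenization_quasi[of f1 f2] T z by simp
    moreover have "\<bar>?q g - ?q (f1 \<circ> f2)\<bar> \<le> 4 * D" using q.homogenization_quasi[of f "f1 \<circ> f2"] T z f(5) by simp
    moreover have "\<bar>N g - ?q g\<bar> \<le> D" using q.homogenization_near that by blast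
    ultimately show ?thesis by linarith
  qed
  then show ?thesis using that by blast
qed

section \<open>Actions on the line\<close>

lemma translation_comp: "translation a \<circ> translation b = translation (a + b)"
  by (auto simp: translation_def)

lemma translation_zero: "translation 0 = id"
  by (auto simp: translation_def)

lemma translation_int_central: "g \<in> carrier T_tilde \<Longrightarrow> g \<circ> translation (of_int k) = translation (of_int k) \<circ> g"
  using T_tildeD(2)[of g _ k] by (auto simp: translation_def)

locale increasing_action =
  fixes \<rho> :: "(real \<Rightarrow> real) \<Rightarrow> real \<Rightarrow> real"
  assumes mult: "f \<in> carrier T_tilde \<Longrightarrow> g \<in> carrier T_tilde \<Longrightarrow> \<rho> (f \<circ> g) = \<rho> f \<circ> \<rho> g"
    and one: "\<rho> id = id"
    and mono: "g \<in> carrier T_tilde \<Longrightarrow> strict_mono (\<rho> g)"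
begin

lemma less_iff: "g \<in> carrier T_tilde \<Longrightarrow> \<rho> g x < \<rho> g y \<longleftrightarrow> x < y"
  using mono strict_mono_less by blast

lemma le_iff: "g \<in> carrier T_tilde \<Longrightarrow> \<rho> g x \<le> \<rho> g y \<longleftrightarrow> x \<le> y"
  using mono strict_mono_less_eq by blast

lemma inverse [simp]:
  assumes "g \<in> carrier T_tilde"
  shows "\<rho> g (\<rho> (tinv g) x) = x" "\<rho> (tinv g) (\<rho> g x) = x"
  using mult[of g "tinv g"] mult[of "tinv g" g] assms one by (simp_all add: fun_eq_iff)

lemma shift_commute:
  assumes "g \<in> carrier T_tilde"
  shows "\<rho> g (\<rho> (translation (of_int k)) x) = \<rho> (translation (of_int k)) (\<rho> g x)"
  using mult[OF assms translation_T[OF dyadic_of_int[of k]]] mult[OF translation_T[OF dyadic_of_int[of k]] assms]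
    translation_int_central[OF assms, of k] by (metis comp_apply)

lemma shift_add: "a \<in> dyadic \<Longrightarrow> b \<in> dyadic \<Longrightarrow> \<rho> (translation (a + b)) x = \<rho> (translation a) (\<rho> (translation b) x)"
  using mult[OF translation_T translation_T, of a b] by (simp add: translation_comp)

text \<open>If an increasing map moves \<open>p\<close>, its iterates move \<open>p\<close> further
  in the same direction and never bring it back. But the \<open>2 ^ n\<close>-th iterate of the
  translation by \<open>of_int k / 2 ^ n\<close> is an integer translation, which fixes
  \<open>p\<close>.\<close>

lemma translation_fixes:
  assumes p: "\<rho> (translation 1) p = p" and z: "z \<in> dyadic"
  shows "\<rho> (translation z) p = p"
proof -
  have nat: "\<rho> (translation (real n * z)) p = p" if "\<rho> (translation z) p = p" "z \<in> dyadic" for n z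
  proof (induction n)
    case 0
    have "translation (real 0 * z) = id" by (simp add: translation_zero)
    then show ?case by (metis one id_apply)
  next
    case (Suc n)
    have "real n * z \<in> dyadic" using that dyadic_of_int[of "int n"] by (intro dyadic_mult) auto
    then show ?case using shift_add[OF that(2), of "real n * z" p] Suc that(1) by (simp add: algebra_simps)
  qed
  have int: "\<rho> (translation (of_int k)) p = p" for k
  proof (cases "k \<ge> 0")
    case True
    then show ?thesis using nat[of 1 "nat k"] p by simp
  next
    case False
    then have "\<rho> (translation (of_int (- k))) p = p" using nat[of 1 "nat (- k)"] p by simp
    then show ?thesis using shift_add[of "of_int k" "of_int (- k)" p]
      by (simp add: translation_zero one dyadic_minus)
  qed
  obtain k :: int and n :: nat where zk: "z = of_int k / 2 ^ n" using z dyadic_iff by blast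
  define m :: nat where "m = 2 ^ n"
  have m: "real m * z = of_int k" "m > 0" by (simp_all add: m_def zk)
  have d: "real i * z \<in> dyadic" for i using z dyadic_of_int[of "int i"] by (intro dyadic_mult) auto
  have ge: "p < \<rho> (translation (real (Suc i) * z)) p" if "p < \<rho> (translation z) p" for i
  proof (induction i)
    case (Suc i)
    have "p < \<rho> (translation z) p" by fact
    also have "\<dots> < \<rho> (translation z) (\<rho> (translation (real (Suc i) * z)) p)"
      using Suc less_iff[OF translation_T[OF z]] by blast
    also have "\<dots> = \<rho> (translation (real (Suc (Suc i)) * z)) p"
      using shift_add[OF z d[of "Suc i"], of p] by (simp add: algebra_simps)
    finally show ?case .
  qed (use that in simp)
  have le: "\<rho> (translation (real (Suc i) * z)) p < p" if "\<rho> (translation z) p < p" for i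
  proof (induction i)
    case (Suc i)
    have "\<rho> (translation (real (Suc (Suc i)) * z)) p = \<rho> (translation z) (\<rho> (translation (real (Suc i) * z)) p)"
      using shift_add[OF z d[of "Suc i"], of p] by (simp add: algebra_simps)
    also have "\<dots> < \<rho> (translation z) p"
      using Suc less_iff[OF translation_T[OF z]] by blast
    also have "\<dots> < p" by fact
    finally show ?case .
  qed (use that in simp)
  show ?thesis using ge[of "m - 1"] le[of "m - 1"] m int[of k] by force
qed

(* Roots of the central translation act trivially on its fixed point set, hence so does the normal
   subgroup they generate together with the commutators. *)
lemma fixed_point_of_shift_global:
  assumes p: "\<rho> (translation 1) p = p" and g: "g \<in> carrier T_tilde"
  shows "\<rho> g p = p"
proof -
  let ?\<Phi> = "{p. \<rho> (translation 1) p = p}"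
  have inv: "\<rho> g x \<in> ?\<Phi>" if "g \<in> carrier T_tilde" "x \<in> ?\<Phi>" for g x
    using shift_commute[OF that(1), of 1 x] that(2) by simp
  let ?K = "{g \<in> carrier T_tilde. \<forall>x\<in>?\<Phi>. \<rho> g x = x}"
  let ?r = "translation (1 / 2)"
  have half: "(1 / 2 :: real) \<in> dyadic" using dyadic_half[of 1] by simp
  have r: "?r \<in> carrier T_tilde" using translation_T half by blast
  have arc: "dyadic_arc (1 / 2) 1" using half by (simp add: dyadic_arc_def)
  have tr: "translation z \<in> ?K" if "z \<in> dyadic" for z using translation_fixes translation_T that by auto
  have inv_fix: "\<rho> (tinv g) x = x" if "g \<in> ?K" "x \<in> ?\<Phi>" for g x
    using that inverse(2)[of g x] by auto
  have comm: "\<rho> f (\<rho> g x) = \<rho> g (\<rho> f x)"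
    if fg: "f \<in> supp_in 0 (1 / 2)" "g \<in> supp_in 0 (1 / 2)" and x: "x \<in> ?\<Phi>" for f g x
  proof -
    \<comment> \<open>The translation by \<open>1 / 2\<close> acts trivially on
      \<open>?\<Phi>\<close>, so there the conjugate \<open>?f\<close> acts as \<open>f\<close>. It
      is supported in the opposite half circle and therefore commutes with \<open>g\<close>.\<close>
    let ?f = "?r \<circ> f \<circ> tinv ?r"
    have T: "f \<in> carrier T_tilde" "g \<in> carrier T_tilde" "?f \<in> carrier T_tilde" using fg r by auto
    have "?f \<in> supp_in (1 / 2) 1" using supp_in_conj[OF fg(1) r] by (simp add: translation_def)
    then have "g \<circ> ?f = ?f \<circ> g" using supp_in_commute[OF fg(2) _ dyadic_arc_half arc] by simp
    then have c: "\<rho> g (\<rho> ?f y) = \<rho> ?f (\<rho> g y)" for y using mult T by (metis comp_apply)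
    have "\<rho> ?f y = \<rho> f y" if y: "y \<in> ?\<Phi>" for y
    proof -
      have "\<rho> ?f y = \<rho> ?r (\<rho> f (\<rho> (tinv ?r) y))" using mult T r by simp
      also have "\<rho> (tinv ?r) y = y" using inv_fix[OF tr[OF half] y] .
      also have "\<rho> ?r (\<rho> f y) = \<rho> f y" using tr[OF half] inv[OF T(1) y] by blast
      finally show ?thesis .
    qed
    then show ?thesis using c[of x] x inv[OF T(2) x] by simp
  qed
  have "?K = carrier T_tilde"
  proof (rule normal_subgroup_eq_T_tilde)
    show "t \<circ> g \<circ> tinv t \<in> ?K" if gt: "g \<in> ?K" "t \<in> carrier T_tilde" for g t
    proof (intro CollectI conjI ballI)
      show "t \<circ> g \<circ> tinv t \<in> carrier T_tilde" using gt by simp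
      fix x assume x: "x \<in> ?\<Phi>"
      have "\<rho> (t \<circ> g \<circ> tinv t) x = \<rho> t (\<rho> g (\<rho> (tinv t) x))" using mult gt by simp
      also have "\<rho> g (\<rho> (tinv t) x) = \<rho> (tinv t) x" using gt inv[OF T.inv_closed[OF gt(2)] x] by blast
      also have "\<rho> t (\<rho> (tinv t) x) = x" using gt by simp
      finally show "\<rho> (t \<circ> g \<circ> tinv t) x = x" .
    qed
    show "f \<circ> g \<in> ?K" if "f \<in> ?K" "g \<in> ?K" for f g using that mult by simp
    show "tinv f \<in> ?K" if "f \<in> ?K" for f using that inv_fix[OF that] by simp
    show "f \<circ> g \<circ> tinv f \<circ> tinv g \<in> ?K" if fg: "f \<in> supp_in 0 (1 / 2)" "g \<in> supp_in 0 (1 / 2)" for f g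
    proof (intro CollectI conjI ballI)
      have T: "f \<in> carrier T_tilde" "g \<in> carrier T_tilde" using fg by auto
      then show "f \<circ> g \<circ> tinv f \<circ> tinv g \<in> carrier T_tilde" by simp
      fix x assume x: "x \<in> ?\<Phi>"
      have "\<rho> (tinv f) (\<rho> (tinv g) x) \<in> ?\<Phi>" using inv T x by simp
      then have "\<rho> f (\<rho> g (\<rho> (tinv f) (\<rho> (tinv g) x))) = \<rho> g (\<rho> f (\<rho> (tinv f) (\<rho> (tinv g) x)))"
        using comm fg by blast
      then show "\<rho> (f \<circ> g \<circ> tinv f \<circ> tinv g) x = x" using mult T by simp
    qed
  qed (use tr in auto)
  then show ?thesis using p g by blast
qed

end

section \<open>Actions in which the central translation moves every point upwards\<close>

locale positive_action = increasing_action +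
  assumes shift_pos: "x < \<rho> (translation 1) x"
begin

abbreviation shift :: "int \<Rightarrow> real \<Rightarrow> real" where
  "shift k \<equiv> \<rho> (translation (of_int k))"

lemma shift_T: "translation (of_int k) \<in> carrier T_tilde"
  by (rule translation_T) simp

lemma shift_plus: "shift (k + l) x = shift k (shift l x)"
  using shift_add[of "of_int k" "of_int l" x] by simp

lemma shift_0: "shift 0 x = x"
  by (simp add: translation_zero one)

lemma shift_less: "k < l \<Longrightarrow> shift k x < shift l x"
proof -
  have *: "shift k x < shift (k + 1 + int n) x" for k n
  proof (induction n)
    case 0
    then show ?case using shift_pos[of "shift k x"] shift_plus[of 1 k x] by (simp add: add.commute)
  next
    case (Suc n)
    also have "shift (k + 1 + int n) x < shift (k + 1 + int (Suc n)) x"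
      using shift_pos[of "shift (k + 1 + int n) x"] shift_plus[of 1 "k + 1 + int n" x] by (simp add: algebra_simps)
    finally show ?case .
  qed
  assume "k < l"
  then show ?thesis using *[of k "nat (l - k - 1)"] by simp
qed

lemma shift_less_iff: "shift k x < shift l x \<longleftrightarrow> k < l"
  using shift_less[of k l x] shift_less[of l k x] by (metis linorder_neqE_linordered_idom order_less_asym)

text \<open>The supremum \<open>s\<close> of a bounded orbit would satisfy
  \<open>shift (- 1) s < s\<close>, so some orbit point lies above \<open>shift (- 1) s\<close>; its
  successor then lies above \<open>s\<close>.\<close>

lemma shift_unbounded_above: "\<exists>k. y < shift k x"
proof (rule ccontr)
  assume "\<not> ?thesis"
  then have bdd: "bdd_above (range (\<lambda>k. shift k x))" by (auto simp: not_less intro: bdd_aboveI[of _ y])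
  define s where "s = (SUP k. shift k x)"
  have "shift (- 1) s < s" using shift_less[of "- 1" 0 s] shift_0 by simp
  then obtain k where "shift (- 1) s < shift k x" unfolding s_def using less_cSUP_iff[OF _ bdd] by auto
  then have "shift 1 (shift (- 1) s) < shift 1 (shift k x)" using less_iff shift_T by blast
  then have "s < shift (1 + k) x" using shift_plus[of 1 "- 1" s] shift_plus[of 1 k x] shift_0 by simp
  moreover have "shift (1 + k) x \<le> s" unfolding s_def using bdd by (rule cSUP_upper[OF UNIV_I])
  ultimately show False by simp
qed

lemma shift_unbounded_below: "\<exists>k. shift k x < y"
proof -
  obtain k where "x < shift k y" using shift_unbounded_above by blast
  then have "shift (- k) x < shift (- k) (shift k y)" using less_iff shift_T by blast
  then have "shift (- k) x < y" using shift_plus[of "- k" k y] shift_0 by simp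
  then show ?thesis ..
qed

lemma level_ex: "\<exists>k. shift k 0 \<le> y \<and> y < shift (k + 1) 0"
proof -
  obtain a b where a: "shift a 0 < y" and b: "y < shift b 0"
    using shift_unbounded_above shift_unbounded_below by blast
  let ?A = "{k \<in> {a..b}. shift k 0 \<le> y}"
  have "a < b" using a b shift_less_iff[of a 0 b] by linarith
  then have "a \<in> ?A" using a by simp
  moreover have "finite ?A" by (rule finite_subset[of _ "{a..b}"]) auto
  ultimately have A: "finite ?A" "?A \<noteq> {}" by blast+
  have "y < shift (Max ?A + 1) 0"
  proof (rule ccontr)
    assume "\<not> ?thesis"
    then have le: "shift (Max ?A + 1) 0 \<le> y" by simp
    then have "Max ?A + 1 < b" using b shift_less_iff[of "Max ?A + 1" 0 b] by linarith
    then have "Max ?A + 1 \<in> ?A" using le Max_in[OF A] by simp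
    then show False using Max_ge[OF A(1)] by fastforce
  qed
  then show ?thesis using Max_in[OF A] by blast
qed

text \<open>The integer part relative to the fundamental domains of the shift; by
  \<open>shift_less_iff\<close> the chosen integer is unique.\<close>

definition level :: "real \<Rightarrow> int" where
  "level y = (SOME k. shift k 0 \<le> y \<and> y < shift (k + 1) 0)"

lemma level: "shift (level y) 0 \<le> y" "y < shift (level y + 1) 0"
  using someI_ex[OF level_ex[of y]] unfolding level_def by auto

text \<open>Since \<open>\<rho> f\<close> commutes with the shifts, it maps the fundamental domain
  of index \<open>b\<close> between \<open>shift (a + b) 0\<close> and
  \<open>shift (a + b + 2) 0\<close>, where \<open>a\<close> is the level of
  \<open>\<rho> f 0\<close>. With \<open>b\<close> the level of \<open>\<rho> g 0\<close>, the level
  for the product is \<open>a + b\<close> or \<open>a + b + 1\<close>.\<close>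

lemma level_quasimorphism: "quasimorphism T_tilde (\<lambda>g. of_int (level (\<rho> g 0))) 1"
proof -
  have "\<bar>level (\<rho> (f \<circ> g) 0) - level (\<rho> f 0) - level (\<rho> g 0)\<bar> \<le> 1"
    if fg: "f \<in> carrier T_tilde" "g \<in> carrier T_tilde" for f g
  proof -
    define a b c where abc: "a = level (\<rho> f 0)" "b = level (\<rho> g 0)" "c = level (\<rho> (f \<circ> g) 0)"
    note l = level[of "\<rho> f 0", folded abc] level[of "\<rho> g 0", folded abc] level[of "\<rho> (f \<circ> g) 0", folded abc]
    have eq: "\<rho> (f \<circ> g) 0 = \<rho> f (\<rho> g 0)" using mult fg by simp
    have "shift (b + a) 0 \<le> shift b (\<rho> f 0)" using l(1) shift_plus le_iff shift_T by simp
    also have "\<dots> = \<rho> f (shift b 0)" using shift_commute fg by simp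
    also have "\<dots> \<le> \<rho> (f \<circ> g) 0" unfolding eq using l(3) le_iff fg by simp
    also have "\<dots> < shift (c + 1) 0" by (rule l(6))
    finally have 1: "b + a < c + 1" by (simp only: shift_less_iff)
    have "shift c 0 \<le> \<rho> (f \<circ> g) 0" by (rule l(5))
    also have "\<dots> < \<rho> f (shift (b + 1) 0)" unfolding eq using l(4) less_iff fg by blast
    also have "\<dots> = shift (b + 1) (\<rho> f 0)" using shift_commute fg by blast
    also have "\<dots> < shift (b + 1) (shift (a + 1) 0)" using l(2) less_iff shift_T by blast
    also have "\<dots> = shift (b + 1 + (a + 1)) 0" by (simp only: shift_plus)
    finally have "c < b + 1 + (a + 1)" by (simp only: shift_less_iff)
    with 1 show ?thesis unfolding abc[symmetric] by linarith
  qed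
  then have "\<bar>real_of_int (level (\<rho> (f \<circ> g) 0)) - of_int (level (\<rho> f 0)) - of_int (level (\<rho> g 0))\<bar> \<le> 1"
    if "f \<in> carrier T_tilde" "g \<in> carrier T_tilde" for f g using that by force
  then show ?thesis by unfold_locales simp
qed

lemma stabilizer_fixed_point:
  obtains p where "\<And>g. g \<in> carrier T_tilde \<Longrightarrow> g 0 = 0 \<Longrightarrow> \<rho> g p = p"
proof -
  obtain C where C: "\<And>g. g \<in> carrier T_tilde \<Longrightarrow> g 0 = 0 \<Longrightarrow> \<bar>real_of_int (level (\<rho> g 0))\<bar> \<le> C"
    using quasimorphism_bounded_on_stabilizer[OF level_quasimorphism] by blast
  let ?H = "{g \<in> carrier T_tilde. g 0 = 0}"
  let ?O = "(\<lambda>g. \<rho> g 0) ` ?H"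
  have bdd: "bdd_above ?O"
  proof (rule bdd_aboveI)
    fix y assume "y \<in> ?O"
    then obtain g where g: "g \<in> ?H" "y = \<rho> g 0" by blast
    then have "level y < \<lceil>C\<rceil> + 1" using C[of g] by simp linarith
    then have "level y + 1 \<le> \<lceil>C\<rceil> + 1" by simp
    then have "shift (level y + 1) 0 \<le> shift (\<lceil>C\<rceil> + 1) 0" using shift_less[of "level y + 1" "\<lceil>C\<rceil> + 1" 0]
      by (cases "level y + 1 = \<lceil>C\<rceil> + 1") auto
    then show "y \<le> shift (\<lceil>C\<rceil> + 1) 0" using level(2)[of y] by linarith
  qed
  have ne: "?O \<noteq> {}" by (auto intro: exI[of _ id])
  \<comment> \<open>The orbit is invariant under the stabilizer, which gives this inequality for
    every \<open>g\<close> in it; applied to \<open>tinv g\<close> it yields the opposite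
    one.\<close>
  have le: "Sup ?O \<le> \<rho> g (Sup ?O)" if g: "g \<in> ?H" for g
  proof (rule cSup_least[OF ne])
    fix y assume "y \<in> ?O"
    then obtain f where f: "f \<in> ?H" "y = \<rho> f 0" by blast
    have gT: "g \<in> carrier T_tilde" "g 0 = 0" using g by simp_all
    have "tinv g 0 = 0" using tinv_apply(1)[OF gT(1), of 0] unfolding gT(2) .
    then have "tinv g \<circ> f \<in> ?H" using f g by simp
    then have "\<rho> (tinv g \<circ> f) 0 \<le> Sup ?O" using bdd by (intro cSup_upper) auto
    then have "\<rho> (tinv g) y \<le> Sup ?O" using f g mult by simp
    then have "\<rho> g (\<rho> (tinv g) y) \<le> \<rho> g (Sup ?O)" using g le_iff by blast
    then show "y \<le> \<rho> g (Sup ?O)" using g by simp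
  qed
  have "\<rho> g (Sup ?O) = Sup ?O" if "g \<in> carrier T_tilde" "g 0 = 0" for g
  proof -
    have "tinv g 0 = 0" using that by (metis tinv_apply(1))
    then have "tinv g \<in> ?H" using that by simp
    then have "\<rho> g (Sup ?O) \<le> \<rho> g (\<rho> (tinv g) (Sup ?O))" using le le_iff that by blast
    then show ?thesis using le[of g] that by simp
  qed
  then show ?thesis using that by blast
qed

lemma semi_conjugacy:
  obtains h :: "real \<Rightarrow> real" where "mono h" "\<And>K. compact K \<Longrightarrow> compact (closure (h -` K))"
    "\<And>g. g \<in> carrier T_tilde \<Longrightarrow> h \<circ> \<rho> g = g \<circ> h"
proof -
  obtain p where p: "\<And>g. g \<in> carrier T_tilde \<Longrightarrow> g 0 = 0 \<Longrightarrow> \<rho> g p = p"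
    using stabilizer_fixed_point by blast
  \<comment> \<open>Translations give a definite element carrying 0 to \<open>z\<close>. Any other
    such element differs from it by one that stabilizes 0 and so fixes \<open>p\<close>; hence the
    equivariance under the whole group.\<close>
  define j where "j z = \<rho> (translation z) p" for z
  have j_equiv: "\<rho> g (j z) = j (g z)" if g: "g \<in> carrier T_tilde" and z: "z \<in> dyadic" for g z
  proof -
    have gz: "g z \<in> dyadic" using T_dyadic g z by blast
    define s where "s = translation (- g z) \<circ> (g \<circ> translation z)"
    have s: "s \<in> carrier T_tilde" "s 0 = 0" unfolding s_def
      using g translation_T z gz dyadic_minus by (simp_all add: translation_def)
    have "translation (g z) \<circ> s = g \<circ> translation z" by (auto simp: s_def translation_def)
    then have "\<rho> (translation (g z)) (\<rho> s p) = \<rho> g (\<rho> (translation z) p)"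
      using mult[OF translation_T[OF gz] s(1)] mult[OF g translation_T[OF z]] by (metis comp_apply)
    then show ?thesis using p[OF s] by (simp add: j_def)
  qed
  have j0: "j 0 = p" by (simp add: j_def translation_zero one)
  have half: "(1 / 2 :: real) \<in> dyadic" using dyadic_half[of 1] by simp
  \<comment> \<open>If the half translation did not raise \<open>p\<close>, neither would its
    square, against \<open>shift_pos\<close>.\<close>
  have j_half: "p < j (1 / 2)"
  proof (rule ccontr)
    assume "\<not> ?thesis"
    then have le: "\<rho> (translation (1 / 2)) p \<le> p" by (simp add: j_def)
    have "\<rho> (translation 1) p = \<rho> (translation (1 / 2)) (\<rho> (translation (1 / 2)) p)"
      using shift_add[OF half half, of p] by simp
    also have "\<dots> \<le> \<rho> (translation (1 / 2)) p" using le le_iff[OF translation_T[OF half]] by blast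
    finally show False using shift_pos[of p] le by linarith
  qed
  \<comment> \<open>The stabilizer of 0 moves \<open>1 / 2\<close> to any dyadic \<open>d\<close> in
    \<open>(0, 1)\<close> and fixes \<open>p\<close>, so the comparison at \<open>1 / 2\<close>
    yields all the others.\<close>
  have j_small: "p < j d" if d: "d \<in> dyadic" "0 < d" "d < 1" for d
  proof -
    obtain a b g where g: "g \<in> supp_in a b" "g (1 / 2) = d" "g 0 = 0" using half_transitive[OF d] by metis
    then have gT: "g \<in> carrier T_tilde" by blast
    have "\<rho> g p < \<rho> g (j (1 / 2))" using j_half less_iff[OF gT] by blast
    then show ?thesis using p[OF gT g(3)] j_equiv[OF gT half] g(2) by simp
  qed
  have j_near: "j x < j y" if "x \<in> dyadic" "y \<in> dyadic" "x < y" "y < x + 1" for x y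
  proof -
    have "p < j (y - x)" using j_small that by (simp add: dyadic_diff)
    then have "\<rho> (translation x) p < \<rho> (translation x) (j (y - x))" using less_iff translation_T that by blast
    then show ?thesis using j_equiv[OF translation_T, of x "y - x"] that by (simp add: j_def dyadic_diff translation_def)
  qed
  \<comment> \<open>Inserting midpoints halves the distance until it is below 1.\<close>
  have "j x < j y" if "x \<in> dyadic" "y \<in> dyadic" "x < y" "y - x < 2 ^ n" for x y n
    using that
  proof (induction n arbitrary: x y)
    case 0
    then show ?case using j_near by simp
  next
    case (Suc n)
    have "(x + y) / 2 \<in> dyadic" using Suc.prems by (intro dyadic_mid)
    then have "j x < j ((x + y) / 2)" "j ((x + y) / 2) < j y"
      using Suc.prems by (auto intro!: Suc.IH simp: field_simps)
    then show ?case by simp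
  qed
  moreover have "\<exists>n. y - x < 2 ^ n" for x y :: real using real_arch_pow[of 2] by simp
  ultimately have j_mono: "j x < j y" if "x \<in> dyadic" "y \<in> dyadic" "x < y" for x y using that by blast
  have j_int: "j (of_int k) = shift k p" for k by (simp add: j_def)
  define A where "A y = {x \<in> dyadic. j x \<le> y}" for y
  \<comment> \<open>\<open>h\<close> is a left inverse of \<open>j\<close> on the dyadic numbers,
    and it is constant on the gaps of the image of \<open>j\<close>.\<close>
  define h where "h y = Sup (A y)" for y
  have A_ne: "A y \<noteq> {}" for y
  proof -
    obtain k where "shift k p < y" using shift_unbounded_below by blast
    then have "of_int k \<in> A y" by (simp add: A_def j_int)
    then show ?thesis by blast
  qed
  have A_less: "x < z" if "x \<in> A y" "z \<in> dyadic" "y < j z" for x y z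
    using that j_mono[of z x] unfolding A_def by (cases "z = x") force+
  have A_bdd: "bdd_above (A y)" for y
  proof -
    obtain k where "y < shift k p" using shift_unbounded_above by blast
    then show ?thesis using A_less[of _ y "of_int k"] by (intro bdd_aboveI[of _ "of_int k"]) (auto simp: j_int less_imp_le)
  qed
  have "mono h" unfolding h_def
    by (intro monoI cSup_subset_mono A_ne A_bdd) (auto simp: A_def)
  moreover have "compact (closure (h -` K))" if K: "compact K" for K
  proof -
    obtain B where B: "\<And>x. x \<in> K \<Longrightarrow> \<bar>x\<bar> \<le> B" using compact_imp_bounded[OF K] by (auto simp: bounded_iff)
    \<comment> \<open>\<open>n\<close> is strictly larger than \<open>B\<close>: outside
      \<open>[shift (- n) p, shift n p]\<close> the absolute value of \<open>h\<close> is at least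
      \<open>n\<close>, so such points are not mapped into \<open>K\<close>.\<close>
    define n where "n = \<lceil>B\<rceil> + 1"
    have n: "B < of_int n" unfolding n_def by linarith
    have "h -` K \<subseteq> {shift (- n) p..shift n p}"
    proof
      fix y assume "y \<in> h -` K"
      then have hy: "\<bar>h y\<bar> \<le> B" using B by auto
      have "\<not> y < shift (- n) p"
      proof
        assume "y < shift (- n) p"
        then have "h y \<le> of_int (- n)" unfolding h_def
          using A_less[of _ y "of_int (- n)"] dyadic_of_int[of "- n"] by (intro cSup_least A_ne) (simp add: j_int[of "- n", simplified] less_imp_le)
        then show False using hy n by simp
      qed
      moreover have "\<not> shift n p < y"
      proof
        assume "shift n p < y"
        then have "of_int n \<in> A y" by (simp add: A_def j_int)
        then have "of_int n \<le> h y" unfolding h_def using A_bdd by (rule cSup_upper)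
        then show False using hy n by simp
      qed
      ultimately show "y \<in> {shift (- n) p..shift n p}" by simp
    qed
    then have "bounded (h -` K)" using bounded_subset[OF bounded_closed_interval] by blast
    then show ?thesis by (simp add: compact_closure)
  qed
  moreover have "h \<circ> \<rho> g = g \<circ> h" if g: "g \<in> carrier T_tilde" for g
  proof
    fix y
    have "A (\<rho> g y) = g ` A y"
    proof (intro equalityI subsetI)
      fix x assume x: "x \<in> A (\<rho> g y)"
      have xd: "tinv g x \<in> dyadic" using x T_dyadic[of "tinv g" x] g by (simp add: A_def)
      have "\<rho> g (j (tinv g x)) \<le> \<rho> g y" using j_equiv[OF g xd] x g by (simp add: A_def)
      then have "tinv g x \<in> A y" using xd le_iff[OF g] by (simp add: A_def)
      then show "x \<in> g ` A y" using g by (intro image_eqI[of _ _ "tinv g x"]) auto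
    next
      fix x assume "x \<in> g ` A y"
      then obtain z where z: "z \<in> dyadic" "j z \<le> y" "x = g z" by (auto simp: A_def)
      then have "j x \<le> \<rho> g y" using j_equiv[OF g z(1)] le_iff[OF g, of "j z" y] by simp
      then show "x \<in> A (\<rho> g y)" using T_dyadic[OF g z(1)] z by (simp add: A_def)
    qed
    moreover have "g (Sup (A y)) = Sup (g ` A y)"
    proof (rule continuous_at_Sup_mono)
      show "mono g" using T_tildeD(6)[OF g] by (rule strict_mono_mono)
      have "isCont g (Sup (A y))" using T_tildeD(4)[OF g] by (simp add: continuous_on_eq_continuous_at)
      then show "continuous (at_left (Sup (A y))) g" by (rule continuous_at_imp_continuous_at_within)
    qed (rule A_ne A_bdd)+
    ultimately show "(h \<circ> \<rho> g) y = (g \<circ> h) y" by (simp add: h_def)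
  qed
  ultimately show ?thesis using that by blast
qed

end

text \<open>Orientation is a homomorphism to a group of order two. It kills the dyadic translations,
  each being the square of the translation by half the amount, and it kills commutators.\<close>

lemma T_tilde_action_increasing:
  assumes hom: "\<rho> \<in> hom T_tilde homeo_line"
  shows "increasing_action \<rho>"
proof -
  have mult: "\<rho> (f \<circ> g) = \<rho> f \<circ> \<rho> g" if "f \<in> carrier T_tilde" "g \<in> carrier T_tilde" for f g
    using hom_mult[OF hom that] by (simp add: homeo_line_def)
  have one: "\<rho> id = id"
    using group_hom.hom_one[of T_tilde homeo_line \<rho>] hom T.is_group group_homeo_line
    by (simp add: group_hom_def group_hom_axioms_def homeo_line_def)
  let ?s = "\<lambda>g. strict_mono (\<rho> g)"
  have alt: "?s g \<or> (\<forall>x y. x < y \<longrightarrow> \<rho> g y < \<rho> g x)" if g: "g \<in> carrier T_tilde" for g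
  proof -
    obtain f where f: "homeomorphism UNIV UNIV (\<rho> g) f"
      using hom_in_carrier[OF hom g] by (auto simp: homeo_line_def)
    then have "inj (\<rho> g)" by (metis UNIV_I homeomorphism_apply1 injI)
    moreover have "continuous_on UNIV (\<rho> g)" using f by (simp add: homeomorphism_def)
    ultimately have "strict_mono (\<rho> g) \<or> strict_antimono_on UNIV (\<rho> g)"
      using injective_eq_monotone_map[of UNIV "\<rho> g"] is_interval_univ by blast
    then show ?thesis by (auto simp: monotone_on_def)
  qed
  have s: "?s (f \<circ> g) \<longleftrightarrow> (?s f \<longleftrightarrow> ?s g)" if fg: "f \<in> carrier T_tilde" "g \<in> carrier T_tilde" for f g
    using alt[OF fg(1)] alt[OF fg(2)] mult[OF fg]
    by (auto simp: strict_mono_def) (metis less_asym zero_less_one)+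
  have s_id: "?s id" unfolding one by (simp add: strict_mono_def)
  have s_inv: "?s (tinv f) \<longleftrightarrow> ?s f" if "f \<in> carrier T_tilde" for f
    using s[of "tinv f" f] that s_id by simp
  have "{g \<in> carrier T_tilde. ?s g} = carrier T_tilde"
  proof (rule normal_subgroup_eq_T_tilde)
    show "translation z \<in> {g \<in> carrier T_tilde. ?s g}" if "z \<in> dyadic" for z
      using s[OF translation_T translation_T, OF dyadic_half dyadic_half, OF that that] translation_T[OF that]
      by (simp add: translation_comp)
    show "f \<circ> g \<circ> tinv f \<circ> tinv g \<in> {g \<in> carrier T_tilde. ?s g}"
      if "f \<in> supp_in 0 (1 / 2)" "g \<in> supp_in 0 (1 / 2)" for f g
      using supp_in_T[OF that(1)] supp_in_T[OF that(2)] s s_inv by auto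
  qed (use s s_inv in auto)
  then show ?thesis using mult one by unfold_locales blast+
qed

lemma increasing_action_flip:
  assumes "increasing_action \<rho>"
  shows "increasing_action (\<lambda>g x. - \<rho> g (- x))"
proof -
  interpret increasing_action \<rho> by fact
  show ?thesis
  proof
    show "(\<lambda>x. - \<rho> (f \<circ> g) (- x)) = (\<lambda>x. - \<rho> f (- x)) \<circ> (\<lambda>x. - \<rho> g (- x))"
      if "f \<in> carrier T_tilde" "g \<in> carrier T_tilde" for f g using mult that by (simp add: fun_eq_iff)
    show "(\<lambda>x. - \<rho> id (- x)) = id" unfolding one by (simp add: fun_eq_iff)
    show "strict_mono (\<lambda>x. - \<rho> g (- x))" if "g \<in> carrier T_tilde" for g
      using less_iff[OF that] by (intro strict_monoI) simp
  qed
qed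

theorem theorem8p7:
  fixes \<rho> :: "(real \<Rightarrow> real) \<Rightarrow> real \<Rightarrow> real"
  assumes "\<rho> \<in> hom T_tilde homeo_line"
    and "no_global_fixed_point T_tilde \<rho>"
  shows "semi_conjugate T_tilde \<rho> (\<lambda>g. g)"
proof -
  interpret increasing_action \<rho> by (rule T_tilde_action_increasing) fact
  have homeo: "\<rho> g \<in> carrier homeo_line" if "g \<in> carrier T_tilde" for g
    using hom_in_carrier[OF assms(1) that] .
  let ?\<tau> = "\<rho> (translation 1)"
  have no_fix: "?\<tau> x \<noteq> x" for x
    using fixed_point_of_shift_global[of x] assms(2) unfolding no_global_fixed_point_def by blast
  have "continuous_on UNIV ?\<tau>"
    using homeo[OF translation_T[of 1]] by (auto simp: homeo_line_def homeomorphism_def)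
  then have cont: "continuous_on UNIV (\<lambda>x. ?\<tau> x - x)" by (intro continuous_intros)
  have sign: "(\<forall>x. x < ?\<tau> x) \<or> (\<forall>x. ?\<tau> x < x)"
  proof (rule ccontr)
    assume "\<not> ?thesis"
    then obtain x y where "?\<tau> x - x \<le> 0" "0 \<le> ?\<tau> y - y" by (auto simp: not_less)
    moreover have "connected (range (\<lambda>x. ?\<tau> x - x))"
      by (rule connected_continuous_image[OF cont connected_UNIV])
    ultimately have "0 \<in> range (\<lambda>x. ?\<tau> x - x)" using connectedD_interval by blast
    then show False using no_fix by (metis (mono_tags, lifting) eq_iff_diff_eq_0 rangeE)
  qed
  have "\<exists>h :: real \<Rightarrow> real. (mono h \<or> antimono h) \<and> (\<forall>K. compact K \<longrightarrow> compact (closure (h -` K))) \<and>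
    (\<forall>g\<in>carrier T_tilde. h \<circ> \<rho> g = g \<circ> h)"
    using sign
  proof
    assume "\<forall>x. x < ?\<tau> x"
    then interpret positive_action \<rho> by unfold_locales blast
    show ?thesis using semi_conjugacy by metis
  next
    assume neg: "\<forall>x. ?\<tau> x < x"
    interpret flip: increasing_action "\<lambda>g x. - \<rho> g (- x)"
      by (rule increasing_action_flip) (rule increasing_action_axioms)
    interpret flip: positive_action "\<lambda>g x. - \<rho> g (- x)"
    proof
      show "x < - ?\<tau> (- x)" for x using neg[rule_format, of "- x"] by simp
    qed
    obtain h where h: "mono h" "\<And>K. compact K \<Longrightarrow> compact (closure (h -` K))"
      "\<And>g. g \<in> carrier T_tilde \<Longrightarrow> h \<circ> (\<lambda>x. - \<rho> g (- x)) = g \<circ> h" using flip.semi_conjugacy by metis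
    \<comment> \<open>Undoing the negation turns the monotone map into a non-increasing one, which a
      semi-conjugacy admits.\<close>
    let ?h = "\<lambda>x. h (- x)"
    have "antimono ?h" using h(1) by (simp add: mono_def antimono_def)
    moreover have "compact (closure (?h -` K))" if "compact K" for K
    proof -
      have "bounded (h -` K)" using h(2)[OF that] by (simp add: compact_closure)
      then have "bounded (uminus ` (h -` K))" by (simp add: bounded_uminus)
      moreover have "?h -` K = uminus ` (h -` K)" 
      proof (intro equalityI subsetI)
        fix x assume "x \<in> ?h -` K"
        then show "x \<in> uminus ` (h -` K)" by (intro image_eqI[of _ _ "- x"]) auto
      qed auto
      ultimately show ?thesis by (simp add: compact_closure)
    qed
    moreover have "?h \<circ> \<rho> g = g \<circ> ?h" if "g \<in> carrier T_tilde" for g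
    proof
      fix x
      show "(?h \<circ> \<rho> g) x = (g \<circ> ?h) x" using fun_cong[OF h(3)[OF that], of "- x"] by simp
    qed
    ultimately show ?thesis by (intro exI[of _ ?h]) blast
  qed
  moreover have "\<rho> \<in> hom T_tilde homeo_line_plus"
    using homeo mono mult by (auto simp: hom_def homeo_line_plus_def homeo_line_def)
  moreover have "(\<lambda>g. g) \<in> hom T_tilde homeo_line_plus"
    using T_tilde_subset_plus by (auto simp: hom_def T_tilde_def homeo_line_plus_def)
  ultimately show ?thesis unfolding semi_conjugate_def by blast
qed

end
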